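(* Let $H$ be a Hilbert space, and let $A$ be a self-adjoint nonnegative operator on $H$ with dense domain $D(A)$. Let $R>0$, let $B_{R}:=\{u\in D(A^{1/2}):|u|_{D(A^{1/2})}<R\}$, and let $f:B_{R}\to H$ be a function. Assume that (i) the spectrum of $A$ is a finite set or an increasing sequence of eigenvalues; (ii) there exist $p>0$ and $L\geq 0$ such that $$|f(u)-f(v)|\leq L\left(|u|_{D(A^{1/2})}^{p}+|v|_{D(A^{1/2})}^{p}\right)|u-v|_{D(A^{1/2})}\qquad\forall u,v\in B_{R},$$ and in addition $f(0)=0$. Let $\lambda>0$ be an eigenvalue of $A$, and let $H=H_{-}\oplus H_{+}$ be the orthogonal decomposition of $H$ where $H_{-}$ is the closure of the subspace generated by all eigenvectors of $A$ relative to eigenvalues less than or equal to $\lambda$, and $H_{+}$ is the closure of the subspace generated by all eigenvectors of $A$ relative to eigenvalues greater than $\lambda$. Then there exists $r_{0}>0$ with the following property. For every eigenvector $v_{0}$ relative to $\lambda$ and every $w_{0}\in H_{+}\cap D(A^{1/2})$ such that $$|v_{0}|_{D(A^{1/2})}+|w_{0}|_{D(A^{1/2})}\leq r_{0},$$ there exists $w_{1}\in H_{-}$ such that $u_{0}:=w_{0}+w_{1}$ lies in $B_R$, the unique local solution of $u'(t)+Au(t)=f(u(t))$, $u(0)=u_{0}$, is actually global (defined for all $t\geq0$), and $$\lim_{t\to+\infty}\left|e^{\lambda t}u(t)-v_{0}\right|_{D(A^{1/2})}=0.$$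
   Context: $|x|$ and $\langle x,y\rangle$ denote the norm and scalar product of $H$. Nonnegative means $\langle Au,u\rangle\geq 0$ for all $u\in D(A)$; $A^{1/2}$ is defined by spectral calculus, and $|u|_{D(A^{1/2})}=(|u|^{2}+|A^{1/2}u|^{2})^{1/2}$. A solution of $u'+Au=f(u)$, $u(0)=u_0$, on an interval $[0,T_* )$ is a function with values in $B_R$ such that for every $T<T_*$: $u\in C^{0}([0,T],D(A^{1/2}))\cap W^{1,2}((0,T),H)\cap L^{2}((0,T),D(A))$, $t\mapsto|A^{1/2}u(t)|^{2}$ is absolutely continuous on $[0,T]$, $u(0)=u_0$, and the equation holds for almost every $t$. It is classical that, if $f$ is Lipschitz continuous from $B_{R}$ (with the $D(A^{1/2})$ norm) to $H$, as is the case under (ii), then for every $u_{0}\in B_{R}$ there is a unique such solution on a maximal interval $[0,T_{*})$, where either $T_{*}=+\infty$ or $\lim_{t\to T_{*}^{-}}|u(t)|_{D(A^{1/2})}=R$. *)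

theory Defs
  imports "HOL-Analysis.Analysis"
begin

section \<open>Unbounded self-adjoint operators\<close>

text \<open>An operator on \<open>H\<close> is a pair of its domain \<open>D\<close> and a total function \<open>A\<close>, whose values
  outside \<open>D\<close> are irrelevant. Hilbert spaces are real, and need not be separable.\<close>

definition linear_operator :: "'a::real_inner set \<Rightarrow> ('a \<Rightarrow> 'a) \<Rightarrow> bool" where
  "linear_operator D A \<longleftrightarrow> subspace D \<and>
     (\<forall>x\<in>D. \<forall>y\<in>D. A (x + y) = A x + A y) \<and> (\<forall>c. \<forall>x\<in>D. A (c *\<^sub>R x) = c *\<^sub>R A x)"

definition adjoint_domain :: "'a::real_inner set \<Rightarrow> ('a \<Rightarrow> 'a) \<Rightarrow> 'a set" where
  "adjoint_domain D A = {y. \<exists>z. \<forall>x\<in>D. A x \<bullet> y = x \<bullet> z}"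

text \<open>The last two conjuncts say that the adjoint has domain \<open>D\<close> and coincides with \<open>A\<close> there.\<close>

definition selfadjoint_operator :: "'a::real_inner set \<Rightarrow> ('a \<Rightarrow> 'a) \<Rightarrow> bool" where
  "selfadjoint_operator D A \<longleftrightarrow> linear_operator D A \<and> closure D = UNIV \<and>
     adjoint_domain D A = D \<and> (\<forall>x\<in>D. \<forall>y\<in>D. A x \<bullet> y = x \<bullet> A y)"

definition nonnegative_operator :: "'a::real_inner set \<Rightarrow> ('a \<Rightarrow> 'a) \<Rightarrow> bool" where
  "nonnegative_operator D A \<longleftrightarrow> (\<forall>u\<in>D. A u \<bullet> u \<ge> 0)"

definition eigenvector :: "'a::real_inner set \<Rightarrow> ('a \<Rightarrow> 'a) \<Rightarrow> real \<Rightarrow> 'a \<Rightarrow> bool" where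
  "eigenvector D A z v \<longleftrightarrow> v \<in> D \<and> v \<noteq> 0 \<and> A v = z *\<^sub>R v"

definition eigenvalue :: "'a::real_inner set \<Rightarrow> ('a \<Rightarrow> 'a) \<Rightarrow> real \<Rightarrow> bool" where
  "eigenvalue D A z \<longleftrightarrow> (\<exists>v. eigenvector D A z v)"

text \<open>Only real points are considered: the spectrum of a self-adjoint operator is real.\<close>

definition resolvent_set :: "'a::real_inner set \<Rightarrow> ('a \<Rightarrow> 'a) \<Rightarrow> real set" where
  "resolvent_set D A = {z. bij_betw (\<lambda>u. A u - z *\<^sub>R u) D UNIV \<and>
     (\<exists>C. \<forall>u\<in>D. norm u \<le> C * norm (A u - z *\<^sub>R u))}"

definition operator_spectrum :: "'a::real_inner set \<Rightarrow> ('a \<Rightarrow> 'a) \<Rightarrow> real set" where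
  "operator_spectrum D A = - resolvent_set D A"

definition H_minus :: "'a::real_inner set \<Rightarrow> ('a \<Rightarrow> 'a) \<Rightarrow> real \<Rightarrow> 'a set" where
  "H_minus D A lam = closure (span {v. \<exists>z\<le>lam. eigenvector D A z v})"

definition H_plus :: "'a::real_inner set \<Rightarrow> ('a \<Rightarrow> 'a) \<Rightarrow> real \<Rightarrow> 'a set" where
  "H_plus D A lam = closure (span {v. \<exists>z>lam. eigenvector D A z v})"


section \<open>Spectral calculus\<close>

text \<open>Projection-valued measures on the Borel sets of the real line; values on other sets are
  irrelevant.\<close>

definition projection_valued_measure :: "(real set \<Rightarrow> 'a::real_inner \<Rightarrow> 'a) \<Rightarrow> bool" where
  "projection_valued_measure E \<longleftrightarrow>
     (\<forall>S\<in>sets borel. bounded_linear (E S) \<and> (\<forall>x. E S (E S x) = E S x) \<and>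
        (\<forall>x y. E S x \<bullet> y = x \<bullet> E S y)) \<and>
     (\<forall>x. E UNIV x = x) \<and>
     (\<forall>S :: nat \<Rightarrow> real set. range S \<subseteq> sets borel \<longrightarrow> disjoint_family S \<longrightarrow>
        (\<forall>x. (\<lambda>n. E (S n) x) sums E (\<Union>n. S n) x))"

definition scalar_spectral_measure :: "(real set \<Rightarrow> 'a::real_inner \<Rightarrow> 'a) \<Rightarrow> 'a \<Rightarrow> real measure" where
  "scalar_spectral_measure E x = measure_of UNIV (sets borel) (\<lambda>S. ennreal (E S x \<bullet> x))"

definition calculus_domain :: "(real set \<Rightarrow> 'a::real_inner \<Rightarrow> 'a) \<Rightarrow> (real \<Rightarrow> real) \<Rightarrow> 'a set" where
  "calculus_domain E \<phi> = {x. (\<integral>\<^sup>+ s. ennreal ((\<phi> s)\<^sup>2) \<partial>scalar_spectral_measure E x) < \<infinity>}"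

text \<open>The integral of \<open>\<phi>\<close> against the signed measure mapping \<open>S\<close> to \<open>E S x \<bullet> y\<close>, by polarization.\<close>

definition spectral_integral ::
    "(real set \<Rightarrow> 'a::real_inner \<Rightarrow> 'a) \<Rightarrow> (real \<Rightarrow> real) \<Rightarrow> 'a \<Rightarrow> 'a \<Rightarrow> real" where
  "spectral_integral E \<phi> x y =
     ((\<integral>s. \<phi> s \<partial>scalar_spectral_measure E (x + y)) -
      (\<integral>s. \<phi> s \<partial>scalar_spectral_measure E (x - y))) / 4"

text \<open>The operator \<open>\<integral> \<phi> dE\<close> on \<open>calculus_domain E \<phi>\<close>; the vector described is unique because that
  domain is dense.\<close>

definition calculus :: "(real set \<Rightarrow> 'a::real_inner \<Rightarrow> 'a) \<Rightarrow> (real \<Rightarrow> real) \<Rightarrow> 'a \<Rightarrow> 'a" where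
  "calculus E \<phi> x = (THE y. \<forall>z\<in>calculus_domain E \<phi>. y \<bullet> z = spectral_integral E \<phi> x z)"

definition resolves :: "(real set \<Rightarrow> 'a::real_inner \<Rightarrow> 'a) \<Rightarrow> 'a set \<Rightarrow> ('a \<Rightarrow> 'a) \<Rightarrow> bool" where
  "resolves E D A \<longleftrightarrow> projection_valued_measure E \<and> D = calculus_domain E (\<lambda>s. s) \<and>
     (\<forall>x\<in>D. A x = calculus E (\<lambda>s. s) x)"

text \<open>By the spectral theorem a self-adjoint operator has a resolution, unique on Borel sets.\<close>

definition spectral_resolution :: "'a::real_inner set \<Rightarrow> ('a \<Rightarrow> 'a) \<Rightarrow> real set \<Rightarrow> 'a \<Rightarrow> 'a" where
  "spectral_resolution D A = (SOME E. resolves E D A)"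

definition half_domain :: "'a::real_inner set \<Rightarrow> ('a \<Rightarrow> 'a) \<Rightarrow> 'a set" where
  "half_domain D A = calculus_domain (spectral_resolution D A) sqrt"

definition half_power :: "'a::real_inner set \<Rightarrow> ('a \<Rightarrow> 'a) \<Rightarrow> 'a \<Rightarrow> 'a" where
  "half_power D A = calculus (spectral_resolution D A) sqrt"

definition half_norm :: "'a::real_inner set \<Rightarrow> ('a \<Rightarrow> 'a) \<Rightarrow> 'a \<Rightarrow> real" where
  "half_norm D A u = sqrt ((norm u)\<^sup>2 + (norm (half_power D A u))\<^sup>2)"

definition half_ball :: "'a::real_inner set \<Rightarrow> ('a \<Rightarrow> 'a) \<Rightarrow> real \<Rightarrow> 'a set" where
  "half_ball D A R = {u \<in> half_domain D A. half_norm D A u < R}"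


section \<open>Vector-valued function spaces on an interval\<close>

text \<open>The library's Bochner integral requires a second countable range. The following is the same
  notion for arbitrary normed spaces, with strong measurability in place of Borel measurability.\<close>

definition strongly_measurable :: "'t measure \<Rightarrow> ('t \<Rightarrow> 'b::real_normed_vector) \<Rightarrow> bool" where
  "strongly_measurable M g \<longleftrightarrow>
     (\<exists>s. (\<forall>n::nat. simple_function M (s n)) \<and> (AE t in M. (\<lambda>n. s n t) \<longlonglongrightarrow> g t))"

definition has_bochner :: "'t measure \<Rightarrow> ('t \<Rightarrow> 'b::real_normed_vector) \<Rightarrow> 'b \<Rightarrow> bool" where
  "has_bochner M g I \<longleftrightarrow> strongly_measurable M g \<and>
     (\<exists>s. (\<forall>n::nat. Bochner_Integration.simple_bochner_integrable M (s n)) \<and>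
        (\<lambda>n. \<integral>\<^sup>+ t. ennreal (norm (g t - s n t)) \<partial>M) \<longlonglongrightarrow> 0 \<and>
        (\<lambda>n. Bochner_Integration.simple_bochner_integral M (s n)) \<longlonglongrightarrow> I)"

definition bochner_L2 :: "'t measure \<Rightarrow> ('t \<Rightarrow> 'b::real_normed_vector) \<Rightarrow> bool" where
  "bochner_L2 M g \<longleftrightarrow> strongly_measurable M g \<and> (\<integral>\<^sup>+ t. ennreal ((norm (g t))\<^sup>2) \<partial>M) < \<infinity>"

definition test_function :: "real \<Rightarrow> (real \<Rightarrow> real) \<Rightarrow> bool" where
  "test_function T \<phi> \<longleftrightarrow> (\<forall>n t. ((deriv ^^ n) \<phi>) differentiable (at t)) \<and>
     (\<exists>a b. 0 < a \<and> b < T \<and> (\<forall>t. t \<notin> {a..b} \<longrightarrow> \<phi> t = 0))"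

definition weak_derivative ::
    "real \<Rightarrow> (real \<Rightarrow> 'b::real_normed_vector) \<Rightarrow> (real \<Rightarrow> 'b) \<Rightarrow> bool" where
  "weak_derivative T u u' \<longleftrightarrow> (\<forall>\<phi>. test_function T \<phi> \<longrightarrow>
     (\<exists>I. has_bochner (lebesgue_on {0<..<T}) (\<lambda>t. deriv \<phi> t *\<^sub>R u t) I \<and>
          has_bochner (lebesgue_on {0<..<T}) (\<lambda>t. \<phi> t *\<^sub>R u' t) (- I)))"

text \<open>Membership of \<open>u\<close> in \<open>W^{1,2}((0,T),H)\<close>, with derivative \<open>u'\<close>.\<close>

definition W12_with_derivative ::
    "real \<Rightarrow> (real \<Rightarrow> 'b::real_normed_vector) \<Rightarrow> (real \<Rightarrow> 'b) \<Rightarrow> bool" where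
  "W12_with_derivative T u u' \<longleftrightarrow> bochner_L2 (lebesgue_on {0<..<T}) u \<and>
     bochner_L2 (lebesgue_on {0<..<T}) u' \<and> weak_derivative T u u'"

text \<open>Membership of \<open>u\<close> in \<open>L^2((0,T),D(A))\<close>: the norm of the pair is the graph norm.\<close>

definition L2_domain :: "'a::real_inner set \<Rightarrow> ('a \<Rightarrow> 'a) \<Rightarrow> real \<Rightarrow> (real \<Rightarrow> 'a) \<Rightarrow> bool" where
  "L2_domain D A T u \<longleftrightarrow> (AE t in lebesgue_on {0<..<T}. u t \<in> D) \<and>
     bochner_L2 (lebesgue_on {0<..<T}) (\<lambda>t. (u t, A (u t)))"

definition C0_half_domain :: "'a::real_inner set \<Rightarrow> ('a \<Rightarrow> 'a) \<Rightarrow> real \<Rightarrow> (real \<Rightarrow> 'a) \<Rightarrow> bool" where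
  "C0_half_domain D A T u \<longleftrightarrow> (\<forall>t\<in>{0..T}. u t \<in> half_domain D A) \<and>
     (\<forall>t\<in>{0..T}. ((\<lambda>s. half_norm D A (u s - u t)) \<longlongrightarrow> 0) (at t within {0..T}))"

definition absolutely_continuous_fun :: "real \<Rightarrow> real \<Rightarrow> (real \<Rightarrow> real) \<Rightarrow> bool" where
  "absolutely_continuous_fun a b F \<longleftrightarrow> (\<forall>\<epsilon>>0. \<exists>\<delta>>0. \<forall>(n::nat) x y.
     (\<forall>i<n. a \<le> x i \<and> x i \<le> y i \<and> y i \<le> b) \<longrightarrow>
     (\<forall>i<n. \<forall>j<n. i \<noteq> j \<longrightarrow> {x i<..<y i} \<inter> {x j<..<y j} = {}) \<longrightarrow>
     (\<Sum>i<n. y i - x i) < \<delta> \<longrightarrow> (\<Sum>i<n. \<bar>F (y i) - F (x i)\<bar>) < \<epsilon>)"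


section \<open>Solutions of the evolution equation\<close>

text \<open>Solutions of \<open>u' + A u = f u\<close>, \<open>u 0 = u0\<close> on \<open>[0,Tmax)\<close>, where \<open>Tmax\<close> may be infinite.\<close>

definition is_solution ::
    "'a::real_inner set \<Rightarrow> ('a \<Rightarrow> 'a) \<Rightarrow> real \<Rightarrow> ('a \<Rightarrow> 'a) \<Rightarrow> 'a \<Rightarrow> ereal \<Rightarrow> (real \<Rightarrow> 'a) \<Rightarrow> bool" where
  "is_solution D A R f u0 Tmax u \<longleftrightarrow>
     0 < Tmax \<and>
     (\<forall>t\<ge>0. ereal t < Tmax \<longrightarrow> u t \<in> half_ball D A R) \<and>
     u 0 = u0 \<and>
     (\<forall>T>0. ereal T < Tmax \<longrightarrow>
        C0_half_domain D A T u \<and>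
        L2_domain D A T u \<and>
        absolutely_continuous_fun 0 T (\<lambda>t. (norm (half_power D A (u t)))\<^sup>2) \<and>
        (\<exists>u'. W12_with_derivative T u u' \<and>
           (AE t in lebesgue_on {0<..<T}. u' t + A (u t) = f (u t))))"

text \<open>The unique local solution starting at \<open>u0\<close> is global and equal to \<open>u\<close>: any solution on any
  interval \<open>[0,Tmax)\<close> is a restriction of \<open>u\<close>.\<close>

definition is_unique_global_solution ::
    "'a::real_inner set \<Rightarrow> ('a \<Rightarrow> 'a) \<Rightarrow> real \<Rightarrow> ('a \<Rightarrow> 'a) \<Rightarrow> 'a \<Rightarrow> (real \<Rightarrow> 'a) \<Rightarrow> bool" where
  "is_unique_global_solution D A R f u0 u \<longleftrightarrow>
     is_solution D A R f u0 \<infinity> u \<and>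
     (\<forall>Tmax v. is_solution D A R f u0 Tmax v \<longrightarrow> (\<forall>t\<ge>0. ereal t < Tmax \<longrightarrow> v t = u t))"

end

theory Submission
  imports Defs
begin

text \<open>
  Let \<open>\<lambda>\<close> be the eigenvalue. In the variable \<open>Y(t) = exp(\<lambda>t) (1 + A)\<^sup>1\<^sup>/\<^sup>2 u(t)\<close> the equation becomes
  \<open>Y' + (A - \<lambda>) Y = (1 + A)\<^sup>1\<^sup>/\<^sup>2 h\<close>, where \<open>h = exp(\<lambda>t) f(u)\<close> decays like \<open>exp(-p\<lambda>t)\<close> as long as \<open>Y\<close> is
  bounded. Solving forward from \<open>w\<^sub>0\<close> in the modes above \<open>\<lambda>\<close> and backward from infinity, where \<open>Y\<close>
  tends to \<open>(1 + A)\<^sup>1\<^sup>/\<^sup>2 v\<^sub>0\<close>, in the finitely many other modes defines a map that is a contraction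
  of a small ball of bounded continuous functions. The loss of half a derivative in the right-hand side
  is absorbed by the energy estimate
  \<open>d/dt |y|\<^sup>2 \<le> - a |y|\<^sup>2 + |g|\<^sup>2 (1 + z) / a\<close> with \<open>a = z - \<lambda>\<close> in each mode \<open>z\<close>.

  The eigenvectors are total because a self-adjoint operator has approximate eigenvalues on every
  invariant subspace, while \<open>A - c\<close> is bounded below off the eigenspace when \<open>c\<close> is isolated in the
  spectrum. Hence a resolution of \<open>A\<close> must consist of the sums of eigenprojections, and everything
  can be computed mode by mode.
\<close>

section \<open>Orthogonal projections\<close>

text \<open>In the variable \<open>Y\<close> the vector \<open>v\<close> is stationary, modes above
  \<open>lam\<close> are damped, and modes below \<open>lam\<close> grow unless their data are
  tuned. So the low modes can only be prescribed at infinity, and the correction \<open>w1\<close>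
  is an output, read off as \<open>G (Y 0 - w)\<close>. The backward integrals converge because the
  factor exp(lam t) costs one power of the decay while \<open>f\<close> supplies p + 1 of them. Two
  obstacles shape the rest. First, \<open>spectral_resolution\<close> is an arbitrary choice among
  the \<open>E\<close> with \<open>resolves E D A\<close>, so nothing is known about A^(1/2) until a
  resolution is exhibited and every resolution is shown to be diagonal; the positive eigenvalue
  enters there. Second, solutions are weak and take values in a possibly nonseparable space.
  Existence means producing vector integrals as limits of step functions, while uniqueness starts
  from an arbitrary weak solution and must recover classical differentiability of its modes, for
  which explicit test functions are built.\<close>

definition orth_proj :: "'a::real_inner set \<Rightarrow> 'a \<Rightarrow> 'a" where
  "orth_proj V x = (SOME p. p \<in> V \<and> (\<forall>v\<in>V. (x - p) \<bullet> v = 0))"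

text \<open>Moving \<open>p\<close> by the optimal multiple \<open>t\<close> of \<open>v\<close>
  would lower the squared distance by ((x - p) . v)^2 / (v . v); minimality forces this gain to be
  zero.\<close>

lemma minimizer_orthogonal:
  fixes V :: "'a::real_inner set"
  assumes "subspace V" "p \<in> V" and min: "\<And>v. v \<in> V \<Longrightarrow> (norm (x - p))\<^sup>2 \<le> (norm (x - v))\<^sup>2"
    and "v \<in> V"
  shows "(x - p) \<bullet> v = 0"
proof (cases "v = 0")
  case False
  define t where "t = ((x - p) \<bullet> v) / (v \<bullet> v)"
  have vv: "v \<bullet> v > 0" using False by simp
  have "(norm (x - p))\<^sup>2 \<le> (norm (x - (p + t *\<^sub>R v)))\<^sup>2"
    by (rule min) (simp add: assms subspace_add subspace_scale)
  also have "\<dots> = (norm (x - p))\<^sup>2 - 2 * t * ((x - p) \<bullet> v) + t\<^sup>2 * (v \<bullet> v)"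
    by (simp add: power2_norm_eq_inner inner_simps inner_commute power2_eq_square[of t] algebra_simps)
  finally have "2 * t * ((x - p) \<bullet> v) \<le> t\<^sup>2 * (v \<bullet> v)" by simp
  then have "((x - p) \<bullet> v)\<^sup>2 / (v \<bullet> v) \<le> 0"
    using vv by (simp add: t_def power2_eq_square field_simps)
  then show ?thesis using vv by (simp add: divide_le_0_iff not_le[symmetric])
qed simp

text \<open>The parallelogram law makes a minimizing sequence Cauchy: midpoints stay in
  \<open>V\<close>, so their squared distance to \<open>x\<close> is at least the infimum
  \<open>d\<close>. Completeness of the space and closedness of \<open>V\<close> then give the
  minimizer.\<close>

lemma orth_proj_exists:
  fixes V :: "'a::{real_inner,complete_space} set"
  assumes V: "subspace V" "closed V"
  shows "\<exists>p. p \<in> V \<and> (\<forall>v\<in>V. (x - p) \<bullet> v = 0)"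
proof -
  define d where "d = Inf ((\<lambda>v. (norm (x - v))\<^sup>2) ` V)"
  have bdd: "bdd_below ((\<lambda>v. (norm (x - v))\<^sup>2) ` V)" by (rule bdd_belowI[of _ 0]) auto
  have ne: "(\<lambda>v. (norm (x - v))\<^sup>2) ` V \<noteq> {}" using subspace_0[OF V(1)] by auto
  have d_le: "d \<le> (norm (x - v))\<^sup>2" if "v \<in> V" for v
    unfolding d_def by (rule cInf_lower) (use that bdd in auto)
  have "\<exists>v\<in>V. (norm (x - v))\<^sup>2 < d + 1 / real (Suc n)" for n
    using cInf_lessD[OF ne, of "d + 1 / real (Suc n)"] by (auto simp: d_def)
  then obtain v where v: "\<And>n. v n \<in> V" "\<And>n. (norm (x - v n))\<^sup>2 < d + 1 / real (Suc n)" by metis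
  have par: "(norm (v n - v m))\<^sup>2 \<le> 2 / real (Suc n) + 2 / real (Suc m)" for n m
  proof -
    have "(1/2) *\<^sub>R (v n + v m) \<in> V" using V(1) v(1) by (simp add: subspace_add subspace_scale)
    then have "d \<le> (norm (x - (1/2) *\<^sub>R (v n + v m)))\<^sup>2" by (rule d_le)
    moreover have "(norm (v n - v m))\<^sup>2 = 2 * (norm (x - v n))\<^sup>2 + 2 * (norm (x - v m))\<^sup>2
        - 4 * (norm (x - (1/2) *\<^sub>R (v n + v m)))\<^sup>2"
      by (simp add: power2_norm_eq_inner inner_simps inner_commute field_simps)
    ultimately show ?thesis using v(2)[of n] v(2)[of m] by simp
  qed
  have "Cauchy v"
  proof (rule CauchyI)
    fix e :: real assume "e > 0"
    obtain N where N: "4 / e\<^sup>2 < real (Suc N)" using reals_Archimedean2 less_Suc_eq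
      by (metis of_nat_less_iff order_less_trans lessI)
    have "norm (v m - v n) < e" if "m \<ge> N" "n \<ge> N" for m n
    proof -
      have "2 / real (Suc m) \<le> 2 / real (Suc N)" "2 / real (Suc n) \<le> 2 / real (Suc N)"
        using that by (auto simp: frac_le)
      then have "(norm (v m - v n))\<^sup>2 \<le> 4 / real (Suc N)" using par[of m n] by linarith
      also have "\<dots> < e\<^sup>2" using N \<open>e > 0\<close> by (simp add: field_simps)
      finally show ?thesis using \<open>e > 0\<close> by (simp add: power_less_imp_less_base)
    qed
    then show "\<exists>M. \<forall>m\<ge>M. \<forall>n\<ge>M. norm (v m - v n) < e" by blast
  qed
  then obtain p where p: "v \<longlonglongrightarrow> p" using Cauchy_convergent_iff convergent_def by blast
  have "p \<in> V" using closed_sequentially[OF V(2) _ p] v(1) by blast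
  have "(\<lambda>n. (norm (x - v n))\<^sup>2) \<longlonglongrightarrow> (norm (x - p))\<^sup>2" by (intro tendsto_intros p)
  moreover have "(\<lambda>n. d + 1 / real (Suc n)) \<longlonglongrightarrow> d + 0"
    by (intro tendsto_intros LIMSEQ_Suc lim_1_over_n)
  ultimately have "(norm (x - p))\<^sup>2 \<le> d"
    using LIMSEQ_le[of _ "(norm (x - p))\<^sup>2" _ d] v(2) less_imp_le by (metis (no_types, lifting) add.right_neutral)
  then have "(x - p) \<bullet> u = 0" if "u \<in> V" for u
    using minimizer_orthogonal[OF V(1) \<open>p \<in> V\<close> _ that] d_le order_trans by blast
  then show ?thesis using \<open>p \<in> V\<close> by blast
qed

context
  fixes V :: "'a::{real_inner,complete_space} set"
  assumes V: "subspace V" "closed V"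
begin

lemma orth_proj_in: "orth_proj V x \<in> V"
  and orth_proj_orth: "v \<in> V \<Longrightarrow> (x - orth_proj V x) \<bullet> v = 0"
  using someI_ex[OF orth_proj_exists[OF V, of x]] by (auto simp: orth_proj_def)

lemma orth_proj_unique:
  assumes "p \<in> V" "\<And>v. v \<in> V \<Longrightarrow> (x - p) \<bullet> v = 0"
  shows "orth_proj V x = p"
proof -
  let ?q = "orth_proj V x"
  have "p - ?q \<in> V" using assms orth_proj_in V subspace_diff by blast
  then have "(x - p) \<bullet> (p - ?q) = 0" "(x - ?q) \<bullet> (p - ?q) = 0"
    using assms orth_proj_orth by auto
  then have "(p - ?q) \<bullet> (p - ?q) = 0" by (simp add: inner_simps)
  then show ?thesis by simp
qed

lemma orth_proj_eq_self: "x \<in> V \<Longrightarrow> orth_proj V x = x"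
  by (rule orth_proj_unique) auto

lemma orth_proj_eq_0: "(\<And>v. v \<in> V \<Longrightarrow> x \<bullet> v = 0) \<Longrightarrow> orth_proj V x = 0"
  by (rule orth_proj_unique) (use V subspace_0 in auto)

lemma inner_orth_proj: "v \<in> V \<Longrightarrow> orth_proj V x \<bullet> v = x \<bullet> v"
  using orth_proj_orth[of v x] by (simp add: inner_simps)

lemma orth_proj_symmetric: "orth_proj V x \<bullet> y = x \<bullet> orth_proj V y"
  by (metis inner_commute inner_orth_proj orth_proj_in)

lemma inner_orth_proj_self: "orth_proj V x \<bullet> x = (norm (orth_proj V x))\<^sup>2"
  by (metis inner_commute inner_orth_proj orth_proj_in power2_norm_eq_inner)

lemma norm_orth_proj_le: "norm (orth_proj V x) \<le> norm x"
proof -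
  have "(norm (orth_proj V x))\<^sup>2 \<le> norm (orth_proj V x) * norm x"
    using norm_cauchy_schwarz[of "orth_proj V x" x] by (simp add: inner_orth_proj_self)
  then show ?thesis by (cases "orth_proj V x = 0") (auto simp: power2_eq_square)
qed

lemma bounded_linear_orth_proj: "bounded_linear (orth_proj V)"
proof (rule bounded_linear_intro[where K=1])
  show "orth_proj V (x + y) = orth_proj V x + orth_proj V y" for x y
    by (rule orth_proj_unique) (auto simp: subspace_add[OF V(1)] orth_proj_in inner_simps inner_orth_proj)
  show "orth_proj V (r *\<^sub>R x) = r *\<^sub>R orth_proj V x" for r x
    by (rule orth_proj_unique) (auto simp: subspace_scale[OF V(1)] orth_proj_in inner_simps inner_orth_proj)
qed (simp add: norm_orth_proj_le)

end

lemma subspace_closure_span: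
  fixes S :: "'a::real_normed_vector set"
  shows "subspace (closure (span S))"
proof (rule subspaceI)
  show "0 \<in> closure (span S)" using closure_subset span_0 by blast
next
  fix x y assume "x \<in> closure (span S)" "y \<in> closure (span S)"
  then obtain a b where "\<And>n. a n \<in> span S" "a \<longlonglongrightarrow> x" "\<And>n. b n \<in> span S" "b \<longlonglongrightarrow> y"
    by (metis closure_sequential)
  then have "\<forall>n. a n + b n \<in> span S" "(\<lambda>n. a n + b n) \<longlonglongrightarrow> x + y"
    by (auto intro: span_add tendsto_add)
  then show "x + y \<in> closure (span S)" by (auto simp: closure_sequential)
next
  fix c x assume "x \<in> closure (span S)"
  then obtain a where "\<And>n. a n \<in> span S" "a \<longlonglongrightarrow> x" by (metis closure_sequential)
  then have "\<forall>n. c *\<^sub>R a n \<in> span S" "(\<lambda>n. c *\<^sub>R a n) \<longlonglongrightarrow> c *\<^sub>R x"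
    by (auto intro: span_scale tendsto_intros)
  then show "c *\<^sub>R x \<in> closure (span S)" by (auto simp: closure_sequential)
qed

lemmas closed_span = subspace_closure_span closed_closure

lemma inner_closure_span_eq_0:
  fixes S :: "'a::real_inner set"
  assumes "y \<in> closure (span S)" "\<And>s. s \<in> S \<Longrightarrow> x \<bullet> s = 0"
  shows "x \<bullet> y = 0"
proof -
  have sub: "subspace {y. x \<bullet> y = 0}" by (auto simp: subspace_def inner_simps)
  have "closed {y. x \<bullet> y = 0}" by (intro closed_Collect_eq continuous_intros)
  moreover have "span S \<subseteq> {y. x \<bullet> y = 0}" by (rule span_minimal) (use sub assms in auto)
  ultimately show ?thesis using closure_minimal assms(1) by blast
qed

section \<open>First consequences of self-adjointness\<close>

locale selfadjoint =
  fixes D :: "'a::{real_inner,complete_space} set" and A :: "'a \<Rightarrow> 'a"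
  assumes selfadjoint: "selfadjoint_operator D A"
begin

lemma subspace_D: "subspace D"
  and A_add: "x \<in> D \<Longrightarrow> y \<in> D \<Longrightarrow> A (x + y) = A x + A y"
  and A_scale: "x \<in> D \<Longrightarrow> A (c *\<^sub>R x) = c *\<^sub>R A x"
  and dense_D: "closure D = UNIV"
  and adjoint_domain_eq: "adjoint_domain D A = D"
  and A_symmetric: "x \<in> D \<Longrightarrow> y \<in> D \<Longrightarrow> A x \<bullet> y = x \<bullet> A y"
  using selfadjoint by (auto simp: selfadjoint_operator_def linear_operator_def)

lemma D_add: "x \<in> D \<Longrightarrow> y \<in> D \<Longrightarrow> x + y \<in> D"
  and D_diff: "x \<in> D \<Longrightarrow> y \<in> D \<Longrightarrow> x - y \<in> D"
  and D_scale: "x \<in> D \<Longrightarrow> c *\<^sub>R x \<in> D"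
  and D_0: "0 \<in> D"
  using subspace_D by (auto simp: subspace_add subspace_diff subspace_scale subspace_0)

lemma A_0: "A 0 = 0"
  using A_scale[OF D_0, of 0] by simp

lemma A_diff: "x \<in> D \<Longrightarrow> y \<in> D \<Longrightarrow> A (x - y) = A x - A y"
  using A_add[of x "(-1) *\<^sub>R y"] A_scale[of y "-1"] D_scale[of y "-1"] by simp

lemma orth_D_eq_0:
  assumes "\<And>x. x \<in> D \<Longrightarrow> x \<bullet> y = 0" shows "y = 0"
proof -
  have "D \<subseteq> {x. x \<bullet> y = 0}" using assms by auto
  moreover have "closed {x. x \<bullet> y = 0}" by (intro closed_Collect_eq continuous_intros)
  ultimately have "y \<bullet> y = 0" using closure_minimal dense_D by (metis (mono_tags) UNIV_I mem_Collect_eq subsetD)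
  then show ?thesis by simp
qed

text \<open>Converts a weak identity, tested only on \<open>D\<close>, into membership in
  \<open>D\<close>: the identity puts \<open>y\<close> in the adjoint domain, which equals
  \<open>D\<close>, and density of \<open>D\<close> identifies the value.\<close>

lemma adjointI:
  assumes "\<And>x. x \<in> D \<Longrightarrow> A x \<bullet> y = x \<bullet> z"
  shows "y \<in> D" "A y = z"
proof -
  have "y \<in> adjoint_domain D A" unfolding adjoint_domain_def using assms by blast
  then show "y \<in> D" by (simp add: adjoint_domain_eq)
  then have "x \<bullet> (A y - z) = 0" if "x \<in> D" for x
    using that assms A_symmetric by (simp add: inner_diff_right)
  then have "A y - z = 0" by (rule orth_D_eq_0)
  then show "A y = z" by simp
qed

definition eigenspace :: "real \<Rightarrow> 'a set" where
  "eigenspace z = {v \<in> D. A v = z *\<^sub>R v}"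

lemma subspace_eigenspace: "subspace (eigenspace z)"
  by (rule subspaceI)
    (auto simp: eigenspace_def D_0 A_0 D_add A_add D_scale A_scale scaleR_add_right)

text \<open>\<open>A\<close> need not be continuous, so the limit is taken in the weak form
  \<open>A y \<bullet> x n = y \<bullet> (z *\<^sub>R x n)\<close> with \<open>y\<close> fixed in
  \<open>D\<close>, and \<open>adjointI\<close> recovers the strong form.\<close>

lemma closed_eigenspace: "closed (eigenspace z)"
proof (unfold closed_sequential_limits, intro allI impI, elim conjE)
  fix x l assume x: "\<forall>n. x n \<in> eigenspace z" and l: "x \<longlonglongrightarrow> l"
  have "A y \<bullet> l = y \<bullet> (z *\<^sub>R l)" if y: "y \<in> D" for y
  proof (rule LIMSEQ_unique)
    show "(\<lambda>n. A y \<bullet> x n) \<longlonglongrightarrow> A y \<bullet> l" by (intro tendsto_intros l)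
    have "A y \<bullet> x n = y \<bullet> (z *\<^sub>R x n)" for n
      using x y A_symmetric by (auto simp: eigenspace_def)
    then show "(\<lambda>n. A y \<bullet> x n) \<longlonglongrightarrow> y \<bullet> (z *\<^sub>R l)" by (auto intro!: tendsto_intros l)
  qed
  then show "l \<in> eigenspace z" using adjointI[of l "z *\<^sub>R l"] by (auto simp: eigenspace_def)
qed

lemma eigenvector_iff: "eigenvector D A z v \<longleftrightarrow> v \<in> eigenspace z \<and> v \<noteq> 0"
  by (auto simp: eigenvector_def eigenspace_def)

lemma eigenspace_orthogonal:
  assumes "v \<in> eigenspace y" "w \<in> eigenspace z" "y \<noteq> z"
  shows "v \<bullet> w = 0"
  using assms A_symmetric[of v w] by (auto simp: eigenspace_def)

section \<open>Totality of the eigenvectors\<close>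

lemma resolvent_bounded_below:
  assumes "c \<in> resolvent_set D A"
  shows "\<exists>d>0. \<forall>u\<in>D. d * norm u \<le> norm (A u - c *\<^sub>R u)"
proof -
  obtain C where C: "\<And>u. u \<in> D \<Longrightarrow> norm u \<le> C * norm (A u - c *\<^sub>R u)"
    using assms by (auto simp: resolvent_set_def)
  have "norm u \<le> (\<bar>C\<bar> + 1) * norm (A u - c *\<^sub>R u)" if "u \<in> D" for u
  proof -
    have "C * norm (A u - c *\<^sub>R u) \<le> (\<bar>C\<bar> + 1) * norm (A u - c *\<^sub>R u)"
      by (rule mult_right_mono) auto
    then show ?thesis using C[OF that] by linarith
  qed
  then show ?thesis
    by (intro exI[of _ "1 / (\<bar>C\<bar> + 1)"]) (auto simp: field_simps add_pos_nonneg)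
qed

text \<open>If \<open>k\<close> is the norm of the resolvent \<open>K\<close> at \<open>c\<close>, then \<open>K\<^sup>2 - k\<^sup>2 = (K - k) (K + k)\<close> is not
  bounded below, because \<open>|K\<^sup>2 x - k\<^sup>2 x|\<^sup>2 \<le> k\<^sup>2 (k\<^sup>2 |x|\<^sup>2 - |K x|\<^sup>2)\<close>. Hence one of
  \<open>c + 1/k\<close> and \<open>c - 1/k\<close> is an approximate eigenvalue. The same holds on an invariant subspace.\<close>
lemma resolvent_distance:
  assumes c: "c \<in> resolvent_set D A" and N: "subspace N"
    and inv: "\<And>u. u \<in> D \<Longrightarrow> A u - c *\<^sub>R u \<in> N \<Longrightarrow> u \<in> N"
    and bb: "\<And>c'. \<bar>c' - c\<bar> < r \<Longrightarrow> \<exists>d>0. \<forall>u\<in>D \<inter> N. d * norm u \<le> norm (A u - c' *\<^sub>R u)"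
    and r: "r > 0" and u: "u \<in> D" "A u - c *\<^sub>R u \<in> N"
  shows "r * norm u \<le> norm (A u - c *\<^sub>R u)"
proof (rule ccontr)
  assume less: "\<not> ?thesis"
  define B where "B = (\<lambda>u. A u - c *\<^sub>R u)"
  define K where "K = inv_into D B"
  have bij: "bij_betw B D UNIV" using c by (auto simp: resolvent_set_def B_def)
  have KD: "K x \<in> D" and BK: "B (K x) = x" for x
    using bij unfolding K_def bij_betw_def by (auto intro: inv_into_into f_inv_into_f)
  have KB: "K (B u) = u" if "u \<in> D" for u
    using bij that unfolding K_def bij_betw_def by auto
  have B_add: "B (x + y) = B x + B y" and B_scale: "B (s *\<^sub>R x) = s *\<^sub>R B x"
    if "x \<in> D" "y \<in> D" for x y s
    using that by (auto simp: B_def A_add A_scale algebra_simps)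
  have K_add: "K (x + y) = K x + K y" for x y
    by (metis KD BK KB B_add D_add)
  have K_scale: "K (s *\<^sub>R x) = s *\<^sub>R K x" for s x
    by (metis KD BK KB B_scale D_scale)
  have K_sym: "K x \<bullet> y = x \<bullet> K y" for x y
  proof -
    have "B (K x) \<bullet> K y = K x \<bullet> B (K y)"
      using A_symmetric[OF KD KD] by (simp add: B_def inner_simps)
    then show ?thesis by (simp add: BK)
  qed
  have KN: "K x \<in> N" if "x \<in> N" for x
    using inv[OF KD, of x] BK[of x] that by (simp add: B_def)
  obtain d where d: "d > 0" "\<And>u. u \<in> D \<Longrightarrow> d * norm u \<le> norm (B u)"
    using resolvent_bounded_below[OF c] by (auto simp: B_def)
  have K_bound: "norm (K x) \<le> norm x / d" for x
    using d(2)[OF KD, of x] d(1) by (simp add: BK field_simps)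
  \<comment> \<open>\<open>k\<close> is the norm of the resolvent \<open>K\<close> restricted to the
    invariant subspace \<open>N\<close>; it may be smaller than the norm on the whole space.\<close>
  define S where "S = (\<lambda>x. norm (K x)) ` {x \<in> N. norm x \<le> 1}"
  define k where "k = Sup S"
  have bdd: "bdd_above S"
  proof (rule bdd_aboveI[of _ "1 / d"])
    fix y assume "y \<in> S"
    then obtain x where "norm x \<le> 1" "y = norm (K x)" by (auto simp: S_def)
    then show "y \<le> 1 / d" using K_bound[of x] d(1) divide_right_mono[of "norm x" 1 d] by linarith
  qed
  have ne: "S \<noteq> {}" unfolding S_def using subspace_0[OF N] by fastforce
  have Kk: "norm (K x) \<le> k * norm x" if "x \<in> N" for x
  proof (cases "x = 0")
    case True then show ?thesis using K_bound[of 0] by simp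
  next
    case False
    have "(1 / norm x) *\<^sub>R x \<in> N" using that N by (simp add: subspace_scale)
    then have "norm (K ((1 / norm x) *\<^sub>R x)) \<le> k"
      unfolding k_def by (intro cSup_upper bdd) (auto simp: S_def)
    then show ?thesis using False by (simp add: K_scale field_simps)
  qed
  \<comment> \<open>The vector \<open>u\<close> violating the claim shows that k > 1/r, so both
    points c + 1/k and c - 1/k lie in the range where \<open>bb\<close> applies.\<close>
  have "norm u \<le> k * norm (B u)" using Kk[of "B u"] u KB by (simp add: B_def)
  moreover have "norm (B u) < r * norm u" using less by (simp add: B_def)
  ultimately have "norm (B u) < r * k * norm (B u)" using r
    by (smt (verit, best) mult.assoc mult_less_cancel_left_pos)
  then have "1 < r * k"
    using mult_right_mono[of "r * k" 1 "norm (B u)"] by (cases "r * k \<le> 1") auto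
  then have "k > 0" using r by (metis less_trans zero_less_mult_pos zero_less_one)
  with \<open>1 < r * k\<close> have k: "k > 0" "1 / k < r" by (auto simp: field_simps)
  \<comment> \<open>Lower bounds pass from \<open>A\<close> to \<open>K\<close> through (A - (c +
    s/k)) (K w) = - (s/k) (K w - s k w). This bounds \<open>K w\<close>, and \<open>w\<close> is
    then recovered from s k w = K w - (K w - s k w).\<close>
  have key: "\<exists>e>0. \<forall>w\<in>N. e * norm w \<le> norm (K w - (s * k) *\<^sub>R w)" if s: "\<bar>s\<bar> = 1" for s
  proof -
    have "\<bar>(c + s / k) - c\<bar> < r" using s k by (simp add: abs_if split: if_splits)
    from bb[OF this] obtain d where d: "d > 0"
      "\<And>u. u \<in> D \<Longrightarrow> u \<in> N \<Longrightarrow> d * norm u \<le> norm (A u - (c + s / k) *\<^sub>R u)" by auto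
    define e where "e = k / (1 + 1 / (k * d))"
    have e: "e > 0" unfolding e_def using k d by (simp add: add_pos_pos)
    have "e * norm w \<le> norm (K w - (s * k) *\<^sub>R w)" if w: "w \<in> N" for w
    proof -
      let ?n = "norm (K w - (s * k) *\<^sub>R w)"
      have "A (K w) - (c + s / k) *\<^sub>R K w = w - (s / k) *\<^sub>R K w"
        using BK[of w] by (simp add: B_def algebra_simps)
      also have "\<dots> = (- s / k) *\<^sub>R (K w - (s * k) *\<^sub>R w)"
        using s k by (auto simp: algebra_simps abs_if split: if_splits)
      finally have "norm (A (K w) - (c + s / k) *\<^sub>R K w) = ?n / k" using s k by (simp add: abs_divide)
      with d(2)[OF KD KN[OF w]] have "d * norm (K w) \<le> ?n / k" by simp
      then have "norm (K w) \<le> ?n / (k * d)" using d(1) k by (simp add: field_simps)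
      moreover have "k * norm w \<le> ?n + norm (K w)"
      proof -
        have "norm ((s * k) *\<^sub>R w) \<le> norm (K w) + norm (K w - (s * k) *\<^sub>R w)"
          by (metis norm_triangle_sub norm_minus_commute)
        then show ?thesis using s k by (simp add: abs_mult)
      qed
      ultimately have "k * norm w \<le> ?n * (1 + 1 / (k * d))" by (simp add: algebra_simps)
      then show ?thesis unfolding e_def using k d by (simp add: field_simps add_pos_pos)
    qed
    then show ?thesis using e by blast
  qed
  obtain e1 where e1: "e1 > 0" "\<And>w. w \<in> N \<Longrightarrow> e1 * norm w \<le> norm (K w - k *\<^sub>R w)"
    using key[of 1] by auto
  obtain e2 where e2: "e2 > 0" "\<And>w. w \<in> N \<Longrightarrow> e2 * norm w \<le> norm (K w + k *\<^sub>R w)"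
    using key[of "-1"] by auto
  define e where "e = (e1 * e2)\<^sup>2"
  have e: "e > 0" using e1 e2 by (simp add: e_def)
  have low: "e * (norm x)\<^sup>2 \<le> k\<^sup>2 * (k\<^sup>2 * (norm x)\<^sup>2 - (norm (K x))\<^sup>2)" if x: "x \<in> N" for x
  proof -
    let ?w = "K x + k *\<^sub>R x"
    have w: "?w \<in> N" using x KN N by (simp add: subspace_add subspace_scale)
    have "e1 * (e2 * norm x) \<le> e1 * norm ?w" using e2(2)[OF x] e1(1) by simp
    also have "\<dots> \<le> norm (K ?w - k *\<^sub>R ?w)" by (rule e1(2)[OF w])
    also have "K ?w - k *\<^sub>R ?w = K (K x) - (k\<^sup>2) *\<^sub>R x"
      by (simp add: K_add K_scale scaleR_add_right power2_eq_square)
    finally have "(e1 * e2 * norm x)\<^sup>2 \<le> (norm (K (K x) - k\<^sup>2 *\<^sub>R x))\<^sup>2"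
      using e1 e2 by (intro power_mono) (auto simp: mult.assoc)
    also have "\<dots> = (norm (K (K x)))\<^sup>2 - 2 * k\<^sup>2 * (norm (K x))\<^sup>2 + k\<^sup>2 * k\<^sup>2 * (norm x)\<^sup>2"
      using K_sym[of "K x" x] by (simp add: power2_norm_eq_inner inner_simps inner_commute)
    also have "(norm (K (K x)))\<^sup>2 \<le> k\<^sup>2 * (norm (K x))\<^sup>2"
      using power_mono[OF Kk[OF KN[OF x]], of 2] by (simp add: power_mult_distrib)
    finally show ?thesis by (simp add: e_def power_mult_distrib algebra_simps)
  qed
  \<comment> \<open>Two demands on how nearly \<open>x\<close> attains the norm \<open>k\<close>: h
    \<le> k^2 / 2 forces |x|^2 > 1/2, and h \<le> e / (4 k^2) makes the right side of
    \<open>low\<close> at most e/4, below the e/2 on its left.\<close>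
  define h where "h = min (k\<^sup>2 / 2) (e / (4 * k\<^sup>2))"
  have h: "h > 0" using e k by (simp add: h_def)
  have "sqrt (k\<^sup>2 - h) < k"
    using h k by (intro real_less_lsqrt) (auto simp: h_def)
  then obtain x where x: "x \<in> N" "norm x \<le> 1" "sqrt (k\<^sup>2 - h) < norm (K x)"
    using less_cSupD[OF ne, of "sqrt (k\<^sup>2 - h)"] by (auto simp: S_def k_def)
  have kh: "k\<^sup>2 - h < (norm (K x))\<^sup>2"
    using x(3) by (metis real_sqrt_less_iff real_sqrt_abs abs_norm_cancel)
  have x1: "(norm x)\<^sup>2 \<le> 1" using x(2) by (simp add: power_le_one)
  have "k\<^sup>2 - h < k\<^sup>2 * (norm x)\<^sup>2"
    using kh power_mono[OF Kk[OF x(1)], of 2] by (simp add: power_mult_distrib)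
  then have "k\<^sup>2 * (1/2) < k\<^sup>2 * (norm x)\<^sup>2" by (simp add: h_def min_def split: if_splits)
  then have "1/2 < (norm x)\<^sup>2" using k by simp
  then have "e * (1/2) < e * (norm x)\<^sup>2" using e by (intro mult_strict_left_mono)
  also have "\<dots> \<le> k\<^sup>2 * (k\<^sup>2 * (norm x)\<^sup>2 - (norm (K x))\<^sup>2)" by (rule low[OF x(1)])
  also have "\<dots> \<le> k\<^sup>2 * h"
  proof -
    have "k\<^sup>2 * (norm x)\<^sup>2 \<le> k\<^sup>2" using x1 by (simp add: mult_left_le)
    then show ?thesis using kh by (intro mult_left_mono) auto
  qed
  also have "\<dots> \<le> k\<^sup>2 * (e / (4 * k\<^sup>2))" by (intro mult_left_mono) (auto simp: h_def)
  also have "\<dots> = e / 4" using k by (simp add: field_simps)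
  finally show False using e by simp
qed

text \<open>All points within \<epsilon>/2 of \<mu> + \<epsilon>/2 or of \<mu> - \<epsilon>/2 are
  resolvent points, so \<open>resolvent_distance\<close> bounds B - \<epsilon>/2 and B +
  \<epsilon>/2 from below, where B = A - \<mu>. Squaring gives \<epsilon> |<B x, x>| \<le> |B x|^2,
  and polarization turns this into a Cauchy-Schwarz inequality for the form <B x, y>. Since
  \<open>u\<close> is orthogonal to the kernel of \<open>B\<close>, it is a limit of vectors
  \<open>B v\<close>, and the inequality for \<open>v\<close> and \<open>u\<close> passes to the
  limit.\<close>

lemma isolated_point_bounded_below:
  assumes eps: "\<epsilon> > 0" and gap: "\<And>c. 0 < \<bar>c - \<mu>\<bar> \<Longrightarrow> \<bar>c - \<mu>\<bar> < \<epsilon> \<Longrightarrow> c \<in> resolvent_set D A"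
    and u: "u \<in> D" and orth: "\<And>e. e \<in> eigenspace \<mu> \<Longrightarrow> u \<bullet> e = 0"
  shows "\<epsilon> * norm u \<le> norm (A u - \<mu> *\<^sub>R u)"
proof -
  define B where "B = (\<lambda>u. A u - \<mu> *\<^sub>R u)"
  have B_add: "B (x + y) = B x + B y" and B_diff: "B (x - y) = B x - B y"
    and B_scale: "B (s *\<^sub>R x) = s *\<^sub>R B x" and B_sym: "B x \<bullet> y = x \<bullet> B y"
    if "x \<in> D" "y \<in> D" for x y s
    using that by (auto simp: B_def A_add A_diff A_scale algebra_simps A_symmetric)
  have half: "(\<epsilon>/2) * norm x \<le> norm (B x - (s * \<epsilon> / 2) *\<^sub>R x)" if x: "x \<in> D" and s: "\<bar>s\<bar> = 1" for x s
  proof -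
    let ?c = "\<mu> + s * \<epsilon> / 2"
    have near: "c' \<in> resolvent_set D A" if "\<bar>c' - ?c\<bar> < \<epsilon> / 2" for c'
    proof (rule gap)
      show "0 < \<bar>c' - \<mu>\<bar>" "\<bar>c' - \<mu>\<bar> < \<epsilon>" using that s by (auto simp: abs_if split: if_splits)
    qed
    have "(\<epsilon>/2) * norm x \<le> norm (A x - ?c *\<^sub>R x)"
    proof (rule resolvent_distance[where N=UNIV])
      show "?c \<in> resolvent_set D A" using near eps by simp
      show "\<exists>d>0. \<forall>u\<in>D \<inter> UNIV. d * norm u \<le> norm (A u - c' *\<^sub>R u)" if "\<bar>c' - ?c\<bar> < \<epsilon> / 2" for c'
        using resolvent_bounded_below[OF near[OF that]] by simp
    qed (use eps x in auto)
    then show ?thesis by (simp add: B_def algebra_simps)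
  qed
  have quad: "\<epsilon> * \<bar>B x \<bullet> x\<bar> \<le> (norm (B x))\<^sup>2" if x: "x \<in> D" for x
  proof -
    have "s * \<epsilon> * (B x \<bullet> x) \<le> (norm (B x))\<^sup>2" if s: "\<bar>s\<bar> = 1" for s
    proof -
      have "((\<epsilon>/2) * norm x)\<^sup>2 \<le> (norm (B x - (s * \<epsilon> / 2) *\<^sub>R x))\<^sup>2"
        using half[OF x s] eps by (intro power_mono) auto
      moreover have "(norm (B x - (s * \<epsilon> / 2) *\<^sub>R x))\<^sup>2 = (norm (B x))\<^sup>2 - 2 * t * (B x \<bullet> x) + (t * t) * (norm x)\<^sup>2" if "t = s * \<epsilon> / 2" for t
        unfolding that[symmetric]
        by (simp add: power2_norm_eq_inner inner_simps inner_commute algebra_simps)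
      from this[OF refl] have "(norm (B x - (s * \<epsilon> / 2) *\<^sub>R x))\<^sup>2
          = (norm (B x))\<^sup>2 - s * \<epsilon> * (B x \<bullet> x) + (s * s) * ((\<epsilon>/2) * norm x)\<^sup>2"
        by (simp add: power_mult_distrib power2_eq_square[of \<epsilon>] power_divide mult.assoc mult.left_commute)
      moreover have "s * s = 1" using s by (metis abs_mult_self_eq mult_1)
      ultimately show ?thesis by simp
    qed
    from this[of 1] this[of "-1"] show ?thesis by (simp add: abs_if)
  qed
  have polar: "2 * \<epsilon> * \<bar>B x \<bullet> y\<bar> \<le> (norm (B x))\<^sup>2 + (norm (B y))\<^sup>2" if xy: "x \<in> D" "y \<in> D" for x y
  proof -
    have "4 * (B x \<bullet> y) = B (x + y) \<bullet> (x + y) - B (x - y) \<bullet> (x - y)"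
      using xy B_sym[of y x] by (simp add: B_add B_diff inner_simps inner_commute)
    then have "4 * (\<epsilon> * \<bar>B x \<bullet> y\<bar>) \<le> \<epsilon> * \<bar>B (x + y) \<bullet> (x + y)\<bar> + \<epsilon> * \<bar>B (x - y) \<bullet> (x - y)\<bar>"
    proof -
      have "4 * \<bar>B x \<bullet> y\<bar> \<le> \<bar>B (x + y) \<bullet> (x + y)\<bar> + \<bar>B (x - y) \<bullet> (x - y)\<bar>"
        using \<open>4 * (B x \<bullet> y) = _\<close> by linarith
      then have "\<epsilon> * (4 * \<bar>B x \<bullet> y\<bar>) \<le> \<epsilon> * (\<bar>B (x + y) \<bullet> (x + y)\<bar> + \<bar>B (x - y) \<bullet> (x - y)\<bar>)"
        using eps by (intro mult_left_mono) auto
      then show ?thesis by (simp add: distrib_left mult.left_commute)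
    qed
    also have "\<dots> \<le> (norm (B (x + y)))\<^sup>2 + (norm (B (x - y)))\<^sup>2"
      by (intro add_mono quad) (simp_all add: xy D_add D_diff)
    also have "\<dots> = 2 * (norm (B x))\<^sup>2 + 2 * (norm (B y))\<^sup>2"
      using xy by (simp add: B_add B_diff power2_norm_eq_inner inner_simps inner_commute)
    finally show ?thesis by simp
  qed
  \<comment> \<open>Rescaling \<open>x\<close> by \<open>s\<close> and \<open>y\<close> by
    \<open>1/s\<close> balances the two squares in \<open>polar\<close>, so that their sum becomes
    twice the product.\<close>
  have CS: "\<epsilon> * \<bar>B x \<bullet> y\<bar> \<le> norm (B x) * norm (B y)" if xy: "x \<in> D" "y \<in> D" for x y
  proof (cases "B x = 0 \<or> B y = 0")
    case True then show ?thesis using B_sym[OF xy] by auto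
  next
    case False
    define s where "s = sqrt (norm (B y) / norm (B x))"
    have s: "s > 0" "s\<^sup>2 = norm (B y) / norm (B x)" using False by (auto simp: s_def)
    have "2 * \<epsilon> * \<bar>B (s *\<^sub>R x) \<bullet> ((1/s) *\<^sub>R y)\<bar> \<le> (norm (B (s *\<^sub>R x)))\<^sup>2 + (norm (B ((1/s) *\<^sub>R y)))\<^sup>2"
      by (rule polar) (simp_all add: xy D_scale)
    also have "\<dots> = s\<^sup>2 * (norm (B x))\<^sup>2 + (norm (B y))\<^sup>2 / s\<^sup>2"
      using xy by (simp add: B_scale power_mult_distrib power_divide)
    also have "\<dots> = 2 * (norm (B x) * norm (B y))"
      unfolding s(2) using False by (simp add: field_simps power2_eq_square)
    finally show ?thesis using s(1) xy by (simp add: B_scale)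
  qed
  have subB: "span (B ` D) = B ` D"
  proof (unfold span_eq_iff, rule subspaceI)
    show "0 \<in> B ` D" using D_0 A_0 by (auto simp: B_def image_iff intro!: bexI[of _ 0])
    show "a + b \<in> B ` D" if ab: "a \<in> B ` D" "b \<in> B ` D" for a b
    proof -
      obtain x y where "a = B x" "b = B y" "x \<in> D" "y \<in> D" using ab by blast
      then show ?thesis using B_add[of x y] D_add[of x y] by (simp flip: B_add)
    qed
    show "s *\<^sub>R a \<in> B ` D" if ab: "a \<in> B ` D" for a s
    proof -
      obtain x where "a = B x" "x \<in> D" using ab by blast
      then show ?thesis using D_scale[of x s] by (simp flip: B_scale)
    qed
  qed
  \<comment> \<open>A vector orthogonal to the range of \<open>B\<close> satisfies the adjoint
    identity, hence lies in the eigenspace of \<mu>. So \<open>u - p\<close> lies there; being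
    orthogonal to both \<open>u\<close> and \<open>p\<close>, it vanishes, and \<open>u\<close> is
    in the closure of the range.\<close>
  define V where "V = closure (span (B ` D))"
  have V: "subspace V" "closed V" by (simp_all add: V_def closed_span)
  define p where "p = orth_proj V u"
  have BV: "B x \<in> V" if "x \<in> D" for x
    unfolding V_def by (intro subsetD[OF closure_subset] span_base imageI that)
  have "B x \<bullet> (u - p) = 0" if "x \<in> D" for x
    using orth_proj_orth[OF V BV[OF that], of u] by (simp add: p_def inner_commute)
  then have "A x \<bullet> (u - p) - \<mu> *\<^sub>R x \<bullet> (u - p) = 0" if "x \<in> D" for x
    using that by (simp add: B_def inner_diff_left)
  then have "A x \<bullet> (u - p) = x \<bullet> (\<mu> *\<^sub>R (u - p))" if "x \<in> D" for x
    using that by simp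
  then have "u - p \<in> eigenspace \<mu>" using adjointI[of "u - p" "\<mu> *\<^sub>R (u - p)"] by (simp add: eigenspace_def)
  then have "u \<bullet> (u - p) = 0" by (rule orth)
  moreover have "p \<bullet> (u - p) = 0"
    using orth_proj_orth[OF V orth_proj_in[OF V], of u u] by (simp add: p_def inner_commute)
  ultimately have "(u - p) \<bullet> (u - p) = 0" by (simp add: inner_simps)
  then have "u \<in> V" using orth_proj_in[OF V, of u] by (simp add: p_def)
  then obtain y where y: "\<And>n. y n \<in> B ` D" "y \<longlonglongrightarrow> u" unfolding V_def subB closure_sequential by blast
  have "\<epsilon> * \<bar>u \<bullet> u\<bar> \<le> norm u * norm (B u)"
  proof (rule LIMSEQ_le)
    show "(\<lambda>n. \<epsilon> * \<bar>y n \<bullet> u\<bar>) \<longlonglongrightarrow> \<epsilon> * \<bar>u \<bullet> u\<bar>" by (intro tendsto_intros y)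
    show "(\<lambda>n. norm (y n) * norm (B u)) \<longlonglongrightarrow> norm u * norm (B u)" by (intro tendsto_intros y)
    show "\<exists>N. \<forall>n\<ge>N. \<epsilon> * \<bar>y n \<bullet> u\<bar> \<le> norm (y n) * norm (B u)"
    proof (intro exI allI impI)
      fix n
      obtain v where "v \<in> D" "y n = B v" using y(1) by blast
      then show "\<epsilon> * \<bar>y n \<bullet> u\<bar> \<le> norm (y n) * norm (B u)" using CS[of v u] u by simp
    qed
  qed
  then show ?thesis by (cases "u = 0") (auto simp: B_def dot_square_norm power2_eq_square)
qed

text \<open>On the orthogonal complement \<open>N\<close> of all eigenvectors every A - c' is
  bounded below, by \<open>isolated_point_bounded_below\<close>, and \<open>N\<close> is invariant
  under the resolvent. Hence \<open>resolvent_distance\<close> holds on \<open>N\<close> with every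
  radius \<open>r\<close>; the resolvent annihilates \<open>N\<close>, and being injective it forces
  \<open>N\<close> to be trivial.\<close>

lemma eigenvectors_total:
  assumes iso: "\<And>\<mu>. \<exists>\<epsilon>>0. \<forall>c. 0 < \<bar>c - \<mu>\<bar> \<longrightarrow> \<bar>c - \<mu>\<bar> < \<epsilon> \<longrightarrow> c \<in> resolvent_set D A"
    and x: "\<And>z e. e \<in> eigenspace z \<Longrightarrow> x \<bullet> e = 0"
  shows "x = 0"
proof -
  define N where "N = {x. \<forall>z. \<forall>e\<in>eigenspace z. x \<bullet> e = 0}"
  have N: "subspace N" by (auto simp: N_def subspace_def inner_simps)
  obtain \<epsilon> where e: "\<epsilon> > 0" "\<And>c. 0 < \<bar>c\<bar> \<Longrightarrow> \<bar>c\<bar> < \<epsilon> \<Longrightarrow> c \<in> resolvent_set D A"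
    using iso[of 0] by auto
  \<comment> \<open>Some resolvent point is needed as a base; one exists because resolvent points
    fill a punctured neighbourhood of 0.\<close>
  define c where "c = \<epsilon> / 2"
  have c: "c \<in> resolvent_set D A" using e by (simp add: c_def)
  have "x \<in> (\<lambda>u. A u - c *\<^sub>R u) ` D" using c by (simp add: resolvent_set_def bij_betw_def)
  then obtain u where u: "u \<in> D" "A u - c *\<^sub>R u = x" by blast
  have xN: "x \<in> N" using x by (auto simp: N_def)
  have inv: "v \<in> N" if v: "v \<in> D" "A v - c *\<^sub>R v \<in> N" for v
    unfolding N_def
  proof (intro CollectI allI ballI)
    fix z e assume e: "e \<in> eigenspace z"
    show "v \<bullet> e = 0"
    proof (cases "e = 0")
      case False
      have "z \<noteq> c"
      proof
        assume "z = c"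
        then have "e = 0" using c e A_0 D_0 unfolding resolvent_set_def bij_betw_def inj_on_def eigenspace_def
          by fastforce
        then show False using False by simp
      qed
      have "0 = (A v - c *\<^sub>R v) \<bullet> e" using v(2) e by (auto simp: N_def)
      also have "\<dots> = (z - c) * (v \<bullet> e)"
        using e v(1) A_symmetric[of v e] by (auto simp: eigenspace_def inner_simps algebra_simps)
      finally show ?thesis using \<open>z \<noteq> c\<close> by simp
    qed simp
  qed
  have "r * norm u \<le> norm x" if r: "r > 0" for r
  proof -
    have "r * norm u \<le> norm (A u - c *\<^sub>R u)"
    proof (rule resolvent_distance[OF c N inv _ r])
      fix c'
      obtain \<epsilon> where "\<epsilon> > 0" "\<And>c. 0 < \<bar>c - c'\<bar> \<Longrightarrow> \<bar>c - c'\<bar> < \<epsilon> \<Longrightarrow> c \<in> resolvent_set D A"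
        using iso[of c'] by auto
      then show "\<exists>d>0. \<forall>u\<in>D \<inter> N. d * norm u \<le> norm (A u - c' *\<^sub>R u)"
        using isolated_point_bounded_below[of \<epsilon> c'] by (auto simp: N_def)
    qed (use u xN in auto)
    then show ?thesis using u by simp
  qed
  \<comment> \<open>With this radius a nonzero \<open>u\<close> would give norm x + 1 \<le> norm
    x.\<close>
  from this[of "(norm x + 1) / norm u"] have "norm u = 0"
    by (cases "norm u = 0") (auto simp: add_nonneg_pos)
  then show ?thesis using u A_0 by simp
qed

end

section \<open>Eigenprojections and multipliers\<close>

text \<open>What is kept of the spectral hypothesis: finitely many eigenvalues below each bound, so
  that truncations are finite sums, and totality, so that a vector is determined by its
  projections.\<close>

locale discrete_selfadjoint = selfadjoint D A
  for D :: "'a::{real_inner,complete_space} set" and A :: "'a \<Rightarrow> 'a" +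
  assumes nonneg: "nonnegative_operator D A"
    and finite_eigenvalues: "finite {z. eigenvalue D A z \<and> z \<le> M}"
    and total: "(\<And>z e. e \<in> eigenspace z \<Longrightarrow> x \<bullet> e = 0) \<Longrightarrow> x = 0"
begin

definition P :: "real \<Rightarrow> 'a \<Rightarrow> 'a" where "P z = orth_proj (eigenspace z)"

text \<open>Exhausting the eigenvalues by these finite sets turns eigenvector expansions into limits
  over \<open>n\<close>. Reals that are not eigenvalues do no harm elsewhere, since
  \<open>P z\<close> vanishes for them.\<close>

definition Lam :: "nat \<Rightarrow> real set" where "Lam n = {z. eigenvalue D A z \<and> z \<le> real n}"

definition Q :: "nat \<Rightarrow> 'a \<Rightarrow> 'a" where "Q n x = (\<Sum>z\<in>Lam n. P z x)"

lemmas eigenspace_closed_subspace = subspace_eigenspace closed_eigenspace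

lemma bounded_linear_P: "bounded_linear (P z)"
  unfolding P_def by (rule bounded_linear_orth_proj[OF eigenspace_closed_subspace])

lemma P_in: "P z x \<in> eigenspace z"
  and P_eq_self: "v \<in> eigenspace z \<Longrightarrow> P z v = v"
  and P_sym: "P z x \<bullet> y = x \<bullet> P z y"
  and P_orth: "v \<in> eigenspace z \<Longrightarrow> P z x \<bullet> v = x \<bullet> v"
  and norm_P_le: "norm (P z x) \<le> norm x"
  and P_inner_self: "P z x \<bullet> x = (norm (P z x))\<^sup>2"
  unfolding P_def
  by (simp_all add: orth_proj_in orth_proj_eq_self orth_proj_symmetric inner_orth_proj
      norm_orth_proj_le eigenspace_closed_subspace)
    (simp add: inner_orth_proj_self eigenspace_closed_subspace flip: orth_proj_symmetric)

lemma P_add: "P z (x + y) = P z x + P z y"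
  and P_diff: "P z (x - y) = P z x - P z y"
  and P_scale: "P z (c *\<^sub>R x) = c *\<^sub>R P z x"
  and P_0: "P z 0 = 0"
  and P_sum: "P z (sum f F) = (\<Sum>i\<in>F. P z (f i))"
  using bounded_linear_P[of z]
  by (simp_all add: linear_simps bounded_linear.linear linear_sum)

lemma P_eq_0: "v \<in> eigenspace y \<Longrightarrow> y \<noteq> z \<Longrightarrow> P z v = 0"
  unfolding P_def
  by (rule orth_proj_eq_0[OF eigenspace_closed_subspace]) (use eigenspace_orthogonal in blast)

lemma P_P: "P z (P y x) = (if y = z then P z x else 0)"
  by (simp add: P_eq_self P_in P_eq_0[OF P_in])

lemma eigenvalue_nonneg: "eigenvalue D A z \<Longrightarrow> 0 \<le> z"
proof -
  assume "eigenvalue D A z"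
  then obtain v where "v \<in> D" "v \<noteq> 0" "A v = z *\<^sub>R v" by (auto simp: eigenvalue_def eigenvector_def)
  moreover have "0 \<le> A v \<bullet> v" using nonneg \<open>v \<in> D\<close> by (auto simp: nonnegative_operator_def)
  ultimately show "0 \<le> z" by (simp add: zero_le_mult_iff) (metis inner_gt_zero_iff less_le_not_le)
qed

lemma not_eigenvalue: "\<not> eigenvalue D A z \<Longrightarrow> v \<in> eigenspace z \<Longrightarrow> v = 0"
  using eigenvector_iff by (auto simp: eigenvalue_def)

lemma P_not_eigenvalue: "\<not> eigenvalue D A z \<Longrightarrow> P z x = 0"
  using not_eigenvalue P_in by blast

lemma finite_Lam: "finite (Lam n)"
  unfolding Lam_def by (rule finite_eigenvalues)

lemma Lam_mono: "m \<le> n \<Longrightarrow> Lam m \<subseteq> Lam n"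
  by (auto simp: Lam_def)

lemma Lam_nonneg: "z \<in> Lam n \<Longrightarrow> 0 \<le> z"
  by (auto simp: Lam_def eigenvalue_nonneg)

lemma eventually_in_Lam: "eigenvalue D A z \<Longrightarrow> \<forall>\<^sub>F n in sequentially. z \<in> Lam n"
proof -
  assume "eigenvalue D A z"
  moreover obtain N where "z \<le> real N" using real_arch_simple by blast
  ultimately show ?thesis by (auto simp: Lam_def eventually_sequentially intro!: exI[of _ N])
qed

lemma norm_sum_eigen:
  assumes "finite F" "\<And>z. z \<in> F \<Longrightarrow> v z \<in> eigenspace z"
  shows "(norm (\<Sum>z\<in>F. v z))\<^sup>2 = (\<Sum>z\<in>F. (norm (v z))\<^sup>2)"
  using assms
proof (induction rule: finite_induct)
  case (insert z F)
  have "v z \<bullet> (\<Sum>y\<in>F. v y) = 0"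
    unfolding inner_sum_right
    by (rule sum.neutral) (use insert in \<open>metis eigenspace_orthogonal insertI1 insertI2\<close>)
  then show ?case
    using insert by (simp add: power2_norm_eq_inner inner_simps inner_commute)
qed simp

lemma norm_diff_sum_P:
  assumes "finite F"
  shows "(norm (x - (\<Sum>z\<in>F. P z x)))\<^sup>2 = (norm x)\<^sup>2 - (\<Sum>z\<in>F. (norm (P z x))\<^sup>2)"
proof -
  have "(\<Sum>z\<in>F. P z x) \<bullet> x = (\<Sum>z\<in>F. (norm (P z x))\<^sup>2)"
    by (simp add: inner_sum_left P_inner_self)
  moreover have "(norm (\<Sum>z\<in>F. P z x))\<^sup>2 = (\<Sum>z\<in>F. (norm (P z x))\<^sup>2)"
    by (rule norm_sum_eigen[OF assms P_in])
  ultimately show ?thesis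
    by (simp add: power2_norm_eq_inner inner_simps inner_commute)
qed

lemma bessel: "finite F \<Longrightarrow> (\<Sum>z\<in>F. (norm (P z x))\<^sup>2) \<le> (norm x)\<^sup>2"
  using norm_diff_sum_P[of F x] zero_le_power2[of "norm (x - (\<Sum>z\<in>F. P z x))"] by linarith

text \<open>Totality in its working form: identities between vectors are verified mode by
  mode.\<close>

lemma P_ext:
  assumes "\<And>z. P z x = P z y" shows "x = y"
proof -
  have "(x - y) \<bullet> e = 0" if "e \<in> eigenspace z" for z e
    using P_orth[OF that, of "x - y"] assms by (simp add: P_diff)
  then have "x - y = 0" by (rule total)
  then show ?thesis by simp
qed

lemma P_sum_eigen:
  assumes v: "\<And>y. v y \<in> eigenspace y" and "eigenvalue D A z \<Longrightarrow> z \<in> F" "finite F"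
  shows "P z (\<Sum>y\<in>F. v y) = v z"
proof -
  have "P z (\<Sum>y\<in>F. v y) = (\<Sum>y\<in>F. if y = z then v z else 0)"
    unfolding P_sum by (rule sum.cong) (auto simp: P_eq_self v P_eq_0[OF v])
  also have "\<dots> = v z" using assms not_eigenvalue[OF _ v] by auto
  finally show ?thesis .
qed

text \<open>The partial sums are Cauchy because, by orthogonality, their squared distances are
  differences of the bounded increasing sequence \<open>s\<close>. Each \<open>P z\<close> is
  continuous, hence commutes with the limit.\<close>

lemma riesz_fischer:
  assumes v: "\<And>z. v z \<in> eigenspace z" and C: "\<And>n. (\<Sum>z\<in>Lam n. (norm (v z))\<^sup>2) \<le> C"
  obtains y where "(\<lambda>n. \<Sum>z\<in>Lam n. v z) \<longlonglongrightarrow> y" "\<And>z. P z y = v z"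
proof -
  define s where "s n = (\<Sum>z\<in>Lam n. (norm (v z))\<^sup>2)" for n
  have "incseq s" unfolding s_def
    by (intro monoI sum_mono2 finite_Lam Lam_mono) auto
  then have "convergent s"
    by (rule incseq_convergent[of s C]) (use C in \<open>auto simp: s_def convergent_def\<close>)
  then have cau: "Cauchy s" by (rule convergent_Cauchy)
  have d: "(norm ((\<Sum>z\<in>Lam n. v z) - (\<Sum>z\<in>Lam m. v z)))\<^sup>2 = s n - s m" if "m \<le> n" for m n
  proof -
    have "(\<Sum>z\<in>Lam n. v z) - (\<Sum>z\<in>Lam m. v z) = (\<Sum>z\<in>Lam n - Lam m. v z)"
      using sum.subset_diff[OF Lam_mono[OF that] finite_Lam, of v] by simp
    moreover have "s n - s m = (\<Sum>z\<in>Lam n - Lam m. (norm (v z))\<^sup>2)" unfolding s_def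
      using sum.subset_diff[OF Lam_mono[OF that] finite_Lam, of "\<lambda>z. (norm (v z))\<^sup>2"] by simp
    ultimately show ?thesis using norm_sum_eigen[of "Lam n - Lam m" v] v finite_Lam by simp
  qed
  have "Cauchy (\<lambda>n. \<Sum>z\<in>Lam n. v z)"
  proof (rule CauchyI')
    fix e :: real assume "e > 0"
    then obtain M where M: "\<And>m n. M \<le> m \<Longrightarrow> M \<le> n \<Longrightarrow> norm (s m - s n) < e\<^sup>2"
      using CauchyD[OF cau, of "e\<^sup>2"] by auto
    have "dist (\<Sum>z\<in>Lam m. v z) (\<Sum>z\<in>Lam n. v z) < e" if "M \<le> m" "m < n" for m n
    proof -
      have "(dist (\<Sum>z\<in>Lam m. v z) (\<Sum>z\<in>Lam n. v z))\<^sup>2 < e\<^sup>2"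
        using M[of n m] d[of m n] that by (simp add: dist_norm norm_minus_commute)
      then show ?thesis using \<open>e > 0\<close> by (simp add: power_less_imp_less_base)
    qed
    then show "\<exists>M. \<forall>m\<ge>M. \<forall>n>m. dist (\<Sum>z\<in>Lam m. v z) (\<Sum>z\<in>Lam n. v z) < e" by blast
  qed
  then obtain y where y: "(\<lambda>n. \<Sum>z\<in>Lam n. v z) \<longlonglongrightarrow> y"
    using Cauchy_convergent_iff convergent_def by blast
  have "P z y = v z" for z
  proof (rule LIMSEQ_unique)
    show "(\<lambda>n. P z (\<Sum>z\<in>Lam n. v z)) \<longlonglongrightarrow> P z y"
      by (intro bounded_linear.tendsto[OF bounded_linear_P] y)
    have "\<forall>\<^sub>F n in sequentially. eigenvalue D A z \<longrightarrow> z \<in> Lam n"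
      by (cases "eigenvalue D A z") (auto intro: eventually_in_Lam)
    then have "\<forall>\<^sub>F n in sequentially. P z (\<Sum>z\<in>Lam n. v z) = v z"
      by eventually_elim (intro P_sum_eigen v finite_Lam, auto)
    then show "(\<lambda>n. P z (\<Sum>z\<in>Lam n. v z)) \<longlonglongrightarrow> v z" by (rule tendsto_eventually)
  qed
  with y that show ?thesis by blast
qed

text \<open>\<open>riesz_fischer\<close> yields some limit of the partial sums; it has the
  projections of \<open>x\<close>, so it is \<open>x\<close>.\<close>

lemma Q_tendsto: "(\<lambda>n. Q n x) \<longlonglongrightarrow> x"
proof -
  obtain y where y: "(\<lambda>n. \<Sum>z\<in>Lam n. P z x) \<longlonglongrightarrow> y" "\<And>z. P z y = P z x"
    using riesz_fischer[of "\<lambda>z. P z x" "(norm x)\<^sup>2"] bessel[OF finite_Lam] P_in by blast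
  have "y = x" by (rule P_ext) (rule y)
  with y show ?thesis by (simp add: Q_def)
qed

lemma bounded_linear_Q: "bounded_linear (Q n)"
  unfolding Q_def by (intro bounded_linear_sum bounded_linear_P)

lemma parseval: "(\<lambda>n. \<Sum>z\<in>Lam n. P z x \<bullet> P z y) \<longlonglongrightarrow> x \<bullet> y"
proof -
  have "Q n x \<bullet> y = (\<Sum>z\<in>Lam n. P z x \<bullet> P z y)" for n
    unfolding Q_def inner_sum_left
    by (rule sum.cong[OF refl]) (metis P_in P_orth inner_commute)
  moreover have "(\<lambda>n. Q n x \<bullet> y) \<longlonglongrightarrow> x \<bullet> y" by (intro tendsto_intros Q_tendsto)
  ultimately show ?thesis by simp
qed

lemma parseval_norm: "(\<lambda>n. \<Sum>z\<in>Lam n. (norm (P z x))\<^sup>2) \<longlonglongrightarrow> (norm x)\<^sup>2"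
  using parseval[of x x] by (simp add: power2_norm_eq_inner)

lemma norm_le_if_partial:
  assumes "\<And>n. (\<Sum>z\<in>Lam n. (norm (P z x))\<^sup>2) \<le> B" shows "(norm x)\<^sup>2 \<le> B"
  by (rule LIMSEQ_le_const2[OF parseval_norm]) (use assms in auto)

lemma norm_diff_Q: "(norm (x - Q n x))\<^sup>2 = (norm x)\<^sup>2 - (\<Sum>z\<in>Lam n. (norm (P z x))\<^sup>2)"
  unfolding Q_def by (rule norm_diff_sum_P[OF finite_Lam])

lemma norm_diff_Q_le: "norm (x - Q n x) \<le> norm x"
  using norm_diff_Q[of x n] sum_nonneg[of "Lam n" "\<lambda>z. (norm (P z x))\<^sup>2"]
  by (intro power2_le_imp_le[OF _ norm_ge_zero]) auto

lemma tail_le: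
  assumes "finite F" "F \<inter> Lam n = {}"
  shows "(\<Sum>z\<in>F. (norm (P z x))\<^sup>2) \<le> (norm (x - Q n x))\<^sup>2"
proof -
  have "(\<Sum>z\<in>F. (norm (P z x))\<^sup>2) + (\<Sum>z\<in>Lam n. (norm (P z x))\<^sup>2) = (\<Sum>z\<in>F \<union> Lam n. (norm (P z x))\<^sup>2)"
    by (rule sum.union_disjoint[symmetric]) (use assms finite_Lam in auto)
  also have "\<dots> \<le> (norm x)\<^sup>2" by (rule bessel) (use assms finite_Lam in auto)
  finally show ?thesis by (simp add: norm_diff_Q)
qed

text \<open>Membership asks for the image vector itself, which makes algebra with multipliers
  immediate. Square summability of the scaled projections is equivalent, by
  \<open>mult_dom_boundedI\<close> and \<open>mult_bounded\<close>.\<close>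

definition mult_dom :: "(real \<Rightarrow> real) \<Rightarrow> 'a set" where
  "mult_dom \<phi> = {x. \<exists>y. \<forall>z. P z y = \<phi> z *\<^sub>R P z x}"

definition mult :: "(real \<Rightarrow> real) \<Rightarrow> 'a \<Rightarrow> 'a" where
  "mult \<phi> x = (THE y. \<forall>z. P z y = \<phi> z *\<^sub>R P z x)"

lemma multI:
  assumes "\<And>z. P z y = \<phi> z *\<^sub>R P z x"
  shows "x \<in> mult_dom \<phi>" "mult \<phi> x = y"
proof -
  show "x \<in> mult_dom \<phi>" unfolding mult_dom_def using assms by blast
  show "mult \<phi> x = y" unfolding mult_def
  proof (rule the_equality)
    show "\<forall>z. P z y = \<phi> z *\<^sub>R P z x" using assms by blast
    fix w assume w: "\<forall>z. P z w = \<phi> z *\<^sub>R P z x"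
    show "w = y" by (rule P_ext) (use assms w in simp)
  qed
qed

lemma P_mult: "x \<in> mult_dom \<phi> \<Longrightarrow> P z (mult \<phi> x) = \<phi> z *\<^sub>R P z x"
proof -
  assume "x \<in> mult_dom \<phi>"
  then obtain y where y: "\<And>z. P z y = \<phi> z *\<^sub>R P z x" unfolding mult_dom_def by blast
  from multI(2)[of y \<phi> x, OF y] y show ?thesis by simp
qed

lemma mult_dom_boundedI:
  assumes "\<And>n. (\<Sum>z\<in>Lam n. (\<phi> z)\<^sup>2 * (norm (P z x))\<^sup>2) \<le> C"
  shows "x \<in> mult_dom \<phi>"
proof -
  have "\<phi> z *\<^sub>R P z x \<in> eigenspace z" for z 
    by (rule subspace_scale[OF subspace_eigenspace P_in])
  then obtain y where "\<And>z. P z y = \<phi> z *\<^sub>R P z x"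
    by (rule riesz_fischer[of "\<lambda>z. \<phi> z *\<^sub>R P z x" C]) (use assms in \<open>auto simp: power_mult_distrib\<close>)
  then show ?thesis by (rule multI(1))
qed

lemma mult_bounded:
  assumes "x \<in> mult_dom \<phi>" "finite F"
  shows "(\<Sum>z\<in>F. (\<phi> z)\<^sup>2 * (norm (P z x))\<^sup>2) \<le> (norm (mult \<phi> x))\<^sup>2"
  using bessel[OF assms(2), of "mult \<phi> x"] by (simp add: P_mult assms power_mult_distrib)

lemma mult_add:
  assumes "x \<in> mult_dom \<phi>" "y \<in> mult_dom \<phi>"
  shows "x + y \<in> mult_dom \<phi>" "mult \<phi> (x + y) = mult \<phi> x + mult \<phi> y"
proof -
  have "P z (mult \<phi> x + mult \<phi> y) = \<phi> z *\<^sub>R P z (x + y)" for z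
    using assms by (simp add: P_add P_mult scaleR_add_right)
  from multI[OF this] show "x + y \<in> mult_dom \<phi>" "mult \<phi> (x + y) = mult \<phi> x + mult \<phi> y" .
qed

lemma mult_diff:
  assumes "x \<in> mult_dom \<phi>" "y \<in> mult_dom \<phi>"
  shows "x - y \<in> mult_dom \<phi>" "mult \<phi> (x - y) = mult \<phi> x - mult \<phi> y"
proof -
  have "P z (mult \<phi> x - mult \<phi> y) = \<phi> z *\<^sub>R P z (x - y)" for z
    using assms by (simp add: P_diff P_mult scaleR_diff_right)
  from multI[OF this] show "x - y \<in> mult_dom \<phi>" "mult \<phi> (x - y) = mult \<phi> x - mult \<phi> y" .
qed

lemma mult_scale:
  assumes "x \<in> mult_dom \<phi>"
  shows "c *\<^sub>R x \<in> mult_dom \<phi>" "mult \<phi> (c *\<^sub>R x) = c *\<^sub>R mult \<phi> x"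
proof -
  have "P z (c *\<^sub>R mult \<phi> x) = \<phi> z *\<^sub>R P z (c *\<^sub>R x)" for z
    using assms by (simp add: P_scale P_mult)
  from multI[OF this] show "c *\<^sub>R x \<in> mult_dom \<phi>" "mult \<phi> (c *\<^sub>R x) = c *\<^sub>R mult \<phi> x" .
qed

lemma mult_eigen:
  assumes "v \<in> eigenspace z"
  shows "v \<in> mult_dom \<phi>" "mult \<phi> v = \<phi> z *\<^sub>R v"
proof -
  have "P y (\<phi> z *\<^sub>R v) = \<phi> y *\<^sub>R P y v" for y
  proof (cases "z = y")
    case False
    then have "P y v = 0" by (rule P_eq_0[OF assms])
    then show ?thesis by (simp add: P_scale)
  qed (simp add: P_scale)
  from multI[OF this] show "v \<in> mult_dom \<phi>" "mult \<phi> v = \<phi> z *\<^sub>R v" .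
qed

lemma P_A: "x \<in> D \<Longrightarrow> P z (A x) = z *\<^sub>R P z x"
proof -
  assume x: "x \<in> D"
  have "(P z (A x) - z *\<^sub>R P z x) \<bullet> e = 0" if e: "e \<in> eigenspace z" for e
  proof -
    have "P z (A x) \<bullet> e = A x \<bullet> e" "P z x \<bullet> e = x \<bullet> e" by (rule P_orth[OF e])+
    moreover have "A x \<bullet> e = z * (x \<bullet> e)" using A_symmetric[OF x, of e] e by (auto simp: eigenspace_def)
    ultimately show ?thesis by (simp add: inner_simps)
  qed
  moreover have "P z (A x) - z *\<^sub>R P z x \<in> eigenspace z"
    by (intro subspace_diff[OF subspace_eigenspace] subspace_scale[OF subspace_eigenspace] P_in)
  ultimately have "(P z (A x) - z *\<^sub>R P z x) \<bullet> (P z (A x) - z *\<^sub>R P z x) = 0" .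
  then show ?thesis by simp
qed

text \<open>For the inclusion into \<open>D\<close>, Parseval shows that \<open>x\<close> and
  \<open>mult (\<lambda>z. z) x\<close> satisfy the adjoint identity on \<open>D\<close>, and
  \<open>adjointI\<close> applies. The converse is \<open>P_A\<close>.\<close>

lemma D_eq_mult_dom: "D = mult_dom (\<lambda>z. z)"
  and A_eq_mult: "x \<in> D \<Longrightarrow> A x = mult (\<lambda>z. z) x"
proof -
  have "x \<in> D" if x: "x \<in> mult_dom (\<lambda>z. z)" for x
  proof (rule adjointI)
    fix w assume w: "w \<in> D"
    have "(\<lambda>n. \<Sum>z\<in>Lam n. P z (A w) \<bullet> P z x) \<longlonglongrightarrow> A w \<bullet> x"
      "(\<lambda>n. \<Sum>z\<in>Lam n. P z w \<bullet> P z (mult (\<lambda>z. z) x)) \<longlonglongrightarrow> w \<bullet> mult (\<lambda>z. z) x"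
      by (rule parseval)+
    then show "A w \<bullet> x = w \<bullet> mult (\<lambda>z. z) x"
      unfolding P_A[OF w] P_mult[OF x] inner_scaleR_left inner_scaleR_right by (rule LIMSEQ_unique)
  qed
  moreover have "x \<in> mult_dom (\<lambda>z. z)" if "x \<in> D" for x
    using multI(1)[of "A x" "\<lambda>z. z" x, OF P_A[OF that]] .
  ultimately show "D = mult_dom (\<lambda>z. z)" by (intro equalityI subsetI)
  show "A x = mult (\<lambda>z. z) x" if "x \<in> D"
    using multI(2)[of "A x" "\<lambda>z. z" x, OF P_A[OF that]] by (rule sym)
qed

end

section \<open>Projection-valued measures\<close>

locale pvm =
  fixes E :: "real set \<Rightarrow> 'a::{real_inner,complete_space} \<Rightarrow> 'a"
  assumes pvm: "projection_valued_measure E"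
begin

lemma bounded_linear_E: "S \<in> sets borel \<Longrightarrow> bounded_linear (E S)"
  and E_idem: "S \<in> sets borel \<Longrightarrow> E S (E S x) = E S x"
  and E_sym: "S \<in> sets borel \<Longrightarrow> E S x \<bullet> y = x \<bullet> E S y"
  and E_UNIV: "E UNIV x = x"
  and E_sums: "range X \<subseteq> sets borel \<Longrightarrow> disjoint_family X \<Longrightarrow> (\<lambda>n::nat. E (X n) x) sums E (\<Union>n. X n) x"
  using pvm unfolding projection_valued_measure_def by blast+

lemma E_inner_self: "S \<in> sets borel \<Longrightarrow> E S x \<bullet> x = (norm (E S x))\<^sup>2"
  by (metis E_idem E_sym power2_norm_eq_inner inner_commute)

text \<open>The series all of whose terms are \<open>E {} x\<close> converges, so its terms tend to
  zero.\<close>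

lemma E_empty: "E {} x = 0"
proof -
  have "(\<lambda>n::nat. E {} x) sums E (\<Union>n::nat. {}) x"
    by (rule E_sums) (auto simp: disjoint_family_on_def)
  then have "(\<lambda>n::nat. E {} x) \<longlonglongrightarrow> 0" by (intro summable_LIMSEQ_zero sums_summable)
  then show ?thesis by (simp add: LIMSEQ_const_iff)
qed

lemma E_Un:
  assumes "S \<in> sets borel" "T \<in> sets borel" "S \<inter> T = {}"
  shows "E (S \<union> T) x = E S x + E T x"
proof -
  have *: "(\<lambda>n. E (binaryset S T n) x) sums E (\<Union>n. binaryset S T n) x"
    using assms by (intro E_sums) (auto simp: binaryset_def disjoint_family_on_def)
  have "(\<lambda>n. E (binaryset S T n) x) sums (\<Sum>n<2. E (binaryset S T n) x)"
    by (rule sums_finite) (auto simp: binaryset_def E_empty)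
  moreover have "(\<Sum>n<2. E (binaryset S T n) x) = E S x + E T x"
    by (simp add: binaryset_def numeral_2_eq_2)
  ultimately show ?thesis using * sums_unique2 UN_binaryset_eq[of S T] by metis
qed

text \<open>Orthogonality is not part of the definition and follows from additivity: for y = E T x
  the form <E (S \<union> T) y, y> is at most |y|^2 and also equals |E S y|^2 + |y|^2.\<close>

lemma E_disjoint:
  assumes ST: "S \<in> sets borel" "T \<in> sets borel" "S \<inter> T = {}"
  shows "E S (E T x) = 0"
proof -
  let ?y = "E T x"
  have U: "S \<union> T \<in> sets borel" using ST by auto
  let ?p = "E (S \<union> T) ?y"
  have "?p \<bullet> ?y \<le> (norm ?y)\<^sup>2"
  proof -
    have "0 \<le> (norm (?y - ?p))\<^sup>2" by simp
    also have "\<dots> = (norm ?y)\<^sup>2 - 2 * (?p \<bullet> ?y) + (norm ?p)\<^sup>2"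
      by (simp add: power2_norm_eq_inner inner_simps inner_commute)
    finally show ?thesis using E_inner_self[OF U, of ?y] by simp
  qed
  moreover have "?p \<bullet> ?y = (norm (E S ?y))\<^sup>2 + (norm ?y)\<^sup>2"
    using ST by (simp add: E_Un E_idem inner_add_left E_inner_self power2_norm_eq_inner)
  ultimately show ?thesis by simp
qed

lemma E_Int:
  assumes ST: "S \<in> sets borel" "T \<in> sets borel"
  shows "E S (E T x) = E (S \<inter> T) x"
proof -
  have "E ((S \<inter> T) \<union> (S - T)) (E T x) = E (S \<inter> T) (E T x) + E (S - T) (E T x)"
    using ST by (intro E_Un) auto
  moreover have "E (S - T) (E T x) = 0" using ST by (intro E_disjoint) auto
  ultimately have 1: "E S (E T x) = E (S \<inter> T) (E T x)" by (simp add: Int_Diff_Un)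
  have "E ((S \<inter> T) \<union> (T - S)) x = E (S \<inter> T) x + E (T - S) x"
    using ST by (intro E_Un) auto
  moreover have "(S \<inter> T) \<union> (T - S) = T" by auto
  ultimately have "E (S \<inter> T) (E T x) = E (S \<inter> T) (E (S \<inter> T) x) + E (S \<inter> T) (E (T - S) x)"
    using ST bounded_linear_E[of "S \<inter> T"] by (simp add: linear_simps)
  moreover have "E (S \<inter> T) (E (T - S) x) = 0" using ST by (intro E_disjoint) auto
  ultimately show ?thesis using 1 ST by (simp add: E_idem)
qed

abbreviation \<mu> where "\<mu> \<equiv> scalar_spectral_measure E"

lemma sets_\<mu> [simp, measurable_cong]: "sets (\<mu> x) = sets borel"
  and space_\<mu> [simp]: "space (\<mu> x) = UNIV"
  by (auto simp: scalar_spectral_measure_def sets_measure_of_conv space_measure_of_conv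
      sets.sigma_sets_eq[of borel, simplified])

lemma emeasure_\<mu>: "S \<in> sets borel \<Longrightarrow> emeasure (\<mu> x) S = ennreal ((norm (E S x))\<^sup>2)"
proof -
  assume S: "S \<in> sets borel"
  have "emeasure (\<mu> x) S = ennreal (E S x \<bullet> x)"
  proof (rule emeasure_measure_of[OF scalar_spectral_measure_def])
    show "positive (sets (\<mu> x)) (\<lambda>S. ennreal (E S x \<bullet> x))" by (simp add: positive_def E_empty)
    show "countably_additive (sets (\<mu> x)) (\<lambda>S. ennreal (E S x \<bullet> x))"
    proof (rule countably_additiveI)
      fix X :: "nat \<Rightarrow> real set"
      assume X: "range X \<subseteq> sets (\<mu> x)" "disjoint_family X"
      then have "(\<lambda>n. E (X n) x) sums E (\<Union>n. X n) x" by (intro E_sums) auto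
      then have sums: "(\<lambda>n. E (X n) x \<bullet> x) sums (E (\<Union>n. X n) x \<bullet> x)"
        by (rule bounded_linear.sums[OF bounded_linear_inner_left])
      have "0 \<le> E (X n) x \<bullet> x" for n using X E_inner_self[of "X n" x] by auto
      then show "(\<Sum>i. ennreal (E (X i) x \<bullet> x)) = ennreal (E (\<Union>i. X i) x \<bullet> x)"
        using sums by (simp add: suminf_ennreal2 sums_iff)
    qed
  qed (use S in auto)
  then show ?thesis by (simp add: E_inner_self S)
qed

lemma finite_measure_\<mu>: "finite_measure (\<mu> x)"
  by (rule finite_measureI) (simp add: emeasure_\<mu>)

lemma measure_\<mu>: "S \<in> sets borel \<Longrightarrow> measure (\<mu> x) S = (norm (E S x))\<^sup>2"
  by (simp add: measure_def emeasure_\<mu>)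

lemma null_\<mu>: "S \<in> sets borel \<Longrightarrow> emeasure (\<mu> x) S = 0 \<Longrightarrow> E S x = 0"
  by (simp add: emeasure_\<mu>)

text \<open>Scaling by \<open>a\<close> on \<open>S\<close> and by \<open>b\<close> off
  \<open>S\<close> enters squared because the spectral measure is quadratic in the vector. Its use
  is to evaluate the two terms of the polarization in \<open>spectral_integral\<close>.\<close>

lemma \<mu>_eq_density:
  assumes g: "g \<in> borel_measurable borel" "\<And>s. 0 \<le> g s"
    and S: "S \<in> sets borel" and g_eq: "\<And>s. g s = (if s \<in> S then a\<^sup>2 else b\<^sup>2)"
  shows "\<mu> (a *\<^sub>R E S x + b *\<^sub>R E (- S) x) = density (\<mu> x) (\<lambda>s. ennreal (g s))"
proof (rule measure_eqI)
  fix T assume "T \<in> sets (\<mu> (a *\<^sub>R E S x + b *\<^sub>R E (- S) x))"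
  then have T: "T \<in> sets borel" by simp
  have "E T (a *\<^sub>R E S x + b *\<^sub>R E (- S) x) = a *\<^sub>R E (T \<inter> S) x + b *\<^sub>R E (T \<inter> - S) x"
    using bounded_linear_E[OF T] S T by (simp add: linear_simps E_Int)
  moreover have "E (T \<inter> S) x \<bullet> E (T \<inter> - S) x = 0"
    using S T by (subst E_sym) (auto simp: E_Int E_empty)
  ultimately have "(norm (E T (a *\<^sub>R E S x + b *\<^sub>R E (- S) x)))\<^sup>2
      = a\<^sup>2 * (norm (E (T \<inter> S) x))\<^sup>2 + b\<^sup>2 * (norm (E (T \<inter> - S) x))\<^sup>2"
    by (simp add: power2_norm_eq_inner inner_simps inner_commute power2_eq_square[of a] power2_eq_square[of b])
  then have "emeasure (\<mu> (a *\<^sub>R E S x + b *\<^sub>R E (- S) x)) T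
      = ennreal (a\<^sup>2) * emeasure (\<mu> x) (T \<inter> S) + ennreal (b\<^sup>2) * emeasure (\<mu> x) (T \<inter> - S)"
    using S T by (simp add: emeasure_\<mu> ennreal_mult ennreal_plus)
  also have "\<dots> = (\<integral>\<^sup>+s. ennreal (a\<^sup>2) * indicator (T \<inter> S) s + ennreal (b\<^sup>2) * indicator (T \<inter> - S) s \<partial>\<mu> x)"
    using S T by (subst nn_integral_add) (auto simp: nn_integral_cmult_indicator)
  also have "\<dots> = (\<integral>\<^sup>+s. ennreal (g s) * indicator T s \<partial>\<mu> x)"
    by (rule nn_integral_cong) (auto simp: g_eq indicator_def)
  also have "\<dots> = emeasure (density (\<mu> x) (\<lambda>s. ennreal (g s))) T"
    using T g by (simp add: emeasure_density)
  finally show "emeasure (\<mu> (a *\<^sub>R E S x + b *\<^sub>R E (- S) x)) T = \<dots>" .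
qed simp

text \<open>The spectral measure is finite and |s| \<le> 1 + s^2.\<close>

lemma integrable_id:
  assumes "x \<in> calculus_domain E (\<lambda>s. s)"
  shows "integrable (\<mu> x) (\<lambda>s. s)"
proof -
  interpret finite_measure "\<mu> x" by (rule finite_measure_\<mu>)
  have "integrable (\<mu> x) (\<lambda>s. s\<^sup>2)"
    using assms by (intro integrableI_bounded) (auto simp: calculus_domain_def)
  then have "integrable (\<mu> x) (\<lambda>s. 1 + s\<^sup>2)" by simp
  then show ?thesis
  proof (rule Bochner_Integration.integrable_bound)
    have "\<bar>s\<bar> \<le> 1 + s\<^sup>2" for s :: real
      using zero_le_power2[of "\<bar>s\<bar> - 1/2"] by (simp add: power2_diff power_divide)
    then show "AE s in \<mu> x. norm s \<le> norm (1 + s\<^sup>2)" by (simp add: add_nonneg_nonneg)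
  qed simp
qed

text \<open>Pairing \<open>x\<close> with \<open>E S x\<close> is enough to locate the spectral
  measure of \<open>x\<close>, and polarization is explicit there: the measures of
  \<open>x + E S x\<close> and \<open>x - E S x\<close> have densities 4 and 0 on \<open>S\<close>
  and both 1 off \<open>S\<close>, so a quarter of the difference is the indicator of
  \<open>S\<close>.\<close>

lemma spectral_integral_E:
  assumes x: "x \<in> calculus_domain E (\<lambda>s. s)" and S: "S \<in> sets borel"
  shows "E S x \<in> calculus_domain E (\<lambda>s. s)"
    and "spectral_integral E (\<lambda>s. s) x (E S x) = (\<integral>s. indicator S s * s \<partial>\<mu> x)"
proof -
  have split: "x = E S x + E (- S) x" using E_Un[of S "- S" x] S by (simp add: E_UNIV)
  have 1: "\<mu> (E S x) = density (\<mu> x) (\<lambda>s. ennreal (indicator S s))"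
  proof -
    have "\<mu> (1 *\<^sub>R E S x + 0 *\<^sub>R E (- S) x) = density (\<mu> x) (\<lambda>s. ennreal (indicator S s))"
      by (rule \<mu>_eq_density[OF _ _ S]) (use S in \<open>auto simp: indicator_def\<close>)
    then show ?thesis by simp
  qed
  show "E S x \<in> calculus_domain E (\<lambda>s. s)"
  proof -
    have "(\<integral>\<^sup>+s. ennreal (s\<^sup>2) \<partial>\<mu> (E S x)) = (\<integral>\<^sup>+s. ennreal (indicator S s) * ennreal (s\<^sup>2) \<partial>\<mu> x)"
      unfolding 1 using S by (subst nn_integral_density) auto
    also have "\<dots> \<le> (\<integral>\<^sup>+s. ennreal (s\<^sup>2) \<partial>\<mu> x)"
      by (rule nn_integral_mono) (auto simp: indicator_def)
    finally show ?thesis using x by (auto simp: calculus_domain_def)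
  qed
  define g where "g s = (if s \<in> S then 4 else 1 :: real)" for s
  define h where "h s = (if s \<in> S then 0 else 1 :: real)" for s
  have gh: "g \<in> borel_measurable borel" "h \<in> borel_measurable borel"
    unfolding g_def h_def using S by measurable
  have "x + E S x = 2 *\<^sub>R E S x + 1 *\<^sub>R E (- S) x" using split
    by (metis (no_types, lifting) add.assoc add.commute scaleR_2 scaleR_one)
  then have p: "\<mu> (x + E S x) = density (\<mu> x) (\<lambda>s. ennreal (g s))"
    by (simp only:) (rule \<mu>_eq_density[OF gh(1) _ S], auto simp: g_def)
  have "x - E S x = 0 *\<^sub>R E S x + 1 *\<^sub>R E (- S) x" using split by (metis add_diff_cancel_left' scaleR_one scaleR_zero_left add_0)
  then have m: "\<mu> (x - E S x) = density (\<mu> x) (\<lambda>s. ennreal (h s))"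
    by (simp only:) (rule \<mu>_eq_density[OF gh(2) _ S], auto simp: h_def)
  have bounded: "integrable (\<mu> x) (\<lambda>s. k s * s)"
    if k: "k \<in> borel_measurable borel" "\<And>s. \<bar>k s\<bar> \<le> 4" for k
  proof (rule Bochner_Integration.integrable_bound)
    show "integrable (\<mu> x) (\<lambda>s. 4 * s)" using integrable_id[OF x] by simp
    show "(\<lambda>s. k s * s) \<in> borel_measurable (\<mu> x)" using k(1) by simp
    show "AE s in \<mu> x. norm (k s * s) \<le> norm (4 * s)"
      by (rule AE_I2) (simp add: abs_mult mult_right_mono k(2))
  qed
  have int: "integrable (\<mu> x) (\<lambda>s. g s * s)" "integrable (\<mu> x) (\<lambda>s. h s * s)"
    by (rule bounded[OF gh(1)], simp add: g_def) (rule bounded[OF gh(2)], simp add: h_def)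
  have "(\<integral>s. s \<partial>density (\<mu> x) (\<lambda>s. ennreal (k s))) = (\<integral>s. k s * s \<partial>\<mu> x)"
    if "k \<in> borel_measurable borel" "\<And>s. 0 \<le> k s" for k
    using integral_density[of "\<lambda>s. s" "\<mu> x" k] that by simp
  from this[OF gh(1)] this[OF gh(2)]
  have "spectral_integral E (\<lambda>s. s) x (E S x) = ((\<integral>s. g s * s \<partial>\<mu> x) - (\<integral>s. h s * s \<partial>\<mu> x)) / 4"
    unfolding spectral_integral_def p m by (simp add: g_def h_def)
  also have "\<dots> = (\<integral>s. g s * s - h s * s \<partial>\<mu> x) / 4" using int by simp
  also have "(\<lambda>s. g s * s - h s * s) = (\<lambda>s. 4 * (indicator S s * s))"
    by (auto simp: g_def h_def indicator_def)
  finally show "spectral_integral E (\<lambda>s. s) x (E S x) = (\<integral>s. indicator S s * s \<partial>\<mu> x)" by simp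
qed

text \<open>By \<open>eq\<close> the function s - z has integral zero over \<open>S\<close>, and by
  \<open>side\<close> it has a constant nonzero sign there, so \<open>S\<close> is a null
  set.\<close>

lemma integral_shift_zero_null:
  assumes x: "x \<in> calculus_domain E (\<lambda>s. s)" and S: "S \<in> sets borel"
    and eq: "(\<integral>s. indicator S s * s \<partial>\<mu> x) = z * measure (\<mu> x) S"
    and side: "(\<forall>s\<in>S. s > z) \<or> (\<forall>s\<in>S. s < z)"
  shows "E S x = 0"
proof -
  interpret finite_measure "\<mu> x" by (rule finite_measure_\<mu>)
  have int1: "integrable (\<mu> x) (\<lambda>s. indicator S s * s)"
    using S by (intro Bochner_Integration.integrable_bound[OF integrable_id[OF x]])
      (auto simp: indicator_def)
  have int2: "integrable (\<mu> x) (\<lambda>s. indicator S s * z)"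
    using S by (intro integrable_mult_left integrable_real_indicator) (auto simp: emeasure_\<mu>)
  have "(\<integral>s. indicator S s * s - indicator S s * z \<partial>\<mu> x) = 0"
    using int1 int2 S by (subst Bochner_Integration.integral_diff) (auto simp: eq mult.commute[of z])
  moreover have int: "integrable (\<mu> x) (\<lambda>s. indicator S s * s - indicator S s * z)"
    using int1 int2 by simp
  moreover have abs: "\<bar>indicator S s * s - indicator S s * z\<bar>
      = (if \<forall>s\<in>S. s > z then 1 else -1) * (indicator S s * s - indicator S s * z)" for s
    using side by (cases "s \<in> S") (auto simp: abs_if)
  ultimately have "(\<integral>s. \<bar>indicator S s * s - indicator S s * z\<bar> \<partial>\<mu> x) = 0"
    unfolding abs by simp
  then have "AE s in \<mu> x. \<bar>indicator S s * s - indicator S s * z\<bar> = 0"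
    by (subst (asm) integral_nonneg_eq_0_iff_AE) (use int in auto)
  then have "AE s in \<mu> x. s \<notin> S"
    by eventually_elim (use side in \<open>auto simp: indicator_def\<close>)
  then have "emeasure (\<mu> x) S = 0" using S AE_iff_measurable[of S "\<mu> x" "\<lambda>s. s \<notin> S"] by simp
  then show ?thesis using S by (intro null_\<mu>)
qed

end

section \<open>The spectral resolution\<close>

context discrete_selfadjoint
begin

text \<open>The form that every resolution of \<open>A\<close> will turn out to have:
  \<open>E S\<close> is the sum of the eigenprojections with eigenvalue in \<open>S\<close>. Stating
  it through the projections avoids an infinite sum.\<close>

definition diagonal :: "(real set \<Rightarrow> 'a \<Rightarrow> 'a) \<Rightarrow> bool" where
  "diagonal E \<longleftrightarrow> projection_valued_measure E \<and>
     (\<forall>S\<in>sets borel. \<forall>z x. P z (E S x) = indicator S z *\<^sub>R P z x)"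

text \<open>Multiplier domains contain all eigenvectors. This makes the vector described in
  \<open>calculus\<close> unique.\<close>

lemma total_mult_dom:
  assumes "\<And>w. w \<in> mult_dom \<phi> \<Longrightarrow> x \<bullet> w = 0" shows "x = 0"
  by (rule total, rule assms, erule mult_eigen(1))

context
  fixes E assumes E: "diagonal E"
begin

interpretation pvm E using E by unfold_locales (simp add: diagonal_def)

lemma P_E: "S \<in> sets borel \<Longrightarrow> P z (E S x) = indicator S z *\<^sub>R P z x"
  using E by (simp add: diagonal_def)

lemma E_singleton: "E {z} x = P z x"
  by (rule P_ext) (auto simp: P_E P_P indicator_def)

text \<open>All projections of \<open>E (- L) x\<close> vanish, where \<open>L\<close> is the
  countable set of eigenvalues. Spectral integrals thereby become sums.\<close>

lemma AE_eigenvalue: "AE s in \<mu> x. eigenvalue D A s"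
proof -
  define L where "L = (\<Union>n. Lam n)"
  have L: "L \<in> sets borel" unfolding L_def using finite_Lam
    by (intro sets.countable_UN) (auto intro: finite_imp_closed borel_closed)
  then have L': "- L \<in> sets borel" by (rule borel_comp)
  have "z \<in> L" if "eigenvalue D A z" for z
    using eventually_in_Lam[OF that] by (auto simp: eventually_sequentially L_def)
  then have zero: "P z (E (- L) x) = 0" for z
    using P_not_eigenvalue[of z x] by (auto simp: P_E[OF L'] indicator_def)
  have "E (- L) x = 0" by (rule P_ext) (simp add: P_0 zero)
  then have "emeasure (\<mu> x) (- L) = 0" using L' by (subst emeasure_\<mu>) auto
  then have "AE s in \<mu> x. s \<in> L"
    using L' AE_iff_measurable[of "- L" "\<mu> x" "\<lambda>s. s \<in> L"] by auto
  then show ?thesis by eventually_elim (auto simp: L_def Lam_def)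
qed

text \<open>Monotone convergence along the finite sets \<open>Lam n\<close>, whose points have mass
  |P z x|^2. The \<open>max 0\<close> reflects that \<open>ennreal\<close> sends negative numbers to
  0.\<close>

lemma nn_integral_diagonal:
  assumes \<phi>: "\<phi> \<in> borel_measurable borel"
  shows "(\<integral>\<^sup>+s. ennreal (\<phi> s) \<partial>\<mu> x) = (SUP n. ennreal (\<Sum>z\<in>Lam n. max 0 (\<phi> z) * (norm (P z x))\<^sup>2))"
proof -
  have "(\<integral>\<^sup>+s. ennreal (\<phi> s) \<partial>\<mu> x) = (\<integral>\<^sup>+s. (SUP n. ennreal (\<phi> s) * indicator (Lam n) s) \<partial>\<mu> x)"
  proof (rule nn_integral_cong_AE)
    show "AE s in \<mu> x. ennreal (\<phi> s) = (SUP n. ennreal (\<phi> s) * indicator (Lam n) s)"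
      using AE_eigenvalue
    proof eventually_elim
      fix s assume "eigenvalue D A s"
      then obtain n where n: "s \<in> Lam n"
        using eventually_in_Lam[of s] by (auto simp: eventually_sequentially)
      show "ennreal (\<phi> s) = (SUP n. ennreal (\<phi> s) * indicator (Lam n) s)"
      proof (rule antisym)
        have "ennreal (\<phi> s) = ennreal (\<phi> s) * indicator (Lam n) s" using n by simp
        also have "\<dots> \<le> (SUP n. ennreal (\<phi> s) * indicator (Lam n) s)" by (rule SUP_upper) simp
        finally show "ennreal (\<phi> s) \<le> (SUP n. ennreal (\<phi> s) * indicator (Lam n) s)" .
        show "(SUP n. ennreal (\<phi> s) * indicator (Lam n) s) \<le> ennreal (\<phi> s)"
          by (rule SUP_least) (simp add: indicator_def)
      qed
    qed
  qed
  also have "\<dots> = (SUP n. \<integral>\<^sup>+s. ennreal (\<phi> s) * indicator (Lam n) s \<partial>\<mu> x)"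
  proof (rule nn_integral_monotone_convergence_SUP)
    show "incseq (\<lambda>n s. ennreal (\<phi> s) * indicator (Lam n) s)"
      using Lam_mono by (auto intro!: incseq_SucI le_funI simp: indicator_def) (meson le_SucI le_refl subsetD)
    have "Lam n \<in> sets borel" for n using finite_Lam[of n] by (auto intro: finite_imp_closed borel_closed)
    then show "(\<lambda>s. ennreal (\<phi> s) * indicator (Lam n) s) \<in> borel_measurable (\<mu> x)" for n
      using \<phi> by simp
  qed
  also have "\<dots> = (SUP n. ennreal (\<Sum>z\<in>Lam n. max 0 (\<phi> z) * (norm (P z x))\<^sup>2))"
  proof (rule SUP_cong[OF refl])
    fix n
    have "(\<integral>\<^sup>+s. ennreal (\<phi> s) * indicator (Lam n) s \<partial>\<mu> x) = (\<Sum>z\<in>Lam n. ennreal (\<phi> z) * emeasure (\<mu> x) {z})"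
      by (rule nn_integral_indicator_finite) (auto simp: finite_Lam)
    also have "\<dots> = (\<Sum>z\<in>Lam n. ennreal (max 0 (\<phi> z) * (norm (P z x))\<^sup>2))"
      by (rule sum.cong) (auto simp: emeasure_\<mu> E_singleton ennreal_mult' max_def ennreal_neg)
    also have "\<dots> = ennreal (\<Sum>z\<in>Lam n. max 0 (\<phi> z) * (norm (P z x))\<^sup>2)"
      by (rule sum_ennreal) simp
    finally show "(\<integral>\<^sup>+s. ennreal (\<phi> s) * indicator (Lam n) s \<partial>\<mu> x) = \<dots>" .
  qed
  finally show ?thesis .
qed

lemma calculus_domain_diagonal:
  assumes \<phi>: "\<phi> \<in> borel_measurable borel"
  shows "calculus_domain E \<phi> = mult_dom \<phi>"
proof -
  have eq: "(\<integral>\<^sup>+s. ennreal ((\<phi> s)\<^sup>2) \<partial>\<mu> x) = (SUP n. ennreal (\<Sum>z\<in>Lam n. (\<phi> z)\<^sup>2 * (norm (P z x))\<^sup>2))" for x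
    using nn_integral_diagonal[of "\<lambda>s. (\<phi> s)\<^sup>2" x] \<phi> by simp
  have "x \<in> mult_dom \<phi>" if x: "x \<in> calculus_domain E \<phi>" for x
  proof (rule mult_dom_boundedI)
    fix n
    define c where "c = (SUP n. ennreal (\<Sum>z\<in>Lam n. (\<phi> z)\<^sup>2 * (norm (P z x))\<^sup>2))"
    have c: "c < \<infinity>" using x by (simp add: calculus_domain_def eq c_def)
    have "ennreal (\<Sum>z\<in>Lam n. (\<phi> z)\<^sup>2 * (norm (P z x))\<^sup>2) \<le> c" unfolding c_def by (rule SUP_upper) simp
    then show "(\<Sum>z\<in>Lam n. (\<phi> z)\<^sup>2 * (norm (P z x))\<^sup>2) \<le> enn2real c"
      using c by (simp add: enn2real_nonneg flip: ennreal_le_iff)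
  qed
  moreover have "x \<in> calculus_domain E \<phi>" if x: "x \<in> mult_dom \<phi>" for x
  proof -
    have "(SUP n. ennreal (\<Sum>z\<in>Lam n. (\<phi> z)\<^sup>2 * (norm (P z x))\<^sup>2)) \<le> ennreal ((norm (mult \<phi> x))\<^sup>2)"
      by (intro SUP_least ennreal_leI mult_bounded[OF x finite_Lam])
    then show ?thesis
      unfolding calculus_domain_def mem_Collect_eq eq by (rule order_le_less_trans) simp
  qed
  ultimately show ?thesis by blast
qed

lemma integral_diagonal:
  assumes \<phi>: "\<phi> \<in> borel_measurable borel" "\<And>z. 0 \<le> z \<Longrightarrow> 0 \<le> \<phi> z" and x: "x \<in> mult_dom \<phi>"
  shows "(\<integral>s. \<phi> s \<partial>\<mu> x) = mult \<phi> x \<bullet> x"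
proof -
  define s where "s n = (\<Sum>z\<in>Lam n. \<phi> z * (norm (P z x))\<^sup>2)" for n
  have \<phi>_nonneg: "0 \<le> \<phi> z" if "z \<in> Lam n" for z n using \<phi>(2) Lam_nonneg that by blast
  have "s \<longlonglongrightarrow> mult \<phi> x \<bullet> x"
    using parseval[of "mult \<phi> x" x] by (simp add: s_def[abs_def] P_mult x power2_norm_eq_inner)
  then have "(\<lambda>n. ennreal (s n)) \<longlonglongrightarrow> ennreal (mult \<phi> x \<bullet> x)" by (rule tendsto_ennrealI)
  moreover have "(\<integral>\<^sup>+s. ennreal (\<phi> s) \<partial>\<mu> x) = (SUP n. ennreal (s n))"
    unfolding nn_integral_diagonal[OF \<phi>(1)] s_def
    by (intro SUP_cong refl arg_cong[of _ _ ennreal] sum.cong) (simp add: \<phi>_nonneg)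
  moreover have "incseq s" unfolding s_def
    by (intro monoI sum_mono2 finite_Lam Lam_mono) (auto intro!: mult_nonneg_nonneg \<phi>_nonneg)
  then have "(\<lambda>n. ennreal (s n)) \<longlonglongrightarrow> (SUP n. ennreal (s n))"
    by (intro LIMSEQ_SUP) (auto simp: mono_def ennreal_leI)
  ultimately have "(\<integral>\<^sup>+s. ennreal (\<phi> s) \<partial>\<mu> x) = ennreal (mult \<phi> x \<bullet> x)" using LIMSEQ_unique by metis
  moreover have "0 \<le> mult \<phi> x \<bullet> x"
    by (rule LIMSEQ_le_const[OF \<open>s \<longlonglongrightarrow> mult \<phi> x \<bullet> x\<close>]) (auto simp: s_def intro!: exI[of _ 0] sum_nonneg mult_nonneg_nonneg \<phi>_nonneg)
  moreover have "AE s in \<mu> x. 0 \<le> \<phi> s"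
    using AE_eigenvalue by eventually_elim (simp add: \<phi>(2) eigenvalue_nonneg)
  ultimately show ?thesis using \<phi>(1) by (subst integral_eq_nn_integral) auto
qed

text \<open>Polarization reduces the spectral integral to the quadratic forms of
  \<open>integral_diagonal\<close>, and symmetry of the multiplier identifies the result. The sign
  condition on the half line fits both the identity and \<open>sqrt\<close>.\<close>

lemma calculus_diagonal:
  assumes \<phi>: "\<phi> \<in> borel_measurable borel" "\<And>z. 0 \<le> z \<Longrightarrow> 0 \<le> \<phi> z" and x: "x \<in> mult_dom \<phi>"
  shows "calculus E \<phi> x = mult \<phi> x"
proof -
  have si: "spectral_integral E \<phi> x w = mult \<phi> x \<bullet> w" if w: "w \<in> mult_dom \<phi>" for w
  proof -
    have "(\<lambda>n. \<Sum>z\<in>Lam n. P z (mult \<phi> x) \<bullet> P z w) \<longlonglongrightarrow> mult \<phi> x \<bullet> w"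
      "(\<lambda>n. \<Sum>z\<in>Lam n. P z x \<bullet> P z (mult \<phi> w)) \<longlonglongrightarrow> x \<bullet> mult \<phi> w"
      by (rule parseval)+
    then have "mult \<phi> x \<bullet> w = x \<bullet> mult \<phi> w"
      unfolding P_mult[OF x] P_mult[OF w] inner_scaleR_left inner_scaleR_right by (rule LIMSEQ_unique)
    then show ?thesis
      unfolding spectral_integral_def
      by (simp add: integral_diagonal \<phi> x w mult_add mult_diff inner_simps inner_commute)
  qed
  show ?thesis unfolding calculus_def
  proof (rule the_equality)
    show "\<forall>z\<in>calculus_domain E \<phi>. mult \<phi> x \<bullet> z = spectral_integral E \<phi> x z"
      by (simp add: calculus_domain_diagonal \<phi> si)
    fix y assume y: "\<forall>z\<in>calculus_domain E \<phi>. y \<bullet> z = spectral_integral E \<phi> x z"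
    have "(y - mult \<phi> x) \<bullet> w = 0" if "w \<in> mult_dom \<phi>" for w
      using y that by (simp add: calculus_domain_diagonal \<phi> si inner_diff_left)
    then have "y - mult \<phi> x = 0" by (rule total_mult_dom)
    then show "y = mult \<phi> x" by simp
  qed
qed

end

lemma indicator_mult_dom: "x \<in> mult_dom (indicator S)"
proof (rule mult_dom_boundedI)
  fix n
  have "(\<Sum>z\<in>Lam n. (indicator S z)\<^sup>2 * (norm (P z x))\<^sup>2) \<le> (\<Sum>z\<in>Lam n. (norm (P z x))\<^sup>2)"
    by (rule sum_mono) (auto simp: indicator_def)
  also have "\<dots> \<le> (norm x)\<^sup>2" by (rule bessel[OF finite_Lam])
  finally show "(\<Sum>z\<in>Lam n. (indicator S z)\<^sup>2 * (norm (P z x))\<^sup>2) \<le> (norm x)\<^sup>2" .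
qed

lemmas P_indicator = P_mult[OF indicator_mult_dom]

lemma norm_indicator_le: "norm (mult (indicator S) x) \<le> norm x"
proof -
  have "(norm (mult (indicator S) x))\<^sup>2 \<le> (norm x)\<^sup>2"
  proof (rule norm_le_if_partial)
    fix n
    have "(\<Sum>z\<in>Lam n. (norm (P z (mult (indicator S) x)))\<^sup>2) \<le> (\<Sum>z\<in>Lam n. (norm (P z x))\<^sup>2)"
      by (rule sum_mono) (auto simp: P_indicator indicator_def)
    also have "\<dots> \<le> (norm x)\<^sup>2" by (rule bessel[OF finite_Lam])
    finally show "(\<Sum>z\<in>Lam n. (norm (P z (mult (indicator S) x)))\<^sup>2) \<le> (norm x)\<^sup>2" .
  qed
  then show ?thesis by (rule power2_le_imp_le) simp
qed

text \<open>Only finitely many eigenvalues lie in \<open>Lam m\<close>, and each of them that lies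
  in the union is caught by some \<open>S n\<close>. From an index \<open>N\<close> on, the
  remainder acts on \<open>x - Q m x\<close> alone, and this is small because indicator multipliers
  are contractions.\<close>

lemma indicator_sums:
  fixes S :: "nat \<Rightarrow> real set"
  assumes S: "disjoint_family S"
  shows "(\<lambda>n. mult (indicator (S n)) x) sums mult (indicator (\<Union>n. S n)) x"
proof -
  let ?T = "\<lambda>N. \<Union>n<N. S n" and ?U = "\<Union>n. S n"
  have part: "(\<Sum>n<N. mult (indicator (S n)) x) = mult (indicator (?T N)) x" for N
  proof (rule P_ext)
    fix z
    have "(indicator (?T N) z :: real) = (\<Sum>n<N. indicator (S n) z)"
      by (rule indicator_UN_disjoint) (use S in \<open>auto simp: disjoint_family_on_def\<close>)
    then show "P z (\<Sum>n<N. mult (indicator (S n)) x) = P z (mult (indicator (?T N)) x)"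
      by (simp add: P_sum P_indicator scaleR_left.sum)
  qed
  have "(\<lambda>N. mult (indicator (?T N)) x) \<longlonglongrightarrow> mult (indicator ?U) x"
  proof (rule LIMSEQ_I)
    fix e :: real assume "e > 0"
    have "(\<lambda>m. x - Q m x) \<longlonglongrightarrow> x - x" by (intro tendsto_intros Q_tendsto)
    then obtain m where m: "norm (x - Q m x) < e" using LIMSEQ_D[of _ 0 e] \<open>e > 0\<close> by fastforce
    have "\<forall>z\<in>Lam m \<inter> ?U. \<exists>n. z \<in> S n" by auto
    then obtain k where k: "\<And>z. z \<in> Lam m \<inter> ?U \<Longrightarrow> z \<in> S (k z)" by metis
    define N where "N = Suc (Max (insert 0 (k ` (Lam m \<inter> ?U))))"
    have kN: "k z < N" if "z \<in> Lam m \<inter> ?U" for z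
      unfolding N_def less_Suc_eq_le by (rule Max_ge) (use that finite_Lam in auto)
    have "norm (mult (indicator (?T n)) x - mult (indicator ?U) x) < e" if n: "N \<le> n" for n
    proof -
      let ?R = "?U - ?T n"
      have R: "?R \<inter> Lam m = {}" using kN k n by fastforce
      have "mult (indicator ?U) x - mult (indicator (?T n)) x = mult (indicator ?R) (x - Q m x)"
      proof (rule P_ext)
        fix z
        have "P z (x - Q m x) = P z x" if "z \<in> ?R"
        proof -
          have "z \<notin> Lam m" using that R by auto
          then have "P z (Q m x) = 0"
            unfolding Q_def P_sum by (intro sum.neutral) (auto simp: P_P)
          then show ?thesis by (simp add: P_diff)
        qed
        then show "P z (mult (indicator ?U) x - mult (indicator (?T n)) x) = P z (mult (indicator ?R) (x - Q m x))"
          by (auto simp: P_diff P_indicator indicator_def)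
      qed
      then show ?thesis
        using norm_indicator_le[of ?R "x - Q m x"] m by (subst norm_minus_commute) simp
    qed
    then show "\<exists>N. \<forall>n\<ge>N. norm (mult (indicator (?T n)) x - mult (indicator ?U) x) < e" by blast
  qed
  then show ?thesis by (simp add: sums_def part)
qed

lemma diagonal_mult: "diagonal (\<lambda>S. mult (indicator S))"
proof -
  have "bounded_linear (mult (indicator S))" for S
    by (rule bounded_linear_intro[where K=1])
      (auto simp: mult_add mult_scale indicator_mult_dom norm_indicator_le)
  moreover have "mult (indicator S) (mult (indicator S) x) = mult (indicator S) x" for S x
    by (rule P_ext) (auto simp: P_indicator indicator_def)
  moreover have "mult (indicator S) x \<bullet> y = x \<bullet> mult (indicator S) y" for S x y
  proof -
    have "(\<lambda>n. \<Sum>z\<in>Lam n. P z (mult (indicator S) x) \<bullet> P z y) \<longlonglongrightarrow> mult (indicator S) x \<bullet> y"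
      "(\<lambda>n. \<Sum>z\<in>Lam n. P z x \<bullet> P z (mult (indicator S) y)) \<longlonglongrightarrow> x \<bullet> mult (indicator S) y"
      by (rule parseval)+
    then show ?thesis
      unfolding P_indicator inner_scaleR_left inner_scaleR_right by (rule LIMSEQ_unique)
  qed
  moreover have "mult (indicator UNIV) x = x" for x
    by (rule P_ext) (unfold P_indicator, simp)
  ultimately show ?thesis
    unfolding diagonal_def projection_valued_measure_def by (auto simp: indicator_sums P_indicator)
qed

text \<open>\<open>spectral_resolution\<close> is a choice among resolving families; this family
  shows that there is one to choose.\<close>

lemma resolves_mult: "resolves (\<lambda>S. mult (indicator S)) D A"
  unfolding resolves_def
proof (intro conjI ballI)
  show "projection_valued_measure (\<lambda>S. mult (indicator S))" using diagonal_mult by (simp add: diagonal_def)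
  show "D = calculus_domain (\<lambda>S. mult (indicator S)) (\<lambda>s. s)"
    by (rule trans[OF D_eq_mult_dom calculus_domain_diagonal[OF diagonal_mult, symmetric]]) simp
  show "A x = calculus (\<lambda>S. mult (indicator S)) (\<lambda>s. s) x" if "x \<in> D" for x
    by (rule trans[OF A_eq_mult[OF that] calculus_diagonal[OF diagonal_mult, symmetric]])
      (use that in \<open>simp_all flip: D_eq_mult_dom\<close>)
qed

text \<open>A priori the description in \<open>calculus\<close> might be empty at \<open>x\<close>. Then it evaluates to the same
  junk vector at \<open>x\<close> and at \<open>2 x\<close> (if it is empty there too), which is impossible when \<open>A x \<noteq> 0\<close>.\<close>
lemma resolves_inner_E:
  assumes E: "resolves E D A" and x: "x \<in> D" "A x \<noteq> 0"
  obtains c where "c \<noteq> 0" "\<And>S. S \<in> sets borel \<Longrightarrow>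
    A (c *\<^sub>R x) \<bullet> E S (c *\<^sub>R x) = (\<integral>s. indicator S s * s \<partial>scalar_spectral_measure E (c *\<^sub>R x))"
proof -
  interpret pvm E using E by unfold_locales (simp add: resolves_def)
  have D: "calculus_domain E (\<lambda>s. s) = D" and A: "\<And>x. x \<in> D \<Longrightarrow> A x = calculus E (\<lambda>s. s) x"
    using E by (simp_all add: resolves_def)
  define good where "good x y \<longleftrightarrow> (\<forall>w\<in>D. y \<bullet> w = spectral_integral E (\<lambda>s. s) x w)" for x y
  have A_good: "A x = (THE y. good x y)" if "x \<in> D" for x
    using A[OF that] by (simp add: calculus_def good_def D)
  have "\<exists>c. c \<noteq> 0 \<and> (\<exists>y. good (c *\<^sub>R x) y)"
  proof (rule ccontr)
    assume "\<not> ?thesis"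
    then have "good (c *\<^sub>R x) = (\<lambda>y. False)" if "c \<noteq> 0" for c using that by auto
    then have "A (1 *\<^sub>R x) = A (2 *\<^sub>R x)"
      using x D_scale by (simp add: A_good del: scaleR_one)
    then have "A x = 2 *\<^sub>R A x" using A_scale[OF x(1), of 2] by simp
    then show False using x(2) by (simp add: scaleR_2)
  qed
  then obtain c y where c: "c \<noteq> 0" and y: "good (c *\<^sub>R x) y" by blast
  have "y' = y" if "good (c *\<^sub>R x) y'" for y'
  proof -
    have "w \<bullet> (y' - y) = 0" if "w \<in> D" for w
      using \<open>good (c *\<^sub>R x) y'\<close> y that by (simp add: good_def inner_diff_right inner_commute)
    then have "y' - y = 0" by (rule orth_D_eq_0)
    then show ?thesis by simp
  qed
  then have "A (c *\<^sub>R x) = y" 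
    using y by (subst A_good[OF D_scale[OF x(1)]]) (rule the_equality)
  then have g: "good (c *\<^sub>R x) (A (c *\<^sub>R x))" using y by simp
  have "A (c *\<^sub>R x) \<bullet> E S (c *\<^sub>R x) = (\<integral>s. indicator S s * s \<partial>\<mu> (c *\<^sub>R x))" if S: "S \<in> sets borel" for S
  proof -
    have "c *\<^sub>R x \<in> calculus_domain E (\<lambda>s. s)" unfolding D by (rule D_scale[OF x(1)])
    from spectral_integral_E[OF this S] show ?thesis using g by (simp add: good_def D)
  qed
  then show ?thesis using c that by blast
qed

text \<open>For an eigenvector with eigenvalue z \<noteq> 0, \<open>resolves_inner_E\<close> says
  that s and z have the same integral over every Borel set against the spectral measure of some
  nonzero multiple of it, so all mass sits at z. Testing against eigenvectors then determines the
  projections of every \<open>E S x\<close>.\<close>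

lemma resolves_diagonal:
  assumes E: "resolves E D A" and lam: "eigenvalue D A lam" "lam > 0"
  shows "diagonal E"
proof -
  interpret pvm E using E by unfold_locales (simp add: resolves_def)
  have D: "calculus_domain E (\<lambda>s. s) = D" using E by (simp add: resolves_def)
  have E_split: "x = E {..<z} x + E {z} x + E {z<..} x" for x and z :: real
  proof -
    have "E ({..<z} \<union> {z} \<union> {z<..}) x = E {..<z} x + E {z} x + E {z<..} x"
      by (subst E_Un, simp, simp, force, subst E_Un, auto)
    moreover have "{..<z} \<union> {z} \<union> {z<..} = (UNIV :: real set)" by auto
    ultimately show ?thesis by (simp add: E_UNIV)
  qed
  have pos: "E {z} v = v" if v: "v \<in> eigenspace z" and z: "z \<noteq> 0" for v z
  proof (cases "v = 0")
    case True
    then show ?thesis using bounded_linear_E[of "{z}"] by (simp add: linear_simps)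
  next
    case False
    then have "v \<in> D" "A v \<noteq> 0" using v z by (auto simp: eigenspace_def)
    then obtain c where c: "c \<noteq> 0" "\<And>S. S \<in> sets borel \<Longrightarrow>
      A (c *\<^sub>R v) \<bullet> E S (c *\<^sub>R v) = (\<integral>s. indicator S s * s \<partial>\<mu> (c *\<^sub>R v))"
      using resolves_inner_E[OF E] by blast
    let ?x = "c *\<^sub>R v"
    have xE: "?x \<in> eigenspace z" using v by (rule subspace_scale[OF subspace_eigenspace])
    then have xD: "?x \<in> calculus_domain E (\<lambda>s. s)" unfolding D by (simp add: eigenspace_def)
    have eq: "(\<integral>s. indicator S s * s \<partial>\<mu> ?x) = z * measure (\<mu> ?x) S" if S: "S \<in> sets borel" for S
    proof -
      have "A ?x = z *\<^sub>R ?x" using xE by (simp add: eigenspace_def)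
      then have "A ?x \<bullet> E S ?x = z * (norm (E S ?x))\<^sup>2"
        by (simp only: inner_scaleR_left[of z ?x] inner_commute[of ?x] E_inner_self[OF S])
      then show ?thesis using c(2)[OF S] S by (simp add: measure_\<mu>)
    qed
    have "E {..<z} ?x = 0" by (rule integral_shift_zero_null[OF xD _ eq]) auto
    moreover have "E {z<..} ?x = 0" by (rule integral_shift_zero_null[OF xD _ eq]) auto
    ultimately have "E {z} ?x = ?x" using E_split[of ?x z] by simp
    then show ?thesis using c(1) bounded_linear_E[of "{z}"] by (simp add: linear_simps)
  qed
  \<comment> \<open>For z = 0 the image \<open>A v\<close> vanishes and
    \<open>resolves_inner_E\<close> does not apply to \<open>v\<close>. Adding an eigenvector
    \<open>e\<close> of the positive eigenvalue \<open>lam\<close> repairs this; by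
    \<open>pos\<close> the contribution of \<open>e\<close> sits at \<open>lam\<close>.\<close>
  have zero: "E {0} v = v" if v: "v \<in> eigenspace 0" for v
  proof -
    obtain e where e: "e \<in> eigenspace lam" "e \<noteq> 0"
      using lam by (auto simp: eigenvalue_def eigenvector_iff)
    have vD: "v \<in> D" "A v = 0" and eD: "e \<in> D" "A e = lam *\<^sub>R e"
      using v e by (auto simp: eigenspace_def)
    have ve: "v + e \<in> D" "A (v + e) \<noteq> 0" using vD eD lam e by (auto simp: D_add A_add)
    from resolves_inner_E[OF E ve] obtain c where c: "c \<noteq> 0" "\<And>S. S \<in> sets borel \<Longrightarrow>
      A (c *\<^sub>R (v + e)) \<bullet> E S (c *\<^sub>R (v + e)) = (\<integral>s. indicator S s * s \<partial>\<mu> (c *\<^sub>R (v + e)))"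
      by blast
    define x where "x = c *\<^sub>R (v + e)"
    have xD: "x \<in> calculus_domain E (\<lambda>s. s)" unfolding D x_def by (rule D_scale[OF ve(1)])
    have Ax: "A x = (c * lam) *\<^sub>R e"
      unfolding x_def using A_scale[OF ve(1)] vD eD by (simp add: A_add)
    have Ex: "E S x = c *\<^sub>R E S v + c *\<^sub>R E S e" if "S \<in> sets borel" for S
      using bounded_linear_E[OF that] by (simp add: x_def linear_simps scaleR_add_right)
    have Ee: "E {lam} e = e" using pos e lam by simp
    have E_off: "E S e = 0" if "S \<in> sets borel" "lam \<notin> S" for S
      using E_disjoint[of S "{lam}" e] that by (simp add: Ee)
    have eq: "(\<integral>s. indicator S s * s \<partial>\<mu> x) = 0 * measure (\<mu> x) S" if S: "S \<in> sets borel" "lam \<notin> S" for S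
    proof -
      have "e \<bullet> E S v = 0" using E_off[OF S] E_sym[OF S(1), of e v] by simp
      then show ?thesis using c(2)[OF S(1)] E_off[OF S] by (simp add: Ax Ex S flip: x_def)
    qed
    have "E {..<0} x = 0" by (rule integral_shift_zero_null[OF xD _ eq]) (use lam in auto)
    then have 1: "E {..<0} v = 0" using c(1) E_off[of "{..<0}"] lam by (simp add: Ex)
    let ?T = "{0<..} - {lam}"
    have "E ?T x = 0" by (rule integral_shift_zero_null[OF xD _ eq]) (use lam in auto)
    then have 2: "E ?T v = 0" using c(1) E_off[of ?T] by (simp add: Ex)
    \<comment> \<open>At \<open>lam\<close> the masses of \<open>v\<close> and \<open>e\<close>
      could mix. Computing \<open>A x \<bullet> E {lam} x\<close> through \<open>A\<close> sees only
      \<open>e\<close>, computing it through the spectral integral also counts \<open>v\<close>;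
      equality removes \<open>v\<close>.\<close>
    have 3: "E {lam} v = 0"
    proof -
      let ?y = "E {lam} v"
      have ev: "v \<bullet> e = 0" by (rule eigenspace_orthogonal[OF v e(1)]) (use lam in simp)
      have ey: "e \<bullet> ?y = 0" using E_sym[of "{lam}" e v] Ee ev by (simp add: inner_commute)
      have "(\<lambda>s. indicator {lam} s * s) = (\<lambda>s. lam * indicator {lam} s)" by (auto simp: indicator_def)
      then have "(\<integral>s. indicator {lam} s * s \<partial>\<mu> x) = lam * (norm (E {lam} x))\<^sup>2"
        by (simp add: measure_\<mu>)
      moreover have "(norm (E {lam} x))\<^sup>2 = c\<^sup>2 * ((norm ?y)\<^sup>2 + (norm e)\<^sup>2)"
        using ey by (simp add: Ex Ee power2_norm_eq_inner inner_simps inner_commute power2_eq_square[of c] algebra_simps)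
      moreover have "A x \<bullet> E {lam} x = lam * (c\<^sup>2 * (norm e)\<^sup>2)"
        using ey by (simp add: Ax Ex Ee inner_simps power2_norm_eq_inner power2_eq_square[of c] algebra_simps)
      ultimately have "lam * (c\<^sup>2 * (norm e)\<^sup>2) = lam * (c\<^sup>2 * ((norm ?y)\<^sup>2 + (norm e)\<^sup>2))"
        using c(2)[of "{lam}"] by (simp flip: x_def)
      then show ?thesis using lam c(1) by simp
    qed
    have "E {0<..} v = E ?T v + E {lam} v"
      using E_Un[of ?T "{lam}" v] lam by (simp add: insert_absorb)
    then show ?thesis using E_split[of v 0] 1 2 3 by simp
  qed
  have single: "E {z} v = v" if "v \<in> eigenspace z" for v z
    using pos zero that by (cases "z = 0") auto
  have "P z (E S x) = indicator S z *\<^sub>R P z x" if S: "S \<in> sets borel" for S z x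
  proof -
    \<comment> \<open>\<open>d\<close> is tested against itself: it lies in the eigenspace of
      \<open>z\<close>, where \<open>single\<close> makes \<open>E S\<close> act as the
      indicator.\<close>
    define d where "d = P z (E S x) - indicator S z *\<^sub>R P z x"
    have d_in: "d \<in> eigenspace z" unfolding d_def
      by (intro subspace_diff[OF subspace_eigenspace] subspace_scale[OF subspace_eigenspace] P_in)
    have "E S d = indicator S z *\<^sub>R d"
      using E_Int[OF S, of "{z}" d] by (simp add: single d_in E_empty indicator_def Int_insert_right)
    moreover have "P z (E S x) \<bullet> d = x \<bullet> E S d"
      by (simp add: P_orth d_in E_sym S)
    moreover have "P z x \<bullet> d = x \<bullet> d" by (simp add: P_orth d_in)
    ultimately have "d \<bullet> d = 0" by (subst (1) d_def) (simp add: inner_diff_left)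
    then show ?thesis by (simp add: d_def)
  qed
  then show ?thesis using pvm by (simp add: diagonal_def)
qed

lemma half_domain_power:
  assumes lam: "eigenvalue D A lam" "lam > 0"
  shows "half_domain D A = mult_dom sqrt"
    and "x \<in> mult_dom sqrt \<Longrightarrow> half_power D A x = mult sqrt x"
proof -
  have "resolves (spectral_resolution D A) D A"
    unfolding spectral_resolution_def by (rule someI[of _ "\<lambda>S. mult (indicator S)"]) (rule resolves_mult)
  then have d: "diagonal (spectral_resolution D A)" by (rule resolves_diagonal[OF _ lam])
  have m: "sqrt \<in> borel_measurable borel" by simp
  show "half_domain D A = mult_dom sqrt"
    unfolding half_domain_def by (rule calculus_domain_diagonal[OF d m])
  show "x \<in> mult_dom sqrt \<Longrightarrow> half_power D A x = mult sqrt x"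
    unfolding half_power_def by (rule calculus_diagonal[OF d m]) simp_all
qed

end

section \<open>Operators whose spectrum is a finite set or an increasing sequence of eigenvalues\<close>

lemma (in selfadjoint) eigenvalue_in_spectrum: "eigenvalue D A z \<Longrightarrow> z \<in> operator_spectrum D A"
proof -
  assume "eigenvalue D A z"
  then obtain v where v: "v \<in> D" "v \<noteq> 0" "A v - z *\<^sub>R v = 0" by (auto simp: eigenvalue_def eigenvector_def)
  have "z \<notin> resolvent_set D A"
  proof
    assume "z \<in> resolvent_set D A"
    then have "inj_on (\<lambda>u. A u - z *\<^sub>R u) D" by (auto simp: resolvent_set_def bij_betw_def)
    from inj_onD[OF this, of v 0] show False using v D_0 A_0 by simp
  qed
  then show ?thesis by (simp add: operator_spectrum_def)
qed

text \<open>Totality is drawn from isolation of the spectral points, which in both alternatives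
  follows once finitely many of them lie below each bound.\<close>

lemma discrete_selfadjointI:
  assumes sa: "selfadjoint_operator D A" and nonneg: "nonnegative_operator D A"
    and spectrum: "finite (operator_spectrum D A) \<or>
      (\<exists>z :: nat \<Rightarrow> real. strict_mono z \<and> range z = operator_spectrum D A \<and>
         (\<forall>n. eigenvalue D A (z n)))"
  shows "discrete_selfadjoint D A"
proof -
  interpret selfadjoint D A using sa by unfold_locales
  have fin: "finite {s \<in> operator_spectrum D A. s \<le> M}" for M
    using spectrum
  proof
    assume "\<exists>z :: nat \<Rightarrow> real. strict_mono z \<and> range z = operator_spectrum D A \<and> (\<forall>n. eigenvalue D A (z n))"
    then obtain z where z: "strict_mono z" "range z = operator_spectrum D A" "\<And>n::nat. eigenvalue D A (z n)" by blast
    \<comment> \<open>A bounded increasing sequence would have a limit \<open>L\<close> outside its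
      range, hence in the resolvent set. There A - L is bounded below, which eigenvectors with
      eigenvalues tending to \<open>L\<close> contradict.\<close>
    have "\<exists>N. M < z N"
    proof (rule ccontr)
      assume "\<not> ?thesis"
      then have "\<And>n. z n \<le> M" by (simp add: not_less)
      then obtain L where L: "z \<longlonglongrightarrow> L" "\<And>n. z n \<le> L"
        using incseq_convergent[of z M] z(1) strict_mono_mono by blast
      have "L \<notin> range z"
      proof
        assume "L \<in> range z"
        then obtain n where "L = z n" by blast
        then show False using L(2)[of "Suc n"] strict_monoD[OF z(1), of n "Suc n"] by simp
      qed
      then have "L \<in> resolvent_set D A" using z(2) by (simp add: operator_spectrum_def)
      then obtain d where d: "d > 0" "\<And>u. u \<in> D \<Longrightarrow> d * norm u \<le> norm (A u - L *\<^sub>R u)"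
        using resolvent_bounded_below by blast
      have "d \<le> \<bar>z n - L\<bar>" for n
      proof -
        obtain v where "v \<in> D" "v \<noteq> 0" "A v = z n *\<^sub>R v"
          using z(3)[of n] by (auto simp: eigenvalue_def eigenvector_def)
        then show ?thesis using d(2)[of v] by (simp flip: scaleR_diff_left)
      qed
      moreover obtain n where "\<bar>z n - L\<bar> < d" using LIMSEQ_D[OF L(1) d(1)] by auto
      ultimately show False by (metis not_less)
    qed
    then obtain N where N: "M < z N" by blast
    have "n < N" if "z n \<le> M" for n
      using strict_mono_less[OF z(1), of n N] that N by simp
    then have "{s \<in> operator_spectrum D A. s \<le> M} \<subseteq> z ` {..<N}" using z(2) by (auto simp flip: z(2))
    then show ?thesis by (rule finite_subset) simp
  qed (rule finite_subset, auto)
  show ?thesis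
  proof (unfold_locales)
    show "nonnegative_operator D A" by (rule nonneg)
    show "finite {z. eigenvalue D A z \<and> z \<le> M}" for M
      by (rule finite_subset[OF _ fin[of M]]) (auto simp: eigenvalue_in_spectrum)
  next
    fix x assume x: "\<And>z e. e \<in> eigenspace z \<Longrightarrow> x \<bullet> e = 0"
    show "x = 0"
    proof (rule eigenvectors_total)
      fix \<mu>
      \<comment> \<open>Spectral points above \<mu> + 1 are farther than 1 from \<mu>, which is why
        the radius below is cut at 1.\<close>
      let ?F = "{s \<in> operator_spectrum D A. s \<le> \<mu> + 1} - {\<mu>}"
      obtain d where d: "d > 0" "\<And>s. s \<in> ?F \<Longrightarrow> d \<le> dist \<mu> s"
        using finite_set_avoid[of ?F \<mu>] fin by auto
      have "c \<in> resolvent_set D A" if "0 < \<bar>c - \<mu>\<bar>" "\<bar>c - \<mu>\<bar> < min d 1" for c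
      proof (rule ccontr)
        assume "c \<notin> resolvent_set D A"
        then have "c \<in> ?F" using that by (auto simp: operator_spectrum_def)
        from d(2)[OF this] show False using that by (simp add: dist_real_def)
      qed
      then show "\<exists>\<epsilon>>0. \<forall>c. 0 < \<bar>c - \<mu>\<bar> \<longrightarrow> \<bar>c - \<mu>\<bar> < \<epsilon> \<longrightarrow> c \<in> resolvent_set D A"
        using d(1) by (intro exI[of _ "min d 1"]) auto
    qed (use x in auto)
  qed
qed

section \<open>Vector-valued integration\<close>

text \<open>Holds by completeness of Lebesgue measure; strong measurability supplies limits only
  almost everywhere.\<close>

lemma borel_measurable_lebesgue_on_AE:
  fixes f g :: "real \<Rightarrow> real"
  assumes S: "S \<in> sets lebesgue" and f: "f \<in> borel_measurable (lebesgue_on S)"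
    and ae: "AE x in lebesgue_on S. f x = g x"
  shows "g \<in> borel_measurable (lebesgue_on S)"
proof -
  have "(\<lambda>x. indicator S x *\<^sub>R f x) \<in> borel_measurable lebesgue"
    using f S by (subst (asm) borel_measurable_restrict_space_iff) auto
  moreover have "AE x in lebesgue. indicator S x *\<^sub>R f x = indicator S x *\<^sub>R g x"
    using ae S by (subst (asm) AE_restrict_space_iff) (auto simp: indicator_def elim!: eventually_mono)
  ultimately have "(\<lambda>x. indicator S x *\<^sub>R g x) \<in> borel_measurable lebesgue" by (rule borel_measurable_AE)
  then show ?thesis using S by (subst borel_measurable_restrict_space_iff) auto
qed

lemma strongly_measurable_compose_measurable:
  fixes g :: "real \<Rightarrow> 'b::real_normed_vector" and h :: "'b \<Rightarrow> real"
  assumes S: "S \<in> sets lebesgue" and g: "strongly_measurable (lebesgue_on S) g"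
    and h: "\<And>x. isCont h x"
  shows "(\<lambda>t. h (g t)) \<in> borel_measurable (lebesgue_on S)"
proof -
  obtain s where s: "\<And>n::nat. simple_function (lebesgue_on S) (s n)"
    "AE t in lebesgue_on S. (\<lambda>n. s n t) \<longlonglongrightarrow> g t"
    using g by (auto simp: strongly_measurable_def)
  have "(\<lambda>t. h (s n t)) \<in> borel_measurable (lebesgue_on S)" for n
    by (rule borel_measurable_simple_function) (rule simple_function_compose1[OF s(1)])
  then have "(\<lambda>t. lim (\<lambda>n. h (s n t))) \<in> borel_measurable (lebesgue_on S)" by (rule borel_measurable_lim_metric)
  moreover have "AE t in lebesgue_on S. lim (\<lambda>n. h (s n t)) = h (g t)"
    using s(2) by eventually_elim (rule limI, rule isCont_tendsto_compose[OF h])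
  ultimately show ?thesis by (rule borel_measurable_lebesgue_on_AE[OF S])
qed

lemma strongly_measurable_diff_simple:
  assumes "strongly_measurable M g" "simple_function M s"
  shows "strongly_measurable M (\<lambda>t. g t - s t)"
proof -
  obtain r where r: "\<And>n::nat. simple_function M (r n)" "AE t in M. (\<lambda>n. r n t) \<longlonglongrightarrow> g t"
    using assms(1) by (auto simp: strongly_measurable_def)
  have "simple_function M (\<lambda>t. r n t - s t)" for n by (rule simple_function_compose2[OF r(1) assms(2)])
  moreover have "AE t in M. (\<lambda>n. r n t - s t) \<longlonglongrightarrow> g t - s t"
    using r(2) by (rule eventually_mono) (rule tendsto_diff[OF _ tendsto_const])
  ultimately show ?thesis unfolding strongly_measurable_def
    by (intro exI[of _ "\<lambda>n t. r n t - s t"] conjI allI)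
qed

text \<open>Pairing with \<open>e\<close> maps the approximating simple functions of the vector
  integral to scalar ones, with the error multiplied by at most the norm of \<open>e\<close>.
  Identities between vector integrals are later proved through this reduction.\<close>

lemma has_bochner_inner:
  fixes g :: "real \<Rightarrow> 'b::real_inner"
  assumes S: "S \<in> sets lebesgue" and g: "has_bochner (lebesgue_on S) g I"
  shows "has_bochner_integral (lebesgue_on S) (\<lambda>t. g t \<bullet> e) (I \<bullet> e)"
proof -
  let ?M = "lebesgue_on S"
  obtain s where s: "\<And>n::nat. Bochner_Integration.simple_bochner_integrable ?M (s n)"
    "(\<lambda>n. \<integral>\<^sup>+ t. ennreal (norm (g t - s n t)) \<partial>?M) \<longlonglongrightarrow> 0"
    "(\<lambda>n. Bochner_Integration.simple_bochner_integral ?M (s n)) \<longlonglongrightarrow> I"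
    and sm: "strongly_measurable ?M g"
    using g by (auto simp: has_bochner_def)
  show ?thesis
  proof (rule has_bochner_integral.intros)
    show "(\<lambda>t. g t \<bullet> e) \<in> borel_measurable ?M"
      by (rule strongly_measurable_compose_measurable[OF S sm]) (intro continuous_intros)
    show sb: "Bochner_Integration.simple_bochner_integrable ?M (\<lambda>t. s n t \<bullet> e)" for n
      by (rule simple_bochner_integrable_compose2[where p="\<lambda>x y. x \<bullet> e" and f="s n" and g="s n"])
        (simp_all add: s(1))
    have meas: "(\<lambda>t. ennreal (norm (g t - s n t))) \<in> borel_measurable ?M" for n
      using s(1)[of n] by (intro measurable_compose[OF _ measurable_ennreal]
        strongly_measurable_compose_measurable[OF S strongly_measurable_diff_simple[OF sm]] continuous_intros)
        (auto elim: simple_bochner_integrable.cases)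
    have "(\<lambda>n. (\<integral>\<^sup>+ t. ennreal (norm (g t - s n t)) \<partial>?M) * ennreal (norm e)) \<longlonglongrightarrow> 0 * ennreal (norm e)"
      by (intro tendsto_mult_ennreal tendsto_const s(2)) auto
    then have lim: "(\<lambda>n. (\<integral>\<^sup>+ t. ennreal (norm (g t - s n t)) \<partial>?M) * ennreal (norm e)) \<longlonglongrightarrow> 0" by simp
    show "(\<lambda>n. \<integral>\<^sup>+ t. ennreal (norm (g t \<bullet> e - s n t \<bullet> e)) \<partial>?M) \<longlonglongrightarrow> 0"
    proof (rule tendsto_sandwich[OF _ _ tendsto_const lim])
      have "(\<integral>\<^sup>+ t. ennreal (norm (g t \<bullet> e - s n t \<bullet> e)) \<partial>?M)
          \<le> (\<integral>\<^sup>+ t. ennreal (norm (g t - s n t)) * ennreal (norm e) \<partial>?M)" for n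
        by (rule nn_integral_mono)
          (simp add: inner_diff_left[symmetric] Cauchy_Schwarz_ineq2 flip: ennreal_mult)
      then show "\<forall>\<^sub>F n in sequentially. (\<integral>\<^sup>+ t. ennreal (norm (g t \<bullet> e - s n t \<bullet> e)) \<partial>?M)
          \<le> (\<integral>\<^sup>+ t. ennreal (norm (g t - s n t)) \<partial>?M) * ennreal (norm e)"
        using meas by (simp add: nn_integral_multc)
    qed simp
    have "(\<lambda>n. Bochner_Integration.simple_bochner_integral ?M (s n) \<bullet> e) \<longlonglongrightarrow> I \<bullet> e"
      by (intro tendsto_intros s(3))
    then show "(\<lambda>n. Bochner_Integration.simple_bochner_integral ?M (\<lambda>t. s n t \<bullet> e)) \<longlonglongrightarrow> I \<bullet> e"
      using simple_bochner_integral_linear[of "\<lambda>x. x \<bullet> e" ?M, OF _ s(1)]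
      by (simp add: bounded_linear.linear bounded_linear_inner_left)
  qed
qed

lemma emeasure_lebesgue_on_interval: "0 \<le> T \<Longrightarrow> emeasure (lebesgue_on {0<..<T}) {0<..<T} = ennreal T"
  by (subst emeasure_restrict_space) auto

lemma lebesgue_on_interval_set: "{0<..<T} \<in> sets lebesgue" for T :: real
  by simp

lemma simple_function_floor:
  "simple_function (lebesgue_on {0<..<T}) (\<lambda>t. \<lfloor>c * t\<rfloor>)" for T c :: real
  unfolding simple_function_def
proof (intro conjI ballI)
  have "\<bar>c * t\<bar> \<le> \<bar>c\<bar> * \<bar>T\<bar>" if "t \<in> {0<..<T}" for t
    unfolding abs_mult using that by (intro mult_left_mono) auto
  then have "(\<lambda>t. \<lfloor>c * t\<rfloor>) ` space (lebesgue_on {0<..<T}) \<subseteq> {\<lfloor>- (\<bar>c\<bar> * \<bar>T\<bar>)\<rfloor>..\<lfloor>\<bar>c\<bar> * \<bar>T\<bar>\<rfloor>}"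
    by (force simp: abs_le_iff intro!: floor_mono)
  then show "finite ((\<lambda>t. \<lfloor>c * t\<rfloor>) ` space (lebesgue_on {0<..<T}))" by (rule finite_subset) simp
  fix x
  have "(\<lambda>t. \<lfloor>c * t\<rfloor>) \<in> lebesgue_on {0<..<T} \<rightarrow>\<^sub>M count_space UNIV"
    by (rule measurable_compose[OF _ measurable_real_floor])
      (intro continuous_imp_measurable_on_sets_lebesgue continuous_intros, simp)
  then show "(\<lambda>t. \<lfloor>c * t\<rfloor>) -` {x} \<inter> space (lebesgue_on {0<..<T}) \<in> sets (lebesgue_on {0<..<T})"
    by (rule measurable_sets) simp
qed

text \<open>\<open>g\<close> is sampled at the grid point of mesh 1/c at or to the left of
  \<open>t\<close>, which stays in [0, T]; uniform continuity on the closed interval bounds the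
  error. The interval is bounded, so the floor takes finitely many values.\<close>

lemma continuous_step_approximation:
  fixes g :: "real \<Rightarrow> 'b::real_normed_vector"
  assumes g: "continuous_on {0..T} g" and T: "T > 0" and e: "e > 0"
  obtains s where "Bochner_Integration.simple_bochner_integrable (lebesgue_on {0<..<T}) s"
    "\<And>t. t \<in> {0<..<T} \<Longrightarrow> norm (g t - s t) < e"
proof -
  have "uniformly_continuous_on {0..T} g" using g by (intro compact_uniformly_continuous) auto
  then obtain d where d: "d > 0" "\<And>t t'. t \<in> {0..T} \<Longrightarrow> t' \<in> {0..T} \<Longrightarrow> dist t' t < d \<Longrightarrow> dist (g t') (g t) < e"
    using e unfolding uniformly_continuous_on_def by metis
  obtain c where c: "c > 0" "1 / c < d"
  proof
    show "0 < 2 / d" "1 / (2 / d) < d" using d(1) by auto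
  qed
  define s where "s t = g (real_of_int \<lfloor>c * t\<rfloor> / c)" for t
  show ?thesis
  proof
    have "simple_function (lebesgue_on {0<..<T}) s"
      unfolding s_def by (rule simple_function_compose1[OF simple_function_floor])
    moreover have "emeasure (lebesgue_on {0<..<T}) {y \<in> space (lebesgue_on {0<..<T}). s y \<noteq> 0} \<le> ennreal T"
      using emeasure_lebesgue_on_interval[of T] T emeasure_space[of "lebesgue_on {0<..<T}"] by simp
    ultimately show "Bochner_Integration.simple_bochner_integrable (lebesgue_on {0<..<T}) s"
      by (intro simple_bochner_integrable.intros) (auto simp: top_unique)
    fix t assume t: "t \<in> {0<..<T}"
    let ?t = "real_of_int \<lfloor>c * t\<rfloor> / c"
    have "?t \<le> t" "t < ?t + 1 / c" "0 \<le> ?t"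
      using c(1) t of_int_floor_le[of "c * t"] real_of_int_floor_add_one_gt[of "c * t"]
      by (auto simp: field_simps)
    then have "dist (g t) (g ?t) < e" using t c d(2)[of ?t t] by (auto simp: dist_real_def)
    then show "norm (g t - s t) < e" by (simp add: s_def dist_norm)
  qed
qed

section \<open>Integrals of almost everywhere limits of continuous functions\<close>

context
  fixes g :: "real \<Rightarrow> 'b::real_normed_vector" and h :: "nat \<Rightarrow> real \<Rightarrow> 'b" and T :: real
  assumes h: "\<And>n. continuous_on {0..T} (h n)" and T: "T > 0"
    and lim: "AE t in lebesgue_on {0<..<T}. (\<lambda>n. h n t) \<longlonglongrightarrow> g t"
begin

lemma step_sequence:
  obtains s where "\<And>n. Bochner_Integration.simple_bochner_integrable (lebesgue_on {0<..<T}) (s n)"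
    "\<And>n t. t \<in> {0<..<T} \<Longrightarrow> norm (h n t - s n t) < 1 / real (Suc n)"
    "AE t in lebesgue_on {0<..<T}. (\<lambda>n. s n t) \<longlonglongrightarrow> g t"
proof -
  have "\<exists>s. Bochner_Integration.simple_bochner_integrable (lebesgue_on {0<..<T}) s \<and>
      (\<forall>t\<in>{0<..<T}. norm (h n t - s t) < 1 / real (Suc n))" for n
    by (rule continuous_step_approximation[OF h[of n] T, of "1 / real (Suc n)"]) auto
  then obtain s where s: "\<And>n. Bochner_Integration.simple_bochner_integrable (lebesgue_on {0<..<T}) (s n)"
    "\<And>n t. t \<in> {0<..<T} \<Longrightarrow> norm (h n t - s n t) < 1 / real (Suc n)" by metis
  have "AE t in lebesgue_on {0<..<T}. t \<in> {0<..<T}" by (rule AE_I2) simp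
  with lim have "AE t in lebesgue_on {0<..<T}. (\<lambda>n. s n t) \<longlonglongrightarrow> g t"
  proof eventually_elim
    fix t assume t: "(\<lambda>n. h n t) \<longlonglongrightarrow> g t" "t \<in> {0<..<T}"
    have "(\<lambda>n. h n t - s n t) \<longlonglongrightarrow> 0"
    proof (rule Lim_null_comparison)
      show "\<forall>\<^sub>F n in sequentially. norm (h n t - s n t) \<le> 1 / real (Suc n)"
        using s(2)[OF t(2)] by (intro always_eventually) (simp add: less_imp_le)
      show "(\<lambda>n. 1 / real (Suc n)) \<longlonglongrightarrow> 0" by (rule LIMSEQ_Suc[OF lim_1_over_n])
    qed
    from tendsto_diff[OF t(1) this] show "(\<lambda>n. s n t) \<longlonglongrightarrow> g t" by simp
  qed
  with s that show ?thesis by blast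
qed

lemma strongly_measurable_limit: "strongly_measurable (lebesgue_on {0<..<T}) g"
proof -
  obtain s where "\<And>n. Bochner_Integration.simple_bochner_integrable (lebesgue_on {0<..<T}) (s n)"
    "AE t in lebesgue_on {0<..<T}. (\<lambda>n. s n t) \<longlonglongrightarrow> g t" using step_sequence by metis
  then show ?thesis unfolding strongly_measurable_def by (meson simple_bochner_integrable.cases)
qed

end

text \<open>Step functions within 1/(n + 1) of \<open>h n\<close> approximate \<open>g\<close> in
  the mean because the interval has finite length, and their integrals are then Cauchy. It serves
  for functions involving \<open>A (G (x t))\<close>, which are only limits of continuous
  truncations.\<close>

lemma has_bochner_limit:
  fixes g :: "real \<Rightarrow> 'b::{real_normed_vector,complete_space}"
  assumes h: "\<And>n. continuous_on {0..T} (h n)" and T: "T > 0"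
    and lim: "AE t in lebesgue_on {0<..<T}. (\<lambda>n. h n t) \<longlonglongrightarrow> g t"
    and L1: "(\<lambda>n. \<integral>\<^sup>+ t. ennreal (norm (g t - h n t)) \<partial>lebesgue_on {0<..<T}) \<longlonglongrightarrow> 0"
  shows "\<exists>I. has_bochner (lebesgue_on {0<..<T}) g I"
proof -
  let ?M = "lebesgue_on {0<..<T}"
  obtain s where s: "\<And>n. Bochner_Integration.simple_bochner_integrable ?M (s n)"
    "\<And>n t. t \<in> {0<..<T} \<Longrightarrow> norm (h n t - s n t) < 1 / real (Suc n)"
    "AE t in ?M. (\<lambda>n. s n t) \<longlonglongrightarrow> g t"
    using step_sequence[OF h T lim] by blast
  have sf: "simple_function ?M (s n)" for n using s(1)[of n] by (rule simple_bochner_integrable.cases)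
  have sm: "strongly_measurable ?M g" by (rule strongly_measurable_limit[OF h T lim])
  have meas: "(\<lambda>t. ennreal (norm (g t - s n t))) \<in> borel_measurable ?M" for n
    by (intro measurable_compose[OF _ measurable_ennreal]
      strongly_measurable_compose_measurable[OF lebesgue_on_interval_set strongly_measurable_diff_simple[OF sm sf]]
      continuous_intros)
  have conv: "(\<lambda>n. \<integral>\<^sup>+ t. ennreal (norm (g t - s n t)) \<partial>?M) \<longlonglongrightarrow> 0"
  proof (rule tendsto_sandwich[OF _ _ tendsto_const])
    have smh: "strongly_measurable ?M (\<lambda>t. g t - h n t)" for n
    proof (rule strongly_measurable_limit[of T "\<lambda>m t. h m t - h n t"])
      show "AE t in ?M. (\<lambda>m. h m t - h n t) \<longlonglongrightarrow> g t - h n t"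
        using lim by (rule eventually_mono) (rule tendsto_diff[OF _ tendsto_const])
    qed (intro continuous_intros h, rule T)
    have "(\<integral>\<^sup>+ t. ennreal (norm (g t - s n t)) \<partial>?M)
        \<le> (\<integral>\<^sup>+ t. ennreal (norm (g t - h n t)) + ennreal (1 / real (Suc n)) \<partial>?M)" for n
    proof (rule nn_integral_mono)
      fix t assume "t \<in> space ?M"
      then have t: "t \<in> {0<..<T}" by simp
      have "norm (g t - s n t) \<le> norm (g t - h n t) + norm (h n t - s n t)"
        using norm_triangle_ineq[of "g t - h n t" "h n t - s n t"] by simp
      then have "norm (g t - s n t) \<le> norm (g t - h n t) + 1 / real (Suc n)"
        using s(2)[OF t, of n] by linarith
      then have "ennreal (norm (g t - s n t)) \<le> ennreal (norm (g t - h n t) + 1 / real (Suc n))"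
        by (rule ennreal_leI)
      also have "\<dots> = ennreal (norm (g t - h n t)) + ennreal (1 / real (Suc n))"
        by (rule ennreal_plus) auto
      finally show "ennreal (norm (g t - s n t)) \<le> \<dots>" .
    qed
    also have "(\<integral>\<^sup>+ t. ennreal (norm (g t - h n t)) + ennreal (1 / real (Suc n)) \<partial>?M)
        = (\<integral>\<^sup>+ t. ennreal (norm (g t - h n t)) \<partial>?M) + ennreal (1 / real (Suc n) * T)" for n
    proof (subst nn_integral_add)
      show "(\<lambda>t. ennreal (norm (g t - h n t))) \<in> borel_measurable ?M"
        by (intro measurable_compose[OF _ measurable_ennreal]
          strongly_measurable_compose_measurable[OF lebesgue_on_interval_set smh] continuous_intros)
      have "(\<integral>\<^sup>+ t. ennreal (1 / real (Suc n)) \<partial>?M) = ennreal (1 / real (Suc n)) * ennreal T"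
        using T emeasure_lebesgue_on_interval[of T] by (simp add: nn_integral_const)
      also have "\<dots> = ennreal (1 / real (Suc n) * T)" by (rule ennreal_mult[symmetric]) (use T in auto)
      finally show "(\<integral>\<^sup>+ t. ennreal (norm (g t - h n t)) \<partial>?M) + (\<integral>\<^sup>+ t. ennreal (1 / real (Suc n)) \<partial>?M)
          = (\<integral>\<^sup>+ t. ennreal (norm (g t - h n t)) \<partial>?M) + ennreal (1 / real (Suc n) * T)" by simp
    qed simp
    finally show "\<forall>\<^sub>F n in sequentially. (\<integral>\<^sup>+ t. ennreal (norm (g t - s n t)) \<partial>?M)
        \<le> (\<integral>\<^sup>+ t. ennreal (norm (g t - h n t)) \<partial>?M) + ennreal (1 / real (Suc n) * T)" by simp
    have "(\<lambda>n. 1 / real (Suc n) * T) \<longlonglongrightarrow> 0 * T"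
      by (rule tendsto_mult_right[OF LIMSEQ_Suc[OF lim_1_over_n]])
    then have "(\<lambda>n. ennreal (1 / real (Suc n) * T)) \<longlonglongrightarrow> ennreal 0" by (intro tendsto_ennrealI) simp
    from tendsto_add[OF L1 this]
    show "(\<lambda>n. (\<integral>\<^sup>+ t. ennreal (norm (g t - h n t)) \<partial>?M) + ennreal (1 / real (Suc n) * T)) \<longlonglongrightarrow> 0" by simp
  qed simp
  define J where "J n = Bochner_Integration.simple_bochner_integral ?M (s n)" for n
  have J: "ennreal (norm (J m - J n)) \<le> (\<integral>\<^sup>+ t. ennreal (norm (g t - s m t)) \<partial>?M)
      + (\<integral>\<^sup>+ t. ennreal (norm (g t - s n t)) \<partial>?M)" for m n
  proof -
    have sb: "Bochner_Integration.simple_bochner_integrable ?M (\<lambda>t. s m t - s n t)"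
      by (rule simple_bochner_integrable_compose2[where p="\<lambda>x y. x - y" and f="s m" and g="s n"])
        (simp_all add: s(1))
    have sbn: "Bochner_Integration.simple_bochner_integrable ?M (\<lambda>t. norm (s m t - s n t))"
      by (rule simple_bochner_integrable_compose2[where p="\<lambda>x y. norm (x - y)" and f="s m" and g="s n"])
        (simp_all add: s(1))
    have "norm (J m - J n) \<le> Bochner_Integration.simple_bochner_integral ?M (\<lambda>t. norm (s m t - s n t))"
      unfolding J_def simple_bochner_integral_diff[OF s(1) s(1), symmetric]
      by (rule simple_bochner_integral_norm_bound[OF sb])
    then have "ennreal (norm (J m - J n)) \<le> (\<integral>\<^sup>+ t. ennreal (norm (s m t - s n t)) \<partial>?M)"
      using simple_bochner_integral_eq_nn_integral[OF sbn] by (simp add: ennreal_leI flip: simple_bochner_integral_eq_nn_integral[OF sbn])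
    also have "\<dots> \<le> (\<integral>\<^sup>+ t. ennreal (norm (g t - s m t)) + ennreal (norm (g t - s n t)) \<partial>?M)"
    proof (rule nn_integral_mono)
      fix t
      have "norm (s m t - s n t) \<le> norm (g t - s m t) + norm (g t - s n t)"
        using norm_triangle_ineq4[of "g t - s n t" "g t - s m t"] by (simp add: algebra_simps)
      then have "ennreal (norm (s m t - s n t)) \<le> ennreal (norm (g t - s m t) + norm (g t - s n t))"
        by (rule ennreal_leI)
      also have "\<dots> = ennreal (norm (g t - s m t)) + ennreal (norm (g t - s n t))"
        by (rule ennreal_plus) auto
      finally show "ennreal (norm (s m t - s n t)) \<le> \<dots>" .
    qed
    also have "\<dots> = (\<integral>\<^sup>+ t. ennreal (norm (g t - s m t)) \<partial>?M) + (\<integral>\<^sup>+ t. ennreal (norm (g t - s n t)) \<partial>?M)"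
      by (rule nn_integral_add[OF meas meas])
    finally show ?thesis .
  qed
  have "Cauchy J"
  proof (rule CauchyI)
    fix e :: real assume e: "e > 0"
    have "\<forall>\<^sub>F n in sequentially. (\<integral>\<^sup>+ t. ennreal (norm (g t - s n t)) \<partial>?M) < ennreal (e / 2)"
      by (rule order_tendstoD(2)[OF conv]) (use e in simp)
    then obtain N where N: "\<And>n. N \<le> n \<Longrightarrow> (\<integral>\<^sup>+ t. ennreal (norm (g t - s n t)) \<partial>?M) < ennreal (e / 2)"
      by (auto simp: eventually_sequentially)
    have "norm (J m - J n) < e" if "N \<le> m" "N \<le> n" for m n
    proof -
      have "ennreal (norm (J m - J n)) < ennreal (e / 2) + ennreal (e / 2)"
        using J[of m n] add_strict_mono[OF N[OF that(1)] N[OF that(2)]] by (rule order_le_less_trans)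
      also have "\<dots> = ennreal e" using e by (subst ennreal_plus[symmetric]) auto
      finally show ?thesis using e by (simp add: ennreal_less_iff)
    qed
    then show "\<exists>M. \<forall>m\<ge>M. \<forall>n\<ge>M. norm (J m - J n) < e" by blast
  qed
  then obtain I where "J \<longlonglongrightarrow> I" using Cauchy_convergent_iff convergent_def by blast
  then have "has_bochner ?M g I"
    unfolding has_bochner_def using sm s(1) conv J_def[abs_def] by blast
  then show ?thesis ..
qed

lemma has_bochner_continuous:
  fixes g :: "real \<Rightarrow> 'b::{real_normed_vector,complete_space}"
  assumes "continuous_on {0..T} g" "T > 0"
  shows "\<exists>I. has_bochner (lebesgue_on {0<..<T}) g I"
  by (rule has_bochner_limit[of T "\<lambda>n. g"]) (use assms in auto)

lemma integral_lebesgue_on_interval: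
  fixes f :: "real \<Rightarrow> real"
  assumes f: "continuous_on {0..T} f"
  shows "has_bochner_integral (lebesgue_on {0<..<T}) f (integral {0..T} f)"
proof -
  have "f absolutely_integrable_on {0..T}" using f by (rule absolutely_integrable_continuous_real)
  then have "f absolutely_integrable_on {0<..<T}"
    by (rule set_integrable_subset) auto
  then have i: "integrable (lebesgue_on {0<..<T}) f" by (rule absolutely_integrable_imp_integrable) simp
  have "integral\<^sup>L (lebesgue_on {0<..<T}) f = integral {0<..<T} f"
    by (rule lebesgue_integral_eq_integral[OF i]) simp
  also have "\<dots> = integral {0..T} f"
    using integral_open_interval[of 0 T f] by (simp add: box_real)
  finally show ?thesis using i by (simp add: has_bochner_integral_iff)
qed

lemma nn_integral_lebesgue_on_interval:
  fixes f :: "real \<Rightarrow> real"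
  assumes f: "continuous_on {0..T} f" "\<And>t. t \<in> {0..T} \<Longrightarrow> 0 \<le> f t"
  shows "(\<integral>\<^sup>+ t. ennreal (f t) \<partial>lebesgue_on {0<..<T}) = ennreal (integral {0..T} f)"
proof -
  have "integrable (lebesgue_on {0<..<T}) f" "integral\<^sup>L (lebesgue_on {0<..<T}) f = integral {0..T} f"
    using integral_lebesgue_on_interval[OF f(1)] by (auto simp: has_bochner_integral_iff)
  moreover have "AE t in lebesgue_on {0<..<T}. 0 \<le> f t" by (rule AE_I2) (use f(2) in auto)
  ultimately show ?thesis using nn_integral_eq_integral by metis
qed

text \<open>The vector integral over (0, T) serves as antiderivative, known only through its inner
  products. The remainder of the difference quotient is bounded in norm by testing it against
  itself, which leaves a scalar mean value inequality.\<close>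

lemma antiderivative_exists:
  fixes h :: "real \<Rightarrow> 'b::{real_inner,complete_space}"
  assumes h: "continuous_on {0..} h"
  obtains G where "G 0 = 0" "\<And>t. t \<ge> 0 \<Longrightarrow> (G has_vector_derivative h t) (at t within {0..})"
proof -
  have cont: "continuous_on {0..T} h" for T using h by (rule continuous_on_subset) auto
  define G where "G T = (if T > 0 then SOME I. has_bochner (lebesgue_on {0<..<T}) h I else 0)" for T
  have G: "G T \<bullet> e = integral {0..T} (\<lambda>s. h s \<bullet> e)" if T: "T \<ge> 0" for T e
  proof (cases "T > 0")
    case True
    have "has_bochner (lebesgue_on {0<..<T}) h (G T)"
      using someI_ex[OF has_bochner_continuous[OF cont True]] True by (simp add: G_def)
    from has_bochner_inner[OF _ this, of e]
    have "has_bochner_integral (lebesgue_on {0<..<T}) (\<lambda>s. h s \<bullet> e) (G T \<bullet> e)" by simp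
    moreover have "has_bochner_integral (lebesgue_on {0<..<T}) (\<lambda>s. h s \<bullet> e) (integral {0..T} (\<lambda>s. h s \<bullet> e))"
      by (intro integral_lebesgue_on_interval continuous_intros cont)
    ultimately show ?thesis by (rule has_bochner_integral_eq)
  qed (use T in \<open>simp add: G_def\<close>)
  have "(G has_vector_derivative h t) (at t within {0..})" if t: "t \<ge> 0" for t
    unfolding has_vector_derivative_def has_derivative_within_alt
  proof (intro conjI allI impI bounded_linear_scaleR_left)
    fix e :: real assume e: "e > 0"
    have "continuous (at t within {0..}) h" using h t by (simp add: continuous_on_eq_continuous_within)
    then obtain d where d: "d > 0" "\<And>s. s \<ge> 0 \<Longrightarrow> dist s t < d \<Longrightarrow> dist (h s) (h t) < e"
      using e by (auto simp: continuous_within_eps_delta)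
    have "norm (G y - G t - (y - t) *\<^sub>R h t) \<le> e * norm (y - t)" if y: "y \<in> {0..}" "norm (y - t) < d" for y
    proof -
      \<comment> \<open>The remainder is frozen as a fixed vector: the scalar function s |-> G s . v
        - s (h t . v) then has increment |v|^2 between \<open>t\<close> and
        \<open>y\<close>.\<close>
      define v where "v = G y - G t - (y - t) *\<^sub>R h t"
      define S where "S = {0..max y t} \<inter> {min y t..}"
      have "norm ((G y \<bullet> v - y * (h t \<bullet> v)) - (G t \<bullet> v - t * (h t \<bullet> v))) \<le> (e * norm v) * norm (y - t)"
      proof (rule field_differentiable_bound[where S=S and f'="\<lambda>s. h s \<bullet> v - h t \<bullet> v"])
        show "convex S" unfolding S_def by (intro convex_Int convex_real_interval)
        show "y \<in> S" "t \<in> S" using y t by (auto simp: S_def)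
        fix s assume s: "s \<in> S"
        then have s0: "s \<in> {0..max y t}" by (simp add: S_def)
        have "((\<lambda>s. integral {0..s} (\<lambda>s. h s \<bullet> v)) has_real_derivative h s \<bullet> v) (at s within {0..max y t})"
          by (rule integral_has_real_derivative[OF _ s0]) (intro continuous_intros cont)
        then have "((\<lambda>s. G s \<bullet> v) has_real_derivative h s \<bullet> v) (at s within {0..max y t})"
          by (rule has_field_derivative_transform_within[of _ _ _ _ 1]) (use s0 G in auto)
        then have "((\<lambda>s. G s \<bullet> v - s * (h t \<bullet> v)) has_real_derivative h s \<bullet> v - 1 * (h t \<bullet> v)) (at s within {0..max y t})"
          by (rule DERIV_diff) (auto intro!: derivative_eq_intros)
        then have "((\<lambda>s. G s \<bullet> v - s * (h t \<bullet> v)) has_real_derivative h s \<bullet> v - h t \<bullet> v) (at s within {0..max y t})"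
          by simp
        then show "((\<lambda>s. G s \<bullet> v - s * (h t \<bullet> v)) has_real_derivative h s \<bullet> v - h t \<bullet> v) (at s within S)"
          by (rule DERIV_subset) (auto simp: S_def)
        have "\<bar>s - t\<bar> < d" "s \<ge> 0"
          using s y t by (auto simp: S_def max_def min_def abs_if split: if_splits)
        then have "norm (h s - h t) \<le> e" using d(2)[of s] by (simp add: dist_norm)
        then show "norm (h s \<bullet> v - h t \<bullet> v) \<le> e * norm v"
          by (simp add: inner_diff_left[symmetric])
            (rule order_trans[OF Cauchy_Schwarz_ineq2 mult_right_mono], simp_all)
      qed
      also have "(G y \<bullet> v - y * (h t \<bullet> v)) - (G t \<bullet> v - t * (h t \<bullet> v)) = v \<bullet> v"
        by (subst (5) v_def) (simp add: inner_simps algebra_simps)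
      finally have "norm v * norm v \<le> (e * norm (y - t)) * norm v"
        by (simp add: dot_square_norm power2_eq_square mult.commute mult.left_commute)
      then have "norm v \<le> e * norm (y - t)" using e by (cases "v = 0") auto
      then show ?thesis by (simp add: v_def)
    qed
    then show "\<exists>d>0. \<forall>y\<in>{0..}. norm (y - t) < d \<longrightarrow> norm (G y - G t - (y - t) *\<^sub>R h t) \<le> e * norm (y - t)"
      using d(1) by blast
  qed
  moreover have "G 0 = 0" by (simp add: G_def)
  ultimately show ?thesis using that by blast
qed

section \<open>Test functions\<close>

text \<open>The functions \<open>p(t) / (t (1 - t))\<^sup>k exp (-1 / (t (1 - t)))\<close>, extended by zero outside
  \<open>(0,1)\<close>: a family of bump functions that is closed under differentiation.\<close>
definition bump :: "real poly \<Rightarrow> nat \<Rightarrow> real \<Rightarrow> real" where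
  "bump p k t = (if 0 < t \<and> t < 1 then poly p t / (t * (1 - t)) ^ k * exp (- 1 / (t * (1 - t))) else 0)"

text \<open>With q = t (1 - t), that is \<open>[:0, 1, -1:]\<close>, and q' =
  \<open>[:1, -2:]\<close>, this is the numerator over q^(k+2) in the derivative of (p / q^k)
  exp(-1/q).\<close>

definition bump_step :: "real poly \<Rightarrow> nat \<Rightarrow> real poly" where
  "bump_step p k = pderiv p * [:0, 1, -1:]\<^sup>2 - of_nat k * p * [:1, -2:] * [:0, 1, -1:] + p * [:1, -2:]"

text \<open>A single term of the exponential series at 1/q is at most its sum.\<close>

lemma exp_neg_inverse_le:
  fixes q :: real assumes "q > 0" shows "exp (- 1 / q) \<le> fact m * q ^ m"
proof -
  have "(1 / q) ^ m / fact m \<le> exp (1 / q)"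
  proof -
    have s: "(\<lambda>n. (1 / q) ^ n /\<^sub>R fact n) sums exp (1 / q)" by (rule exp_converges)
    have "(\<Sum>n\<in>{m}. (1 / q) ^ n /\<^sub>R fact n) \<le> (\<Sum>n. (1 / q) ^ n /\<^sub>R fact n)"
      by (rule sum_le_suminf) (use s assms in \<open>auto simp: sums_iff\<close>)
    then show ?thesis using s by (simp add: sums_iff field_simps)
  qed
  then show ?thesis using assms by (simp add: exp_minus field_simps)
qed

text \<open>Taking \<open>m = k + 2\<close> in \<open>exp_neg_inverse_le\<close> cancels the pole
  q^k and leaves q^2, which is at most t^2 and at most (1 - t)^2. Quadratic flatness at both ends
  gives derivative 0 there.\<close>

lemma bump_quadratic_bound:
  obtains B where "B \<ge> 0" "\<And>t. \<bar>bump p k t\<bar> \<le> B * t\<^sup>2" "\<And>t. \<bar>bump p k t\<bar> \<le> B * (t - 1)\<^sup>2"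
proof -
  have "bounded (poly p ` {0..1})"
    by (intro compact_imp_bounded compact_continuous_image continuous_intros) simp
  then obtain C where C: "C > 0" "\<And>t. 0 \<le> t \<Longrightarrow> t \<le> 1 \<Longrightarrow> \<bar>poly p t\<bar> \<le> C"
    by (auto simp: bounded_pos)
  define B where "B = C * fact (k + 2)"
  have B: "\<bar>bump p k t\<bar> \<le> B * (t * (1 - t))\<^sup>2" if "0 < t" "t < 1" for t
  proof -
    let ?q = "t * (1 - t)"
    have q: "?q > 0" using that by simp
    have "\<bar>bump p k t\<bar> = \<bar>poly p t\<bar> / ?q ^ k * exp (- 1 / ?q)"
      using that q by (simp add: bump_def abs_mult)
    also have "\<dots> \<le> C / ?q ^ k * (fact (k + 2) * ?q ^ (k + 2))"
      by (intro mult_mono divide_right_mono exp_neg_inverse_le q C) (use that q C in auto)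
    also have "\<dots> = B * ?q\<^sup>2" using q that by (simp add: B_def power_add power2_eq_square mult.assoc mult.left_commute)
    finally show ?thesis .
  qed
  have B0: "B \<ge> 0" using C by (simp add: B_def)
  have "\<bar>bump p k t\<bar> \<le> B * t\<^sup>2 \<and> \<bar>bump p k t\<bar> \<le> B * (t - 1)\<^sup>2" for t
  proof (cases "0 < t \<and> t < 1")
    case True
    have "(t * (1 - t))\<^sup>2 \<le> t\<^sup>2" "(t * (1 - t))\<^sup>2 \<le> (1 - t)\<^sup>2"
      using True by (auto intro!: power_mono mult_left_le mult_left_le_one_le)
    then have "B * (t * (1 - t))\<^sup>2 \<le> B * t\<^sup>2" "B * (t * (1 - t))\<^sup>2 \<le> B * (1 - t)\<^sup>2"
      using B0 by (auto intro: mult_left_mono)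
    then show ?thesis using B[of t] True by (simp add: power2_commute[of t 1])
  next
    case False
    then have "bump p k t = 0" by (auto simp: bump_def)
    then show ?thesis using B0 by simp
  qed
  then show ?thesis using that B0 by blast
qed

lemma quadratic_bound_deriv_zero:
  fixes f :: "real \<Rightarrow> real"
  assumes "\<And>t. \<bar>f t\<bar> \<le> B * (t - a)\<^sup>2" "B \<ge> 0"
  shows "(f has_real_derivative 0) (at a)"
proof -
  have f0: "f a = 0" using assms(1)[of a] by simp
  have "((\<lambda>h. (f (a + h) - f a) / h) \<longlongrightarrow> 0) (at 0)"
  proof (rule Lim_null_comparison)
    have "\<bar>(f (a + h) - f a) / h\<bar> \<le> B * \<bar>h\<bar>" if "h \<noteq> 0" for h
      using assms(1)[of "a + h"] that by (simp add: f0 abs_divide divide_le_eq power2_eq_square mult.assoc)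
    then show "\<forall>\<^sub>F h in at 0. norm ((f (a + h) - f a) / h) \<le> B * \<bar>h\<bar>"
      by (auto simp: eventually_at_filter)
    have "((\<lambda>h. B * \<bar>h\<bar>) \<longlongrightarrow> B * \<bar>0\<bar>) (at (0::real))" by (intro tendsto_intros)
    then show "((\<lambda>h. B * \<bar>h\<bar>) \<longlongrightarrow> 0) (at (0::real))" by simp
  qed
  then show ?thesis by (simp add: DERIV_def)
qed

lemma bump_deriv: "(bump p k has_real_derivative bump (bump_step p k) (k + 2) t) (at t)"
proof -
  obtain B where B: "B \<ge> 0" "\<And>t. \<bar>bump p k t\<bar> \<le> B * t\<^sup>2" "\<And>t. \<bar>bump p k t\<bar> \<le> B * (t - 1)\<^sup>2"
    using bump_quadratic_bound by blast
  consider "t = 0" | "t = 1" | "t < 0 \<or> t > 1" | "0 < t" "t < 1" by linarith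
  then show ?thesis
  proof cases
    case 1
    then show ?thesis using quadratic_bound_deriv_zero[of "bump p k" B 0] B by (simp add: bump_def)
  next
    case 2
    then show ?thesis using quadratic_bound_deriv_zero[of "bump p k" B 1] B by (simp add: bump_def)
  next
    case 3
    have "((\<lambda>t. 0) has_real_derivative 0) (at t)" by simp
    then have "(bump p k has_real_derivative 0) (at t)"
      by (rule has_field_derivative_transform_within_open[of _ _ _ "{..<0} \<union> {1<..}"])
        (use 3 in \<open>auto simp: bump_def\<close>)
    then show ?thesis using 3 by (auto simp: bump_def)
  next
    case 4
    define q where "q = t * (1 - t)"
    have q: "q > 0" using 4 by (simp add: q_def)
    have t: "t \<noteq> 0" "1 - t \<noteq> 0" using 4 by auto
    have dq: "((\<lambda>t. t * (1 - t)) has_real_derivative 1 - 2 * t) (at t)"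
      by (auto intro!: derivative_eq_intros)
    have "((\<lambda>t. poly p t / (t * (1 - t)) ^ k) has_real_derivative
        (poly (pderiv p) t * q ^ k - poly p t * (of_nat k * ((1 - 2 * t) * q ^ (k - Suc 0)))) / (q ^ k * q ^ k)) (at t)"
      unfolding q_def by (rule DERIV_divide[OF poly_DERIV DERIV_power[OF dq]]) (use t in simp)
    moreover have "((\<lambda>t. exp (- 1 / (t * (1 - t)))) has_real_derivative
        exp (- 1 / q) * ((0 * q - (- 1) * (1 - 2 * t)) / (q * q))) (at t)"
      unfolding q_def by (rule DERIV_fun_exp[OF DERIV_divide[OF DERIV_const dq]]) (use t in simp)
    ultimately have "((\<lambda>t. poly p t / (t * (1 - t)) ^ k * exp (- 1 / (t * (1 - t)))) has_real_derivative
        (poly (pderiv p) t * q ^ k - poly p t * (of_nat k * ((1 - 2 * t) * q ^ (k - Suc 0)))) / (q ^ k * q ^ k) * exp (- 1 / q)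
        + exp (- 1 / q) * ((0 * q - (- 1) * (1 - 2 * t)) / (q * q)) * (poly p t / q ^ k)) (at t)"
      unfolding q_def by (rule DERIV_mult)
    also have "(poly (pderiv p) t * q ^ k - poly p t * (of_nat k * ((1 - 2 * t) * q ^ (k - Suc 0)))) / (q ^ k * q ^ k) * exp (- 1 / q)
        + exp (- 1 / q) * ((0 * q - (- 1) * (1 - 2 * t)) / (q * q)) * (poly p t / q ^ k)
      = (poly (pderiv p) t * q\<^sup>2 - of_nat k * poly p t * (1 - 2 * t) * q + poly p t * (1 - 2 * t)) / q ^ (k + 2) * exp (- 1 / q)"
      using q by (cases k) (simp_all add: field_simps power2_eq_square)
    also have "\<dots> = bump (bump_step p k) (k + 2) t"
      using 4 by (simp add: bump_def bump_step_def q_def algebra_simps)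
    finally show ?thesis
      by (rule has_field_derivative_transform_within_open[of _ _ _ "{0<..<1}"]) (use 4 in \<open>auto simp: bump_def\<close>)
  qed
qed

fun bump_poly :: "nat \<Rightarrow> real poly" where
  "bump_poly 0 = 1"
| "bump_poly (Suc n) = bump_step (bump_poly n) (2 * n)"

text \<open>The exponent is 2n because each differentiation raises it by 2.\<close>

definition bump_derivs :: "nat \<Rightarrow> real \<Rightarrow> real" where
  "bump_derivs n = bump (bump_poly n) (2 * n)"

lemma bump_derivs_deriv: "(bump_derivs n has_real_derivative bump_derivs (Suc n) t) (at t)"
  using bump_deriv[of "bump_poly n" "2 * n" t] by (simp add: bump_derivs_def)

lemma bump_derivs_0: "bump_derivs 0 t = (if 0 < t \<and> t < 1 then exp (- 1 / (t * (1 - t))) else 0)"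
  by (simp add: bump_derivs_def bump_def)

text \<open>A smooth step. The difference of two rescaled translates has compact support, and its
  derivative is a bump near one point minus an equal bump near another.\<close>

lemma bump_primitive_exists:
  obtains R where "\<And>t. (R has_real_derivative bump_derivs 0 t) (at t)"
    "\<And>t. t \<le> 0 \<Longrightarrow> R t = R 0" "\<And>t. 1 \<le> t \<Longrightarrow> R t = R 1" "R 0 < R 1"
proof -
  have "isCont (bump_derivs 0) t" for t by (rule DERIV_isCont[OF bump_derivs_deriv])
  then obtain R where R: "\<And>t. (R has_real_derivative bump_derivs 0 t) (at t)"
    using einterval_antiderivative[of "-\<infinity>" "\<infinity>" "bump_derivs 0"]
    by (auto simp: has_real_derivative_iff_has_vector_derivative)
  have "R t = R 0" if "t \<le> 0" for t
  proof (cases "t = 0")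
    case False
    then have "t < 0" using that by simp
    from MVT2[OF this, of R "bump_derivs 0"] R obtain z where "z < 0" "R 0 - R t = (0 - t) * bump_derivs 0 z" by auto
    then show ?thesis by (simp add: bump_derivs_0)
  qed simp
  moreover have "R t = R 1" if "1 \<le> t" for t
  proof (cases "t = 1")
    case False
    then have "1 < t" using that by simp
    from MVT2[OF this, of R "bump_derivs 0"] R obtain z where "1 < z" "R t - R 1 = (t - 1) * bump_derivs 0 z" by auto
    then show ?thesis by (simp add: bump_derivs_0)
  qed simp
  moreover have "R 0 < R 1"
  proof -
    have "(0::real) < 1" by simp
    from MVT2[OF this, of R "bump_derivs 0"] R obtain z where "0 < z" "z < 1" "R 1 - R 0 = (1 - 0) * bump_derivs 0 z" by auto
    moreover from this have "0 < bump_derivs 0 z" by (simp add: bump_derivs_0)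
    ultimately show ?thesis by simp
  qed
  ultimately show ?thesis using that R by blast
qed

lemma funpow_deriv_eq:
  fixes F :: "nat \<Rightarrow> real \<Rightarrow> real"
  assumes "\<And>n t. (F n has_real_derivative F (Suc n) t) (at t)"
  shows "(deriv ^^ n) (F 0) = F n"
proof (induction n)
  case (Suc n)
  have "deriv (F n) = F (Suc n)" using assms DERIV_imp_deriv by blast
  then show ?case using Suc by simp
qed simp

lemma test_function_difference:
  assumes R: "\<And>t. (R has_real_derivative bump_derivs 0 t) (at t)"
    "\<And>t. t \<le> 0 \<Longrightarrow> R t = R 0" "\<And>t. 1 \<le> t \<Longrightarrow> R t = R 1"
    and e: "e > 0" and ab: "0 < a" "a \<le> b" "b + e < T"
  defines "\<phi> \<equiv> \<lambda>t. R ((t - a) / e) - R ((t - b) / e)"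
  shows "test_function T \<phi>"
    and "deriv \<phi> t = (bump_derivs 0 ((t - a) / e) - bump_derivs 0 ((t - b) / e)) / e"
proof -
  define F where "F n t = (case n of 0 \<Rightarrow> \<phi> t
    | Suc n \<Rightarrow> (bump_derivs n ((t - a) / e) - bump_derivs n ((t - b) / e)) / e ^ Suc n)" for n t
  have chain: "((\<lambda>t. f ((t - c) / e)) has_real_derivative g ((t - c) / e) / e) (at t)"
    if "\<And>t. (f has_real_derivative g t) (at t)" for f g c t
  proof -
    have "((\<lambda>t. (t - c) / e) has_real_derivative 1 / e) (at t)"
      using e by (auto intro!: derivative_eq_intros)
    from DERIV_chain2[OF that this] show ?thesis by simp
  qed
  have F: "(F n has_real_derivative F (Suc n) t) (at t)" for n t
  proof (cases n)
    case 0
    have "(\<phi> has_real_derivative bump_derivs 0 ((t - a) / e) / e - bump_derivs 0 ((t - b) / e) / e) (at t)"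
      unfolding \<phi>_def by (intro DERIV_diff chain R)
    then show ?thesis by (simp add: F_def[abs_def] 0 diff_divide_distrib)
  next
    case (Suc m)
    have "((\<lambda>t. (bump_derivs m ((t - a) / e) - bump_derivs m ((t - b) / e)) / e ^ Suc m) has_real_derivative
        (bump_derivs (Suc m) ((t - a) / e) / e - bump_derivs (Suc m) ((t - b) / e) / e) / e ^ Suc m) (at t)"
      by (intro DERIV_cdivide DERIV_diff chain bump_derivs_deriv)
    then show ?thesis by (simp add: F_def[abs_def] Suc diff_divide_distrib)
  qed
  have F0: "F 0 = \<phi>" by (auto simp: F_def)
  have "((deriv ^^ n) \<phi>) differentiable (at t)" for n t
    using funpow_deriv_eq[of F n, OF F] F[of n t] F0 real_differentiable_def by metis
  moreover have "\<phi> t = 0" if "t \<notin> {a..b + e}" for t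
  proof (cases "t < a")
    case True
    then show ?thesis using R(2)[of "(t - a) / e"] R(2)[of "(t - b) / e"] ab e
      by (simp add: \<phi>_def divide_le_0_iff)
  next
    case False
    then have "1 \<le> (t - a) / e" "1 \<le> (t - b) / e" using that ab e by (auto simp: field_simps)
    from this[THEN R(3)] show ?thesis by (simp add: \<phi>_def)
  qed
  ultimately show "test_function T \<phi>" unfolding test_function_def using ab by blast
  show "deriv \<phi> t = (bump_derivs 0 ((t - a) / e) - bump_derivs 0 ((t - b) / e)) / e"
    using F[of 0 t] unfolding F0 by (simp add: F_def DERIV_imp_deriv)
qed

text \<open>The derivative of the test function is a bump just to the right of \<open>a\<close>
  minus an equal bump just to the right of \<open>b\<close>, so the two weighted averages of
  \<open>w\<close> coincide. If \<open>w a < w b\<close>, narrow bumps keep the first average at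
  most the midpoint \<open>m\<close> and push the second above it.\<close>

lemma du_bois_reymond:
  fixes w :: "real \<Rightarrow> real"
  assumes w: "continuous_on {0..T} w"
    and weak: "\<And>\<phi>. test_function T \<phi> \<Longrightarrow> integral {0..T} (\<lambda>t. deriv \<phi> t * w t) = 0"
    and ab: "0 < a" "a < b" "b < T"
  shows "w b \<le> w a"
proof (rule ccontr)
  assume "\<not> ?thesis"
  then have lt: "w a < w b" by simp
  define m where "m = (w a + w b) / 2"
  have m: "w a < m" "m < w b" using lt by (auto simp: m_def)
  obtain R where R: "\<And>t. (R has_real_derivative bump_derivs 0 t) (at t)"
    "\<And>t. t \<le> 0 \<Longrightarrow> R t = R 0" "\<And>t. 1 \<le> t \<Longrightarrow> R t = R 1" "R 0 < R 1"
    using bump_primitive_exists by blast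
  have near: "\<exists>d>0. \<forall>t\<in>{0..T}. \<bar>t - c\<bar> < d \<longrightarrow> \<bar>w t - w c\<bar> < r" if "c \<in> {0..T}" "r > 0" for c r
    using w that unfolding continuous_on_iff dist_real_def by blast
  obtain da where da: "da > 0" "\<And>t. t \<in> {0..T} \<Longrightarrow> \<bar>t - a\<bar> < da \<Longrightarrow> \<bar>w t - w a\<bar> < m - w a"
    using near[of a "m - w a"] ab m by auto
  obtain db where db: "db > 0" "\<And>t. t \<in> {0..T} \<Longrightarrow> \<bar>t - b\<bar> < db \<Longrightarrow> \<bar>w t - w b\<bar> < w b - m"
    using near[of b "w b - m"] ab m by auto
  \<comment> \<open>This width keeps \<open>w\<close> below \<open>m\<close> on the first bump,
    above \<open>m\<close> on the second, and the second bump inside the interval.\<close>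
  define e where "e = min (min da db) ((T - b) / 2)"
  have e: "e > 0" "e \<le> da" "e \<le> db" "b + e < T" using da(1) db(1) ab by (auto simp: e_def min_def field_simps)
  define ra where "ra c t = bump_derivs 0 ((t - c) / e) / e" for c t
  have ra_nonneg: "0 \<le> ra c t" for c t using e by (simp add: ra_def bump_derivs_0)
  have ra_supp: "c < t \<and> t < c + e" if "ra c t \<noteq> 0" for c t
    using that e by (auto simp: ra_def bump_derivs_0 field_simps split: if_splits)
  have cont_bump: "continuous_on UNIV (bump_derivs 0)"
    by (intro continuous_at_imp_continuous_on ballI DERIV_isCont[OF bump_derivs_deriv])
  have cont: "continuous_on S (ra c)" for c S
    unfolding ra_def using e by (intro continuous_intros continuous_on_compose2[OF cont_bump]) auto
  have int_ra: "(ra c has_integral (R 1 - R 0)) {0..T}" if "0 < c" "c + e \<le> T" for c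
  proof -
    have "(ra c has_integral (R ((T - c) / e) - R ((0 - c) / e))) {0..T}"
    proof (rule fundamental_theorem_of_calculus)
      fix t assume "t \<in> {0..T}"
      have "((\<lambda>t. (t - c) / e) has_real_derivative 1 / e) (at t)"
        using e by (auto intro!: derivative_eq_intros)
      from DERIV_chain2[OF R(1) this] have "((\<lambda>t. R ((t - c) / e)) has_real_derivative ra c t) (at t)"
        by (simp add: ra_def)
      then show "((\<lambda>t. R ((t - c) / e)) has_vector_derivative ra c t) (at t within {0..T})"
        by (simp add: has_real_derivative_iff_has_vector_derivative has_vector_derivative_at_within)
    qed (use ab in simp)
    moreover have "R ((T - c) / e) = R 1" using that e by (intro R(3)) (simp add: field_simps)
    moreover have "R ((0 - c) / e) = R 0" using that e by (intro R(2)) (simp add: divide_le_0_iff)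
    ultimately show ?thesis by simp
  qed
  define \<phi> where "\<phi> t = R ((t - a) / e) - R ((t - b) / e)" for t
  have "test_function T \<phi>" "\<And>t. deriv \<phi> t = (bump_derivs 0 ((t - a) / e) - bump_derivs 0 ((t - b) / e)) / e"
    using test_function_difference[OF R(1-3) e(1), of a b T] ab e unfolding \<phi>_def[abs_def] by auto
  then have "integral {0..T} (\<lambda>t. (ra a t - ra b t) * w t) = 0"
    using weak[of \<phi>] by (simp add: ra_def diff_divide_distrib)
  moreover have i: "(\<lambda>t. ra a t * w t) integrable_on {0..T}" "(\<lambda>t. ra b t * w t) integrable_on {0..T}"
    by (intro integrable_continuous_real continuous_intros cont w)+
  ultimately have eq: "integral {0..T} (\<lambda>t. ra a t * w t) = integral {0..T} (\<lambda>t. ra b t * w t)"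
    by (simp add: left_diff_distrib integral_diff)
  have va: "ra a t * w t \<le> ra a t * m" if "t \<in> {0..T}" for t
  proof (cases "ra a t = 0")
    case False
    then have "w t \<le> m" using da(2)[OF that] ra_supp[OF False] e by auto
    then show ?thesis using ra_nonneg by (rule mult_left_mono)
  qed simp
  have vb: "ra b t * m \<le> ra b t * w t" if "t \<in> {0..T}" for t
  proof (cases "ra b t = 0")
    case False
    then have "m \<le> w t" using db(2)[OF that] ra_supp[OF False] e by auto
    then show ?thesis using ra_nonneg by (rule mult_left_mono)
  qed simp
  have ia: "((\<lambda>t. ra a t * m) has_integral (R 1 - R 0) * m) {0..T}"
    and ib: "((\<lambda>t. ra b t * m) has_integral (R 1 - R 0) * m) {0..T}"
    using int_ra[of a] int_ra[of b] ab e by (auto intro!: has_integral_mult_left)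
  text \<open>Both integrals equal \<open>(R 1 - R 0) m\<close>, so the continuous nonnegative function
    \<open>ra b t * (w t - m)\<close> vanishes on \<open>[0,T]\<close>, although it is positive at \<open>b + e/2\<close>.\<close>
  have "integral {0..T} (\<lambda>t. ra a t * w t) \<le> (R 1 - R 0) * m"
    by (rule has_integral_le[OF integrable_integral[OF i(1)] ia va])
  then have "integral {0..T} (\<lambda>t. ra b t * (w t - m)) \<le> 0"
    using eq integral_unique[OF has_integral_diff[OF integrable_integral[OF i(2)] ib]]
    by (simp add: right_diff_distrib)
  moreover have nn: "0 \<le> ra b t * (w t - m)" if "t \<in> {0..T}" for t
    using vb[OF that] by (simp add: right_diff_distrib)
  moreover have ci: "continuous_on {0..T} (\<lambda>t. ra b t * (w t - m))" by (intro continuous_intros cont w)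
  ultimately have "((\<lambda>t. ra b t * (w t - m)) has_integral 0) (cbox 0 T)"
    using integral_nonneg[OF integrable_continuous_real[OF ci]] integrable_integral[OF integrable_continuous_real[OF ci]]
    by (metis box_real(2) order_antisym)
  moreover have mid: "b + e / 2 \<in> {0..T}" using ab e by auto
  ultimately have "ra b (b + e / 2) * (w (b + e / 2) - m) = 0"
    using has_integral_0_cbox_imp_0[of 0 T "\<lambda>t. ra b t * (w t - m)" "b + e / 2"] ci nn ab by simp
  moreover have "ra b (b + e / 2) > 0" using e by (simp add: ra_def bump_derivs_0)
  moreover have "w (b + e / 2) > m" using db(2)[OF mid] e by auto
  ultimately show False by simp
qed

lemma test_functionD:
  assumes \<phi>: "test_function T \<phi>"
  shows "(\<phi> has_real_derivative deriv \<phi> t) (at t)" "continuous_on S \<phi>" "continuous_on S (deriv \<phi>)"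
    "\<phi> 0 = 0" "\<phi> T = 0"
proof -
  have "(deriv ^^ n) \<phi> differentiable (at t)" for n t using \<phi> by (simp add: test_function_def)
  from this[of 0] this[of 1]
  have d0: "\<phi> differentiable (at t)" and d1: "deriv \<phi> differentiable (at t)" for t by auto
  show "(\<phi> has_real_derivative deriv \<phi> t) (at t)"
    using d0 DERIV_deriv_iff_real_differentiable by blast
  show "continuous_on S \<phi>" "continuous_on S (deriv \<phi>)"
    using d0 d1 by (auto intro!: continuous_at_imp_continuous_on differentiable_imp_continuous_within)
  show "\<phi> 0 = 0" "\<phi> T = 0" using \<phi> by (auto simp: test_function_def)
qed

text \<open>Subtracting the primitive \<open>B\<close> of \<open>b\<close> leaves a function
  \<open>w\<close> with zero weak derivative. Applying \<open>du_bois_reymond\<close> to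
  \<open>w\<close> and to \<open>- w\<close> makes it constant on the open interval, and continuity
  reaches the endpoints.\<close>

lemma weak_derivative_imp_derivative:
  fixes a b :: "real \<Rightarrow> real"
  assumes a: "continuous_on {0..T} a" and b: "continuous_on {0..T} b" and T: "T > 0"
    and weak: "\<And>\<phi>. test_function T \<phi> \<Longrightarrow> integral {0..T} (\<lambda>t. deriv \<phi> t * a t) = - integral {0..T} (\<lambda>t. \<phi> t * b t)"
    and t: "t \<in> {0..T}"
  shows "(a has_real_derivative b t) (at t within {0..T})"
proof -
  define B where "B t = integral {0..t} b" for t
  have B: "(B has_real_derivative b t) (at t within {0..T})" if "t \<in> {0..T}" for t
    unfolding B_def by (rule integral_has_real_derivative[OF b that])
  have contB: "continuous_on {0..T} B" using B by (meson DERIV_continuous_on)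
  define w where "w t = a t - B t" for t
  have contw: "continuous_on {0..T} w" unfolding w_def by (intro continuous_intros a contB)
  have weak0: "integral {0..T} (\<lambda>t. deriv \<phi> t * w t) = 0" if \<phi>: "test_function T \<phi>" for \<phi>
  proof -
    note d = test_functionD(1)[OF \<phi>] and c0 = test_functionD(2)[OF \<phi>] and c1 = test_functionD(3)[OF \<phi>]
      and supp = test_functionD(4,5)[OF \<phi>]
    have "((\<lambda>t. deriv \<phi> t * B t + \<phi> t * b t) has_integral (\<phi> T * B T - \<phi> 0 * B 0)) {0..T}"
    proof (rule fundamental_theorem_of_calculus)
      fix t assume t: "t \<in> {0..T}"
      have "((\<lambda>t. \<phi> t * B t) has_real_derivative deriv \<phi> t * B t + b t * \<phi> t) (at t within {0..T})"
        by (rule DERIV_mult[OF has_field_derivative_at_within[OF d] B[OF t]])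
      then show "((\<lambda>t. \<phi> t * B t) has_vector_derivative deriv \<phi> t * B t + \<phi> t * b t) (at t within {0..T})"
        by (simp add: has_real_derivative_iff_has_vector_derivative mult.commute)
    qed (use T in simp)
    moreover have i: "(\<lambda>t. deriv \<phi> t * B t) integrable_on {0..T}" "(\<lambda>t. \<phi> t * b t) integrable_on {0..T}"
      "(\<lambda>t. deriv \<phi> t * a t) integrable_on {0..T}"
      by (intro integrable_continuous_real continuous_intros c0 c1 contB a b)+
    ultimately have "integral {0..T} (\<lambda>t. deriv \<phi> t * B t) = - integral {0..T} (\<lambda>t. \<phi> t * b t)"
      using supp integral_add[OF i(1,2)] by (auto dest!: integral_unique)
    then show ?thesis using weak[OF \<phi>] i by (simp add: w_def right_diff_distrib integral_diff)
  qed
  have le: "w t \<le> w s" if "0 < s" "s < t" "t < T" for s t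
    by (rule du_bois_reymond[OF contw weak0 that])
  have "integral {0..T} (\<lambda>t. deriv \<phi> t * - w t) = 0" if "test_function T \<phi>" for \<phi>
    using weak0[OF that] by simp
  then have ge: "w s \<le> w t" if "0 < s" "s < t" "t < T" for s t
    using du_bois_reymond[of T "\<lambda>t. - w t" s t] contw that by (simp add: continuous_on_minus)
  define c where "c = w (T / 2)"
  have eq: "w t = c" if "t \<in> {0<..<T}" for t
    using le[of t "T/2"] ge[of t "T/2"] le[of "T/2" t] ge[of "T/2" t] that T
    by (cases t "T/2" rule: linorder_cases) (auto simp: c_def)
  have "w t = c" if t: "t \<in> {0..T}" for t
  proof -
    have "closure {0<..<T} = {0..T}" using T by simp
    then show ?thesis
      using continuous_constant_on_closure[of "{0<..<T}" w c t] contw eq t by auto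
  qed
  then have "a t = B t + c" if "t \<in> {0..T}" for t using that by (simp add: w_def algebra_simps)
  moreover have "((\<lambda>t. B t + c) has_real_derivative b t) (at t within {0..T})"
    using DERIV_add[OF B[OF t] DERIV_const] by simp
  ultimately show ?thesis using t
    by (auto intro: has_field_derivative_transform_within[of _ _ _ _ 1])
qed

section \<open>The linear equation mode by mode\<close>

lemma nonincreasing_if_deriv_nonpos:
  fixes F :: "real \<Rightarrow> real"
  assumes F: "\<And>s. 0 \<le> s \<Longrightarrow> s \<le> t \<Longrightarrow> (F has_real_derivative F' s) (at s within {0..t})"
    and le: "\<And>s. 0 \<le> s \<Longrightarrow> s \<le> t \<Longrightarrow> F' s \<le> 0" and t: "0 \<le> t"
  shows "F t \<le> F 0"
  using t
proof (rule DERIV_nonpos_imp_decreasing_open)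
  fix s assume s: "0 < s" "s < t"
  have "at s within {0..t} = at s" by (rule at_within_interior) (use s in simp)
  then show "\<exists>y. (F has_real_derivative y) (at s) \<and> y \<le> 0" using F[of s] le[of s] s by auto
next
  show "continuous_on {0..t} F" using F by (intro DERIV_continuous_on) auto
qed

lemma integral_has_real_derivative_atLeast:
  fixes g :: "real \<Rightarrow> real"
  assumes g: "continuous_on {0..} g" and t: "t \<ge> 0"
  shows "((\<lambda>t. integral {0..t} g) has_real_derivative g t) (at t within {0..})"
proof -
  have "((\<lambda>t. integral {0..t} g) has_real_derivative g t) (at t within {0..t + 1})"
    by (rule integral_has_real_derivative) (use g t in \<open>auto intro: continuous_on_subset\<close>)
  moreover have "at t within {0..t + 1} = at t within {0..}"
    by (rule at_within_nhd[of t "{..<t + 1}"]) (use t in auto)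
  ultimately show ?thesis by simp
qed

lemma has_real_derivative_norm_square:
  fixes y :: "real \<Rightarrow> 'b::real_inner"
  assumes "(y has_vector_derivative y') (at t within S)"
  shows "((\<lambda>t. (norm (y t))\<^sup>2) has_real_derivative 2 * (y t \<bullet> y')) (at t within S)"
proof -
  have "((\<lambda>t. y t \<bullet> y t) has_derivative (\<lambda>h. y t \<bullet> (h *\<^sub>R y') + (h *\<^sub>R y') \<bullet> y t)) (at t within S)"
    by (rule has_derivative_inner) (use assms in \<open>simp_all add: has_vector_derivative_def\<close>)
  moreover have "(\<lambda>h. y t \<bullet> (h *\<^sub>R y') + (h *\<^sub>R y') \<bullet> y t) = (*) (2 * (y t \<bullet> y'))"
    by (auto simp: inner_commute)
  ultimately show ?thesis by (simp add: has_field_derivative_def power2_norm_eq_inner)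
qed

text \<open>Of the damping 2a, one half absorbs the forcing by Young's inequality and the other
  half, being at least \<delta>, absorbs the derivative of the weight. The loss \<open>b\<close>
  enters only through b^2 / a \<le> \<kappa>.\<close>

lemma mode_energy:
  fixes y g :: "real \<Rightarrow> 'b::real_inner"
  assumes y: "\<And>t. t \<ge> 0 \<Longrightarrow> (y has_vector_derivative - a *\<^sub>R y t + b *\<^sub>R g t) (at t within {0..})"
    and g: "continuous_on {0..} g" and \<delta>: "\<delta> \<le> a" and a: "0 < a" and \<kappa>: "b\<^sup>2 \<le> \<kappa> * a" and t: "t \<ge> 0"
  shows "exp (\<delta> * t) * (norm (y t))\<^sup>2 \<le> (norm (y 0))\<^sup>2 + \<kappa> * integral {0..t} (\<lambda>s. exp (\<delta> * s) * (norm (g s))\<^sup>2)"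
proof -
  define F where "F t = exp (\<delta> * t) * (norm (y t))\<^sup>2 - \<kappa> * integral {0..t} (\<lambda>s. exp (\<delta> * s) * (norm (g s))\<^sup>2)" for t
  define F' where "F' t = (\<delta> * exp (\<delta> * t)) * (norm (y t))\<^sup>2 + (2 * (y t \<bullet> (- a *\<^sub>R y t + b *\<^sub>R g t))) * exp (\<delta> * t)
    - \<kappa> * (exp (\<delta> * t) * (norm (g t))\<^sup>2)" for t
  have "F t \<le> F 0"
  proof (rule nonincreasing_if_deriv_nonpos[OF _ _ t])
    fix s :: real assume s: "0 \<le> s"
    have "((\<lambda>t. exp (\<delta> * t)) has_real_derivative \<delta> * exp (\<delta> * s)) (at s within {0..})"
      by (auto intro!: derivative_eq_intros)
    moreover have "continuous_on {0..} (\<lambda>s. exp (\<delta> * s) * (norm (g s))\<^sup>2)" by (intro continuous_intros g)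
    ultimately have "(F has_real_derivative F' s) (at s within {0..})" unfolding F_def F'_def
      by (intro DERIV_diff DERIV_mult DERIV_cmult integral_has_real_derivative_atLeast
          has_real_derivative_norm_square y s)
    then show "(F has_real_derivative F' s) (at s within {0..t})" by (rule DERIV_subset) auto
    have "2 * b * (y s \<bullet> g s) \<le> a * (norm (y s))\<^sup>2 + b\<^sup>2 / a * (norm (g s))\<^sup>2"
    proof -
      have "0 \<le> (norm (a *\<^sub>R y s - b *\<^sub>R g s))\<^sup>2" by simp
      also have "\<dots> = a\<^sup>2 * (norm (y s))\<^sup>2 - 2 * a * b * (y s \<bullet> g s) + b\<^sup>2 * (norm (g s))\<^sup>2"
        by (simp add: power2_norm_eq_inner inner_simps inner_commute power2_eq_square[of a] power2_eq_square[of b])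
      finally show ?thesis using a by (simp add: field_simps power2_eq_square)
    qed
    also have "b\<^sup>2 / a * (norm (g s))\<^sup>2 \<le> \<kappa> * (norm (g s))\<^sup>2"
      using \<kappa> a by (intro mult_right_mono) (auto simp: field_simps)
    finally have "2 * b * (y s \<bullet> g s) \<le> a * (norm (y s))\<^sup>2 + \<kappa> * (norm (g s))\<^sup>2" by simp
    moreover have "\<delta> * (norm (y s))\<^sup>2 \<le> a * (norm (y s))\<^sup>2" using \<delta> by (intro mult_right_mono) auto
    moreover have "F' s = exp (\<delta> * s) * (\<delta> * (norm (y s))\<^sup>2 - 2 * a * (norm (y s))\<^sup>2
        + 2 * b * (y s \<bullet> g s) - \<kappa> * (norm (g s))\<^sup>2)"
      by (simp add: F'_def inner_simps power2_norm_eq_inner algebra_simps)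
    ultimately show "F' s \<le> 0" by (simp add: mult_le_0_iff)
  qed
  then show ?thesis by (simp add: F_def)
qed

lemma exp_bound_increment:
  fixes E :: "real \<Rightarrow> 'b::real_normed_vector"
  assumes E: "\<And>t. t \<ge> 0 \<Longrightarrow> (E has_vector_derivative E' t) (at t within {0..})"
    and bound: "\<And>t. t \<ge> 0 \<Longrightarrow> norm (E' t) \<le> K * exp (- (c * t))" and c: "c > 0" and K: "K \<ge> 0"
    and t: "0 \<le> t" "t \<le> T"
  shows "norm (E T - E t) \<le> K / c * exp (- (c * t))"
proof (cases "t = T")
  case False
  define \<phi> where "\<phi> s = - (K / c) * exp (- (c * s))" for s
  have "norm (E T - E t) \<le> \<phi> T - \<phi> t"
  proof (rule differentiable_bound_general[of t T E \<phi> E' "\<lambda>s. K * exp (- (c * s))"])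
    show "continuous_on {t..T} E"
      by (rule continuous_on_subset[of "{0..}"])
        (use E t in \<open>auto simp: continuous_on_eq_continuous_within intro: has_vector_derivative_continuous\<close>)
    show "continuous_on {t..T} \<phi>" unfolding \<phi>_def by (intro continuous_intros)
    fix s assume s: "t < s" "s < T"
    have "at s within {0..} = at s" by (rule at_within_interior) (use s t in simp)
    then show "(E has_vector_derivative E' s) (at s)" using E[of s] s t by simp
    show "(\<phi> has_vector_derivative K * exp (- (c * s))) (at s)"
      unfolding has_real_derivative_iff_has_vector_derivative[symmetric] \<phi>_def
      using c by (auto intro!: derivative_eq_intros)
    show "norm (E' s) \<le> K * exp (- (c * s))" using bound s t by simp
  qed (use False t in simp)
  also have "\<dots> \<le> K / c * exp (- (c * t))" using c K by (simp add: \<phi>_def)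
  finally show ?thesis .
qed (use c K in simp)

lemma exp_scaled_derivative:
  fixes y :: "real \<Rightarrow> 'b::real_normed_vector"
  assumes "(y has_vector_derivative - a *\<^sub>R y t + g) (at t within S)"
  shows "((\<lambda>t. exp (a * t) *\<^sub>R y t) has_vector_derivative exp (a * t) *\<^sub>R g) (at t within S)"
proof -
  have "((\<lambda>t. exp (a * t)) has_real_derivative a * exp (a * t)) (at t within S)"
    by (auto intro!: derivative_eq_intros)
  from has_vector_derivative_scaleR[OF this assms] show ?thesis
    by (simp add: algebra_simps)
qed

lemma exp_unscaled_derivative:
  fixes y :: "real \<Rightarrow> 'b::real_normed_vector"
  assumes "(E has_vector_derivative exp (a * t) *\<^sub>R g) (at t within S)"
  shows "((\<lambda>t. exp (- (a * t)) *\<^sub>R E t) has_vector_derivative - a *\<^sub>R (exp (- (a * t)) *\<^sub>R E t) + g) (at t within S)"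
proof -
  have "((\<lambda>t. exp (- (a * t))) has_real_derivative - a * exp (- (a * t))) (at t within S)"
    by (auto intro!: derivative_eq_intros)
  from has_vector_derivative_scaleR[OF this assms] show ?thesis
    by (simp add: exp_minus algebra_simps)
qed

text \<open>For a \<le> 0 the homogeneous solutions do not decay, so the bound comes from infinity:
  \<open>exp (a * t) *\<^sub>R d t\<close> tends to zero with \<open>d\<close>, and its increments
  are bounded by the tail of the forcing. Since \<beta> - a \<ge> \<beta>, the constant is uniform
  in \<open>a\<close>.\<close>

lemma mode_decay:
  fixes d g :: "real \<Rightarrow> 'b::real_normed_vector"
  assumes d: "\<And>t. t \<ge> 0 \<Longrightarrow> (d has_vector_derivative - a *\<^sub>R d t + g t) (at t within {0..})"
    and g: "\<And>t. t \<ge> 0 \<Longrightarrow> norm (g t) \<le> K * exp (- (\<beta> * t))" and K: "K \<ge> 0" and \<beta>: "\<beta> > 0" and a: "a \<le> 0"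
    and lim: "(d \<longlongrightarrow> 0) at_top" and t: "t \<ge> 0"
  shows "norm (d t) \<le> K / \<beta> * exp (- (\<beta> * t))"
proof -
  define E where "E t = exp (a * t) *\<^sub>R d t" for t
  have E: "(E has_vector_derivative exp (a * t) *\<^sub>R g t) (at t within {0..})" if "t \<ge> 0" for t
    unfolding E_def by (rule exp_scaled_derivative[OF d[OF that]])
  have E': "norm (exp (a * t) *\<^sub>R g t) \<le> K * exp (- ((\<beta> - a) * t))" if "t \<ge> 0" for t
    using mult_left_mono[OF g[OF that], of "exp (a * t)"] by (simp add: mult.left_commute algebra_simps flip: exp_add)
  have inc: "norm (E T - E t) \<le> K / (\<beta> - a) * exp (- ((\<beta> - a) * t))" if "t \<le> T" for T
    by (rule exp_bound_increment[OF E E' _ K t that]) (use a \<beta> in auto)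
  have "((\<lambda>T. norm (E T - E t)) \<longlongrightarrow> norm (0 - E t)) at_top"
  proof (intro tendsto_intros Lim_null_comparison[OF _ tendsto_norm_zero[OF lim]])
    show "\<forall>\<^sub>F T in at_top. norm (E T) \<le> norm (d T)"
      using eventually_ge_at_top[of 0]
    proof eventually_elim
      fix T :: real assume "T \<ge> 0"
      then have "exp (a * T) \<le> 1" using a by (simp add: mult_nonpos_nonneg)
      then show "norm (E T) \<le> norm (d T)" by (simp add: E_def mult_left_le_one_le)
    qed
  qed
  then have "norm (0 - E t) \<le> K / (\<beta> - a) * exp (- ((\<beta> - a) * t))"
    by (rule tendsto_upperbound) (rule eventually_mono[OF eventually_ge_at_top inc], assumption, rule trivial_limit_at_top_linorder)
  also have "\<dots> \<le> K / \<beta> * exp (- ((\<beta> - a) * t))"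
    using a \<beta> K by (intro mult_right_mono divide_left_mono) auto
  finally have "exp (a * t) * norm (d t) \<le> K / \<beta> * exp (- ((\<beta> - a) * t))" by (simp add: E_def)
  then have "exp (- (a * t)) * (exp (a * t) * norm (d t)) \<le> exp (- (a * t)) * (K / \<beta> * exp (- ((\<beta> - a) * t)))"
    by (rule mult_left_mono) simp
  moreover have "exp (- (a * t)) * (exp (a * t) * norm (d t)) = norm (d t)"
    by (simp add: exp_minus)
  moreover have "exp (- (a * t)) * exp (- ((\<beta> - a) * t)) = exp (- (\<beta> * t))"
    unfolding exp_add[symmetric] by (rule arg_cong[of _ _ exp]) (simp add: algebra_simps)
  then have "exp (- (a * t)) * (K / \<beta> * exp (- ((\<beta> - a) * t))) = K / \<beta> * exp (- (\<beta> * t))"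
    by (simp only: mult.left_commute[of "exp (- (a * t))" "K / \<beta>"])
  ultimately show ?thesis by linarith
qed

section \<open>Energy estimates for finite sums of modes\<close>

context discrete_selfadjoint
begin

text \<open>The equation \<open>Y' + (A - \<theta>) Y = (1 + A)\<^sup>1\<^sup>/\<^sup>2 h\<close>, projected to the eigenspaces. It is solved by
  \<open>Y(t) = exp(\<theta>t) (1 + A)\<^sup>1\<^sup>/\<^sup>2 u(t)\<close> if \<open>u' + A u = exp(-\<theta>t) h\<close>.\<close>
definition modes :: "real \<Rightarrow> (real \<Rightarrow> 'a) \<Rightarrow> (real \<Rightarrow> 'a) \<Rightarrow> bool" where
  "modes \<theta> h Y \<longleftrightarrow> (\<forall>z. \<forall>t\<ge>0. ((\<lambda>t. P z (Y t)) has_vector_derivative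
     - (z - \<theta>) *\<^sub>R P z (Y t) + sqrt (1 + z) *\<^sub>R P z (h t)) (at t within {0..}))"

lemma modes_diff:
  assumes "modes \<theta> h Y" "modes \<theta> k Z"
  shows "modes \<theta> (\<lambda>t. h t - k t) (\<lambda>t. Y t - Z t)"
  unfolding modes_def P_diff
proof (intro allI impI)
  fix z t :: real assume "0 \<le> t"
  then have "((\<lambda>t. P z (Y t) - P z (Z t)) has_vector_derivative
      (- (z - \<theta>) *\<^sub>R P z (Y t) + sqrt (1 + z) *\<^sub>R P z (h t)) -
      (- (z - \<theta>) *\<^sub>R P z (Z t) + sqrt (1 + z) *\<^sub>R P z (k t))) (at t within {0..})"
    using assms unfolding modes_def by (intro has_vector_derivative_diff) blast+
  then show "((\<lambda>t. P z (Y t) - P z (Z t)) has_vector_derivative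
      - (z - \<theta>) *\<^sub>R (P z (Y t) - P z (Z t)) + sqrt (1 + z) *\<^sub>R (P z (h t) - P z (k t))) (at t within {0..})"
    by (simp add: algebra_simps)
qed

lemma continuous_on_P: "continuous_on S f \<Longrightarrow> continuous_on S (\<lambda>t. P z (f t))"
  by (rule bounded_linear.continuous_on[OF bounded_linear_P])

text \<open>The projections of \<open>h\<close> are kept on the right so that sums over eigenvalues
  outside \<open>Lam n\<close> become small by \<open>tail_le\<close>;
  \<open>energy_sum_norm\<close> trades this for the full norm.\<close>

lemma energy_sum:
  assumes y: "\<And>z t. z \<in> F \<Longrightarrow> t \<ge> 0 \<Longrightarrow> (y z has_vector_derivative
      - (z - \<theta>) *\<^sub>R y z t + sqrt (1 + z) *\<^sub>R P z (h t)) (at t within {0..})"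
    and F: "finite F" "\<And>z. z \<in> F \<Longrightarrow> 0 \<le> z \<and> 0 < z - \<theta> \<and> \<delta> \<le> z - \<theta> \<and> 1 + z \<le> \<kappa> * (z - \<theta>)"
    and h: "continuous_on {0..} h" and t: "t \<ge> 0"
  shows "exp (\<delta> * t) * (\<Sum>z\<in>F. (norm (y z t))\<^sup>2) \<le> (\<Sum>z\<in>F. (norm (y z 0))\<^sup>2)
    + \<kappa> * integral {0..t} (\<lambda>s. exp (\<delta> * s) * (\<Sum>z\<in>F. (norm (P z (h s)))\<^sup>2))"
proof -
  have "exp (\<delta> * t) * (norm (y z t))\<^sup>2 \<le> (norm (y z 0))\<^sup>2
      + \<kappa> * integral {0..t} (\<lambda>s. exp (\<delta> * s) * (norm (P z (h s)))\<^sup>2)" if "z \<in> F" for z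
    by (rule mode_energy[OF y[OF that]]) (use F(2)[OF that] continuous_on_P[OF h] t in auto)
  then have "(\<Sum>z\<in>F. exp (\<delta> * t) * (norm (y z t))\<^sup>2) \<le> (\<Sum>z\<in>F. (norm (y z 0))\<^sup>2
      + \<kappa> * integral {0..t} (\<lambda>s. exp (\<delta> * s) * (norm (P z (h s)))\<^sup>2))"
    by (rule sum_mono)
  moreover have "integral {0..t} (\<lambda>s. exp (\<delta> * s) * (\<Sum>z\<in>F. (norm (P z (h s)))\<^sup>2))
      = (\<Sum>z\<in>F. integral {0..t} (\<lambda>s. exp (\<delta> * s) * (norm (P z (h s)))\<^sup>2))"
    unfolding sum_distrib_left
    by (rule integral_sum[OF F(1)], rule integrable_continuous_real,
        intro continuous_intros continuous_on_P continuous_on_subset[OF h]) auto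
  ultimately show ?thesis by (simp add: sum_distrib_left sum.distrib)
qed

lemma energy_sum_norm:
  assumes y: "\<And>z t. z \<in> F \<Longrightarrow> t \<ge> 0 \<Longrightarrow> (y z has_vector_derivative
      - (z - \<theta>) *\<^sub>R y z t + sqrt (1 + z) *\<^sub>R P z (h t)) (at t within {0..})"
    and F: "finite F" "\<And>z. z \<in> F \<Longrightarrow> 0 \<le> z \<and> 0 < z - \<theta> \<and> \<delta> \<le> z - \<theta> \<and> 1 + z \<le> \<kappa> * (z - \<theta>)"
    and h: "continuous_on {0..} h" and t: "t \<ge> 0" and \<kappa>: "\<kappa> \<ge> 0"
  shows "exp (\<delta> * t) * (\<Sum>z\<in>F. (norm (y z t))\<^sup>2) \<le> (\<Sum>z\<in>F. (norm (y z 0))\<^sup>2)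
    + \<kappa> * integral {0..t} (\<lambda>s. exp (\<delta> * s) * (norm (h s))\<^sup>2)"
proof -
  have ch: "continuous_on {0..t} h" by (rule continuous_on_subset[OF h]) auto
  have "integral {0..t} (\<lambda>s. exp (\<delta> * s) * (\<Sum>z\<in>F. (norm (P z (h s)))\<^sup>2))
      \<le> integral {0..t} (\<lambda>s. exp (\<delta> * s) * (norm (h s))\<^sup>2)"
    by (rule integral_le) (auto intro!: integrable_continuous_real continuous_intros continuous_on_P ch
        mult_left_mono bessel F)
  then have "\<kappa> * integral {0..t} (\<lambda>s. exp (\<delta> * s) * (\<Sum>z\<in>F. (norm (P z (h s)))\<^sup>2))
      \<le> \<kappa> * integral {0..t} (\<lambda>s. exp (\<delta> * s) * (norm (h s))\<^sup>2)"
    using \<kappa> by (rule mult_left_mono)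
  then show ?thesis using energy_sum[of F y \<theta> h \<delta> \<kappa> t, OF y F h t] by linarith
qed

text \<open>Dominated convergence, with \<open>Q_tendsto\<close> for the pointwise limit and
  \<open>norm_diff_Q_le\<close> for the domination.\<close>

lemma integral_tail_tendsto:
  assumes h: "continuous_on {0..T} h"
  shows "(\<lambda>n. integral {0..T} (\<lambda>s. exp (\<delta> * s) * (norm (h s - Q n (h s)))\<^sup>2)) \<longlonglongrightarrow> 0"
proof -
  have cQ: "continuous_on {0..T} (\<lambda>s. Q n (h s))" for n
    by (rule bounded_linear.continuous_on[OF bounded_linear_Q h])
  have "(\<lambda>n. integral {0..T} (\<lambda>s. exp (\<delta> * s) * (norm (h s - Q n (h s)))\<^sup>2)) \<longlonglongrightarrow> integral {0..T} (\<lambda>s. 0)"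
  proof (rule dominated_convergence(2))
    show "(\<lambda>s. exp (\<delta> * s) * (norm (h s - Q n (h s)))\<^sup>2) integrable_on {0..T}" for n
      by (intro integrable_continuous_real continuous_intros h cQ)
    show "(\<lambda>s. exp (\<delta> * s) * (norm (h s))\<^sup>2) integrable_on {0..T}"
      by (intro integrable_continuous_real continuous_intros h)
    show "norm (exp (\<delta> * s) * (norm (h s - Q n (h s)))\<^sup>2) \<le> exp (\<delta> * s) * (norm (h s))\<^sup>2" for n s
      by (simp add: power_mono norm_diff_Q_le)
    have "(\<lambda>n. exp (\<delta> * s) * (norm (h s - Q n (h s)))\<^sup>2) \<longlonglongrightarrow> exp (\<delta> * s) * (norm (h s - h s))\<^sup>2" for s
      by (intro tendsto_intros Q_tendsto)
    then show "(\<lambda>n. exp (\<delta> * s) * (norm (h s - Q n (h s)))\<^sup>2) \<longlonglongrightarrow> 0" for s by simp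
  qed
  then show ?thesis by simp
qed

end

text \<open>\<beta> is the decay rate of the forcing, \<delta> a rate exceeding neither \<beta> nor
  the gap above \<open>lam\<close>. The constant \<kappa> bounds (1 + z) / (z - lam) on the
  eigenvalues above \<open>lam\<close>, which makes the loss of half a derivative uniform over the
  modes.\<close>

locale spectral_gap = discrete_selfadjoint D A
  for D :: "'a::{real_inner,complete_space} set" and A :: "'a \<Rightarrow> 'a" +
  fixes lam \<delta> \<kappa> \<beta> :: real
  assumes lam_pos: "0 < lam" and \<delta>_pos: "0 < \<delta>" and \<delta>_le: "\<delta> \<le> \<beta>" and \<kappa>_nonneg: "0 \<le> \<kappa>"
    and gap: "eigenvalue D A z \<Longrightarrow> lam < z \<Longrightarrow> \<delta> \<le> z - lam \<and> 1 + z \<le> \<kappa> * (z - lam)"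

lemma (in discrete_selfadjoint) spectral_gap_exists:
  assumes "0 < lam" "0 < \<beta>"
  obtains \<delta> \<kappa> where "spectral_gap D A lam \<delta> \<kappa> \<beta>"
proof -
  let ?F = "{z. eigenvalue D A z \<and> z \<le> lam + 1} - {lam}"
  have "finite ?F" using finite_eigenvalues by simp
  from finite_set_avoid[OF this, of lam]
  obtain d where d: "d > 0" "\<And>z. z \<in> ?F \<Longrightarrow> d \<le> dist lam z" by auto
  define \<delta> where "\<delta> = min (min d 1) \<beta>"
  \<comment> \<open>Write 1 + z = (z - lam) + (1 + lam) and use z - lam \<ge> \<delta> for the
    second summand.\<close>
  define \<kappa> where "\<kappa> = 1 + (1 + lam) / \<delta>"
  have \<delta>: "0 < \<delta>" "\<delta> \<le> \<beta>" using d(1) assms by (auto simp: \<delta>_def)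
  have "\<delta> \<le> z - lam \<and> 1 + z \<le> \<kappa> * (z - lam)" if z: "eigenvalue D A z" "lam < z" for z
  proof
    show le: "\<delta> \<le> z - lam"
    proof (cases "z \<le> lam + 1")
      case True
      then show ?thesis using d(2)[of z] z by (auto simp: \<delta>_def dist_real_def)
    qed (auto simp: \<delta>_def)
    have "(1 + lam) / \<delta> * \<delta> \<le> (1 + lam) / \<delta> * (z - lam)"
      using le \<delta> assms by (intro mult_left_mono) auto
    then have "1 + lam \<le> (1 + lam) / \<delta> * (z - lam)" using \<delta> by simp
    from add_left_mono[OF this, of "z - lam"]
    show "1 + z \<le> \<kappa> * (z - lam)" unfolding \<kappa>_def distrib_right by simp
  qed
  then have "spectral_gap D A lam \<delta> \<kappa> \<beta>"
    using assms \<delta> by unfold_locales (auto simp: \<kappa>_def)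
  then show ?thesis by (rule that)
qed

section \<open>The linear problem with data at time 0 above the eigenvalue and at infinity up to
  it\<close>

context spectral_gap
begin

definition Low :: "real set" where "Low = {z. eigenvalue D A z \<and> z \<le> lam}"

definition decaying :: "real \<Rightarrow> (real \<Rightarrow> 'a) \<Rightarrow> bool" where
  "decaying C h \<longleftrightarrow> 0 \<le> C \<and> continuous_on {0..} h \<and> (\<forall>t\<ge>0. norm (h t) \<le> C * exp (- (\<beta> * t)))"

text \<open>The square collects \<kappa>/\<beta> from the energy estimate above \<open>lam\<close>
  and (1 + lam)/\<beta>^2 for each of the finitely many modes up to \<open>lam\<close>.\<close>

definition K :: real where "K = sqrt (\<kappa> / \<beta> + card Low * (1 + lam) / \<beta>\<^sup>2)"

lemma \<beta>_pos: "0 < \<beta>" using \<delta>_pos \<delta>_le by simp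

lemma finite_Low: "finite Low" unfolding Low_def by (rule finite_eigenvalues)

lemma K_nonneg: "0 \<le> K" using \<beta>_pos \<kappa>_nonneg lam_pos by (simp add: K_def)

lemma K_square: "K\<^sup>2 = \<kappa> / \<beta> + card Low * (1 + lam) / \<beta>\<^sup>2"
  unfolding K_def using \<beta>_pos \<kappa>_nonneg lam_pos by (intro real_sqrt_pow2) simp

lemma high: "z \<in> Lam n - Low \<Longrightarrow> 0 \<le> z \<and> 0 < z - lam \<and> \<delta> \<le> z - lam \<and> 1 + z \<le> \<kappa> * (z - lam)"
  using gap[of z] lam_pos by (auto simp: Lam_def Low_def)

text \<open>Since \<delta> \<le> \<beta>, the weight exp(\<delta> s) uses up at most half of the
  decay exp(-2 \<beta> s) of the square.\<close>

lemma decaying_integral_le: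
  assumes h: "decaying C h" and t: "t \<ge> 0"
  shows "integral {0..t} (\<lambda>s. exp (\<delta> * s) * (norm (h s))\<^sup>2) \<le> C\<^sup>2 / \<beta>"
proof -
  have ch: "continuous_on {0..t} h" using h by (auto simp: decaying_def intro: continuous_on_subset)
  have I: "((\<lambda>s. C\<^sup>2 * exp (- (\<beta> * s))) has_integral
      (- (C\<^sup>2 / \<beta>) * exp (- (\<beta> * t)) - - (C\<^sup>2 / \<beta>) * exp (- (\<beta> * 0)))) {0..t}"
    using \<beta>_pos
    by (intro fundamental_theorem_of_calculus t)
      (auto simp: has_real_derivative_iff_has_vector_derivative[symmetric] intro!: derivative_eq_intros)
  have "integral {0..t} (\<lambda>s. exp (\<delta> * s) * (norm (h s))\<^sup>2)
      \<le> - (C\<^sup>2 / \<beta>) * exp (- (\<beta> * t)) - - (C\<^sup>2 / \<beta>) * exp (- (\<beta> * 0))"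
  proof (rule has_integral_le[OF integrable_integral I])
    show "(\<lambda>s. exp (\<delta> * s) * (norm (h s))\<^sup>2) integrable_on {0..t}"
      by (intro integrable_continuous_real continuous_intros ch)
    fix s assume s: "s \<in> {0..t}"
    have "(norm (h s))\<^sup>2 \<le> (C * exp (- (\<beta> * s)))\<^sup>2"
      using h s by (intro power_mono) (auto simp: decaying_def)
    then have "exp (\<delta> * s) * (norm (h s))\<^sup>2 \<le> exp (\<beta> * s) * (C * exp (- (\<beta> * s)))\<^sup>2"
      using s \<delta>_le by (intro mult_mono) (auto intro: mult_right_mono)
    also have "\<dots> = C\<^sup>2 * exp (- (\<beta> * s))"
      by (simp add: power_mult_distrib power2_eq_square exp_minus)
    finally show "exp (\<delta> * s) * (norm (h s))\<^sup>2 \<le> C\<^sup>2 * exp (- (\<beta> * s))" .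
  qed
  also have "\<dots> \<le> C\<^sup>2 / \<beta>" using \<beta>_pos by simp
  finally show ?thesis .
qed

lemma norm_sqrt_P_le:
  assumes "decaying C h" "z \<in> Low" "t \<ge> 0"
  shows "norm (sqrt (1 + z) *\<^sub>R P z (h t)) \<le> sqrt (1 + lam) * C * exp (- (\<beta> * t))"
proof -
  have "0 \<le> z" "z \<le> lam" using assms(2) by (auto simp: Low_def eigenvalue_nonneg)
  moreover have "norm (P z (h t)) \<le> C * exp (- (\<beta> * t))"
    using norm_P_le[of z "h t"] assms by (auto simp: decaying_def intro: order_trans)
  ultimately have "sqrt (1 + z) * norm (P z (h t)) \<le> sqrt (1 + lam) * (C * exp (- (\<beta> * t)))"
    by (intro mult_mono) auto
  then show ?thesis using \<open>0 \<le> z\<close> by (simp add: mult.assoc)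
qed

text \<open>\<open>P z v\<close> vanishes unless z = lam, where the coefficient vanishes:
  \<open>v\<close> is a stationary solution.\<close>

lemma low_eigen:
  assumes v: "v \<in> eigenspace lam"
  shows "- (z - lam) *\<^sub>R (x - P z v) = - (z - lam) *\<^sub>R x"
    and "- (z - lam) *\<^sub>R (P z v + x) = - (z - lam) *\<^sub>R x"
  using P_eq_0[OF v, of z] by (cases "z = lam"; simp)+

text \<open>Up to \<open>lam\<close> the difference to \<open>v\<close> tends to zero and
  \<open>mode_decay\<close> applies; above \<open>lam\<close>, where \<open>v\<close> has no
  component, the weighted energy estimate starts from the data at time 0. The exponent is halved
  because the energy bounds the square of the norm. The lemma yields invariance of a ball and,
  applied to differences, the contraction.\<close>

lemma modes_bound:
  assumes Y: "modes lam h Y" and h: "decaying C h" and v: "v \<in> eigenspace lam"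
    and lim: "\<And>z. z \<le> lam \<Longrightarrow> ((\<lambda>t. P z (Y t)) \<longlongrightarrow> P z v) at_top"
    and W: "0 \<le> W" "\<And>n. (\<Sum>z\<in>Lam n - Low. (norm (P z (Y 0)))\<^sup>2) \<le> W\<^sup>2" and t: "t \<ge> 0"
  shows "norm (Y t - v) \<le> exp (- (\<delta> / 2 * t)) * (W + K * C)"
proof -
  have C: "0 \<le> C" and ch: "continuous_on {0..} h" using h by (auto simp: decaying_def)
  have deriv: "((\<lambda>t. P z (Y t)) has_vector_derivative
     - (z - lam) *\<^sub>R P z (Y t) + sqrt (1 + z) *\<^sub>R P z (h t)) (at t within {0..})" if "t \<ge> 0" for z t
    using Y that by (simp add: modes_def)
  have low: "(norm (P z (Y t - v)))\<^sup>2 \<le> (1 + lam) / \<beta>\<^sup>2 * C\<^sup>2 * exp (- (\<delta> * t))" if z: "z \<in> Low" for z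
  proof -
    have zl: "z \<le> lam" using z by (simp add: Low_def)
    have "norm (P z (Y t) - P z v) \<le> sqrt (1 + lam) * C / \<beta> * exp (- (\<beta> * t))"
    proof (rule mode_decay[where d="\<lambda>t. P z (Y t) - P z v" and a="z - lam" and g="\<lambda>t. sqrt (1 + z) *\<^sub>R P z (h t)"])
      show "((\<lambda>t. P z (Y t) - P z v) \<longlongrightarrow> 0) at_top" using lim[OF zl] by (simp add: LIM_zero)
    next
      fix s :: real assume s: "s \<ge> 0"
      show "((\<lambda>t. P z (Y t) - P z v) has_vector_derivative
          - (z - lam) *\<^sub>R (P z (Y s) - P z v) + sqrt (1 + z) *\<^sub>R P z (h s)) (at s within {0..})"
        unfolding low_eigen(1)[OF v]
        using has_vector_derivative_diff[OF deriv[OF s] has_vector_derivative_const, of z "P z v"] by simp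
      show "norm (sqrt (1 + z) *\<^sub>R P z (h s)) \<le> sqrt (1 + lam) * C * exp (- (\<beta> * s))"
        by (rule norm_sqrt_P_le[OF h z s])
    qed (use C lam_pos \<beta>_pos zl t in auto)
    then have "(norm (P z (Y t - v)))\<^sup>2 \<le> (sqrt (1 + lam) * C / \<beta> * exp (- (\<beta> * t)))\<^sup>2"
      unfolding P_diff by (rule power_mono) simp
    also have "\<dots> = (1 + lam) / \<beta>\<^sup>2 * C\<^sup>2 * exp (- (2 * \<beta> * t))"
      using lam_pos by (simp add: power_mult_distrib power_divide exp_double[symmetric])
    also have "\<dots> \<le> (1 + lam) / \<beta>\<^sup>2 * C\<^sup>2 * exp (- (\<delta> * t))"
      using lam_pos \<beta>_pos \<delta>_le t by (intro mult_left_mono) (auto intro!: mult_right_mono)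
    finally show ?thesis .
  qed
  have "(\<Sum>z\<in>Lam n. (norm (P z (Y t - v)))\<^sup>2) \<le> exp (- (\<delta> * t)) * (W\<^sup>2 + (K * C)\<^sup>2)" for n
  proof -
    have "(\<Sum>z\<in>Lam n \<inter> Low. (norm (P z (Y t - v)))\<^sup>2) \<le> (\<Sum>z\<in>Low. (norm (P z (Y t - v)))\<^sup>2)"
      by (rule sum_mono2[OF finite_Low]) auto
    also have "\<dots> \<le> (\<Sum>z\<in>Low. (1 + lam) / \<beta>\<^sup>2 * C\<^sup>2 * exp (- (\<delta> * t)))"
      by (rule sum_mono) (rule low)
    also have "\<dots> = exp (- (\<delta> * t)) * (card Low * (1 + lam) / \<beta>\<^sup>2 * C\<^sup>2)" by simp
    finally have l: "(\<Sum>z\<in>Lam n \<inter> Low. (norm (P z (Y t - v)))\<^sup>2) \<le> exp (- (\<delta> * t)) * (card Low * (1 + lam) / \<beta>\<^sup>2 * C\<^sup>2)" .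
    have "exp (\<delta> * t) * (\<Sum>z\<in>Lam n - Low. (norm (P z (Y t)))\<^sup>2) \<le> (\<Sum>z\<in>Lam n - Low. (norm (P z (Y 0)))\<^sup>2)
        + \<kappa> * integral {0..t} (\<lambda>s. exp (\<delta> * s) * (norm (h s))\<^sup>2)"
      by (rule energy_sum_norm[where \<theta>=lam]) (use deriv finite_Lam high ch t \<kappa>_nonneg in auto)
    also have "\<dots> \<le> W\<^sup>2 + \<kappa> * (C\<^sup>2 / \<beta>)"
      by (intro add_mono W mult_left_mono decaying_integral_le[OF h t] \<kappa>_nonneg)
    finally have "exp (- (\<delta> * t)) * (exp (\<delta> * t) * (\<Sum>z\<in>Lam n - Low. (norm (P z (Y t)))\<^sup>2))
        \<le> exp (- (\<delta> * t)) * (W\<^sup>2 + \<kappa> * (C\<^sup>2 / \<beta>))" by (rule mult_left_mono) simp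
    then have u: "(\<Sum>z\<in>Lam n - Low. (norm (P z (Y t)))\<^sup>2) \<le> exp (- (\<delta> * t)) * (W\<^sup>2 + \<kappa> * (C\<^sup>2 / \<beta>))"
      unfolding mult.assoc[symmetric] exp_add[symmetric] by simp
    have "P z (Y t - v) = P z (Y t)" if "z \<in> Lam n - Low" for z
      using high[OF that] P_eq_0[OF v, of z] by (simp add: P_diff)
    then have "(\<Sum>z\<in>Lam n - Low. (norm (P z (Y t - v)))\<^sup>2) = (\<Sum>z\<in>Lam n - Low. (norm (P z (Y t)))\<^sup>2)" by simp
    moreover have "(\<Sum>z\<in>Lam n. (norm (P z (Y t - v)))\<^sup>2) = (\<Sum>z\<in>Lam n \<inter> Low. (norm (P z (Y t - v)))\<^sup>2)
        + (\<Sum>z\<in>Lam n - Low. (norm (P z (Y t - v)))\<^sup>2)"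
      by (rule sum.Int_Diff[OF finite_Lam])
    ultimately show ?thesis using l u by (simp add: power_mult_distrib K_square algebra_simps)
  qed
  then have "(norm (Y t - v))\<^sup>2 \<le> exp (- (\<delta> * t)) * (W\<^sup>2 + (K * C)\<^sup>2)" by (rule norm_le_if_partial)
  also have "\<dots> \<le> exp (- (\<delta> * t)) * (W + K * C)\<^sup>2"
    using W(1) K_nonneg C by (intro mult_left_mono) (auto simp: power2_sum)
  also have "\<dots> = (exp (- (\<delta> / 2 * t)) * (W + K * C))\<^sup>2"
    by (simp add: power_mult_distrib exp_double[symmetric])
  finally show ?thesis by (rule power2_le_imp_le) (use W(1) K_nonneg C in simp)
qed

text \<open>Variation of constants. Projecting the antiderivative keeps the values in the eigenspace
  and does not change the forcing, which lies there already.\<close>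

lemma high_mode_exists:
  assumes h: "continuous_on {0..} h"
  shows "\<exists>y. (\<forall>t. y t \<in> eigenspace z) \<and> y 0 = P z w \<and>
    (\<forall>t\<ge>0. (y has_vector_derivative - (z - lam) *\<^sub>R y t + sqrt (1 + z) *\<^sub>R P z (h t)) (at t within {0..}))"
proof -
  define a where "a = z - lam"
  have "continuous_on {0..} (\<lambda>t. exp (a * t) *\<^sub>R (sqrt (1 + z) *\<^sub>R P z (h t)))"
    by (intro continuous_intros continuous_on_P h)
  then obtain G where G: "G 0 = 0"
    "\<And>t. t \<ge> 0 \<Longrightarrow> (G has_vector_derivative exp (a * t) *\<^sub>R (sqrt (1 + z) *\<^sub>R P z (h t))) (at t within {0..})"
    using antiderivative_exists by blast
  have PG: "((\<lambda>t. P z w + P z (G t)) has_vector_derivative exp (a * t) *\<^sub>R (sqrt (1 + z) *\<^sub>R P z (h t))) (at t within {0..})"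
    if "t \<ge> 0" for t
    using has_vector_derivative_add[OF has_vector_derivative_const bounded_linear.has_vector_derivative[OF bounded_linear_P G(2)[OF that]], of "P z w" z]
    by (simp add: P_scale P_P)
  show ?thesis
  proof (intro exI conjI allI impI)
    show "exp (- (a * t)) *\<^sub>R (P z w + P z (G t)) \<in> eigenspace z" for t
      by (intro subspace_scale[OF subspace_eigenspace] subspace_add[OF subspace_eigenspace] P_in)
    show "exp (- (a * 0)) *\<^sub>R (P z w + P z (G 0)) = P z w" by (simp add: G(1) P_0)
    show "((\<lambda>t. exp (- (a * t)) *\<^sub>R (P z w + P z (G t))) has_vector_derivative
        - (z - lam) *\<^sub>R (exp (- (a * t)) *\<^sub>R (P z w + P z (G t))) + sqrt (1 + z) *\<^sub>R P z (h t)) (at t within {0..})"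
      if "t \<ge> 0" for t
      using exp_unscaled_derivative[OF PG[OF that]] by (simp add: a_def)
  qed
qed

text \<open>Variation of constants with the constant fixed at infinity: the rescaled forcing is
  integrable, so its antiderivative has a limit \<open>L\<close>, and \<open>G t - L\<close>
  replaces the integral from 0. The growth of \<open>exp (- (a * t))\<close> is beaten because the
  tail decays at the faster rate \<beta> - a.\<close>

lemma low_mode_exists:
  assumes h: "decaying C h" and v: "v \<in> eigenspace lam" and z: "z \<in> Low"
  shows "\<exists>y. (\<forall>t. y t \<in> eigenspace z) \<and> (y \<longlongrightarrow> P z v) at_top \<and>
    (\<forall>t\<ge>0. (y has_vector_derivative - (z - lam) *\<^sub>R y t + sqrt (1 + z) *\<^sub>R P z (h t)) (at t within {0..}))"
proof -
  have C: "0 \<le> C" and ch: "continuous_on {0..} h" using h by (auto simp: decaying_def)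
  define a where "a = z - lam"
  have a: "a \<le> 0" using z by (simp add: a_def Low_def)
  let ?b = "sqrt (1 + lam) * C"
  define g where "g t = exp (a * t) *\<^sub>R (sqrt (1 + z) *\<^sub>R P z (h t))" for t
  have "continuous_on {0..} g"
    unfolding g_def by (intro continuous_intros continuous_on_P ch)
  then obtain G where G: "\<And>t. t \<ge> 0 \<Longrightarrow> (G has_vector_derivative g t) (at t within {0..})"
    using antiderivative_exists by blast
  have g_bound: "norm (g t) \<le> ?b * exp (- ((\<beta> - a) * t))" if "t \<ge> 0" for t
  proof -
    have "norm (g t) \<le> exp (a * t) * (?b * exp (- (\<beta> * t)))"
      using mult_left_mono[OF norm_sqrt_P_le[OF h z that], of "exp (a * t)"]
      by (simp only: g_def norm_scaleR abs_exp_cancel exp_ge_zero)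
    also have "\<dots> = ?b * (exp (a * t) * exp (- (\<beta> * t)))" by (rule mult.left_commute)
    also have "exp (a * t) * exp (- (\<beta> * t)) = exp (- ((\<beta> - a) * t))"
      unfolding exp_add[symmetric] by (rule arg_cong[of _ _ exp]) (simp add: algebra_simps)
    finally show ?thesis .
  qed
  have b0: "?b \<ge> 0" using C lam_pos by simp
  have ba: "\<beta> - a > 0" using a \<beta>_pos by simp
  have inc: "norm (G T - G t) \<le> ?b / (\<beta> - a) * exp (- ((\<beta> - a) * t))" if "0 \<le> t" "t \<le> T" for t T
    by (rule exp_bound_increment[OF G g_bound ba b0 that])
  have "Cauchy (\<lambda>n. G (real n))"
  proof (rule CauchyI')
    fix e :: real assume e: "e > 0"
    have "(\<lambda>n. ?b / (\<beta> - a) * exp (- ((\<beta> - a) * real n))) \<longlonglongrightarrow> ?b / (\<beta> - a) * 0"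
    proof (intro tendsto_mult_left filterlim_compose[OF exp_at_bot])
      show "LIM n sequentially. - ((\<beta> - a) * real n) :> at_bot"
        unfolding filterlim_uminus_at_bot
        using filterlim_tendsto_pos_mult_at_top[OF tendsto_const ba filterlim_real_sequentially] by simp
    qed
    then have "(\<lambda>n. ?b / (\<beta> - a) * exp (- ((\<beta> - a) * real n))) \<longlonglongrightarrow> 0" by simp
    from order_tendstoD(2)[OF this e]
    obtain N where N: "\<And>n. N \<le> n \<Longrightarrow> ?b / (\<beta> - a) * exp (- ((\<beta> - a) * real n)) < e"
      by (auto simp: eventually_sequentially)
    have "dist (G (real m)) (G (real n)) < e" if "N \<le> m" "m < n" for m n
      using inc[of "real m" "real n"] N[of m] that by (simp add: dist_norm norm_minus_commute)
    then show "\<exists>M. \<forall>m\<ge>M. \<forall>n>m. dist (G (real m)) (G (real n)) < e" by blast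
  qed
  then obtain L where L: "(\<lambda>n. G (real n)) \<longlonglongrightarrow> L" using Cauchy_convergent_iff convergent_def by blast
  have GL: "norm (L - G t) \<le> ?b / (\<beta> - a) * exp (- ((\<beta> - a) * t))" if t: "t \<ge> 0" for t
  proof (rule LIMSEQ_le_const2)
    show "(\<lambda>n. norm (G (real n) - G t)) \<longlonglongrightarrow> norm (L - G t)" by (intro tendsto_intros L)
    obtain N where "t \<le> real N" using real_arch_simple by blast
    then show "\<exists>N. \<forall>n\<ge>N. norm (G (real n) - G t) \<le> ?b / (\<beta> - a) * exp (- ((\<beta> - a) * t))"
      using inc[OF t] by (intro exI[of _ N]) (auto intro: order_trans)
  qed
  define y where "y t = P z v + exp (- (a * t)) *\<^sub>R P z (G t - L)" for t
  have "(y has_vector_derivative - (z - lam) *\<^sub>R y t + sqrt (1 + z) *\<^sub>R P z (h t)) (at t within {0..})" if t: "t \<ge> 0" for t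
  proof -
    have "((\<lambda>t. P z (G t - L)) has_vector_derivative P z (g t)) (at t within {0..})"
      by (rule bounded_linear.has_vector_derivative[OF bounded_linear_P])
        (use has_vector_derivative_diff[OF G[OF t] has_vector_derivative_const] in simp)
    then have "((\<lambda>t. P z (G t - L)) has_vector_derivative exp (a * t) *\<^sub>R (sqrt (1 + z) *\<^sub>R P z (h t))) (at t within {0..})"
      by (simp add: g_def P_scale P_P)
    from has_vector_derivative_add[OF has_vector_derivative_const exp_unscaled_derivative[OF this], of "P z v"]
    have "(y has_vector_derivative - a *\<^sub>R (exp (- (a * t)) *\<^sub>R P z (G t - L)) + sqrt (1 + z) *\<^sub>R P z (h t)) (at t within {0..})"
      by (simp add: y_def[abs_def])
    moreover have "- a *\<^sub>R (exp (- (a * t)) *\<^sub>R P z (G t - L)) = - (z - lam) *\<^sub>R y t"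
      unfolding y_def a_def low_eigen(2)[OF v] ..
    ultimately show ?thesis by (simp only:)
  qed
  moreover have "y t \<in> eigenspace z" for t unfolding y_def
    by (intro subspace_scale[OF subspace_eigenspace] subspace_add[OF subspace_eigenspace] P_in)
  moreover have "(y \<longlongrightarrow> P z v) at_top"
  proof -
    have "((\<lambda>t. exp (- (a * t)) *\<^sub>R P z (G t - L)) \<longlongrightarrow> 0) at_top"
    proof (rule Lim_null_comparison)
      show "\<forall>\<^sub>F t in at_top. norm (exp (- (a * t)) *\<^sub>R P z (G t - L)) \<le> ?b / (\<beta> - a) * exp (- (\<beta> * t))"
        using eventually_ge_at_top[of 0]
      proof eventually_elim
        fix t :: real assume t: "t \<ge> 0"
        have "norm (P z (G t - L)) \<le> ?b / (\<beta> - a) * exp (- ((\<beta> - a) * t))"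
          using norm_P_le[of z "G t - L"] GL[OF t] by (simp add: norm_minus_commute)
        then have "exp (- (a * t)) * norm (P z (G t - L)) \<le> exp (- (a * t)) * (?b / (\<beta> - a) * exp (- ((\<beta> - a) * t)))"
          by (rule mult_left_mono) simp
        also have "\<dots> = ?b / (\<beta> - a) * (exp (- (a * t)) * exp (- ((\<beta> - a) * t)))" by (rule mult.left_commute)
        also have "exp (- (a * t)) * exp (- ((\<beta> - a) * t)) = exp (- (\<beta> * t))"
          unfolding exp_add[symmetric] by (rule arg_cong[of _ _ exp]) (simp add: algebra_simps)
        finally show "norm (exp (- (a * t)) *\<^sub>R P z (G t - L)) \<le> ?b / (\<beta> - a) * exp (- (\<beta> * t))" by simp
      qed
      have "((\<lambda>t. ?b / (\<beta> - a) * exp (- (\<beta> * t))) \<longlongrightarrow> ?b / (\<beta> - a) * 0) at_top"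
      proof (intro tendsto_mult_left filterlim_compose[OF exp_at_bot])
        show "LIM t at_top. - (\<beta> * t) :> at_bot"
          unfolding filterlim_uminus_at_bot
          using filterlim_tendsto_pos_mult_at_top[OF tendsto_const \<beta>_pos filterlim_ident] by simp
      qed
      then show "((\<lambda>t. ?b / (\<beta> - a) * exp (- (\<beta> * t))) \<longlongrightarrow> 0) at_top" by simp
    qed
    from tendsto_add[OF tendsto_const this, of "P z v"] show ?thesis by (simp add: y_def[abs_def])
  qed
  ultimately show ?thesis by blast
qed

text \<open>The modes are solved separately, from infinity on \<open>Low\<close> and from time 0
  otherwise; the work is to assemble them into one continuous function.\<close>

lemma modes_exist:
  assumes h: "decaying C h" and v: "v \<in> eigenspace lam"
  obtains Y where "continuous_on {0..} Y" "modes lam h Y" "\<And>z. lam < z \<Longrightarrow> P z (Y 0) = P z w"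
    "\<And>z. z \<le> lam \<Longrightarrow> ((\<lambda>t. P z (Y t)) \<longlongrightarrow> P z v) at_top"
proof -
  have ch: "continuous_on {0..} h" using h by (auto simp: decaying_def)
  have "\<exists>y. (\<forall>t. y t \<in> eigenspace z) \<and> (z \<in> Low \<longrightarrow> (y \<longlongrightarrow> P z v) at_top) \<and> (z \<notin> Low \<longrightarrow> y 0 = P z w) \<and>
    (\<forall>t\<ge>0. (y has_vector_derivative - (z - lam) *\<^sub>R y t + sqrt (1 + z) *\<^sub>R P z (h t)) (at t within {0..}))" for z
    using high_mode_exists[OF ch, of z w] low_mode_exists[OF h v, of z] by (cases "z \<in> Low") auto
  then obtain y where y_in: "\<And>z t. y z t \<in> eigenspace z" and y_lim: "\<And>z. z \<in> Low \<Longrightarrow> (y z \<longlongrightarrow> P z v) at_top"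
    and y_0: "\<And>z. z \<notin> Low \<Longrightarrow> y z 0 = P z w"
    and y_deriv: "\<And>z t. t \<ge> 0 \<Longrightarrow> (y z has_vector_derivative
      - (z - lam) *\<^sub>R y z t + sqrt (1 + z) *\<^sub>R P z (h t)) (at t within {0..})" by metis
  \<comment> \<open>The finitely many low modes are bounded by their own sum, and the energy
    estimate bounds the others independently of \<open>n\<close>, as \<open>riesz_fischer\<close>
    requires.\<close>
  have bound: "(\<Sum>z\<in>Lam n. (norm (y z t))\<^sup>2) \<le> (\<Sum>z\<in>Low. (norm (y z t))\<^sup>2)
      + exp (- (\<delta> * t)) * ((norm w)\<^sup>2 + \<kappa> * integral {0..t} (\<lambda>s. exp (\<delta> * s) * (norm (h s))\<^sup>2))" if t: "t \<ge> 0" for n t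
  proof -
    have "exp (\<delta> * t) * (\<Sum>z\<in>Lam n - Low. (norm (y z t))\<^sup>2) \<le> (\<Sum>z\<in>Lam n - Low. (norm (y z 0))\<^sup>2)
        + \<kappa> * integral {0..t} (\<lambda>s. exp (\<delta> * s) * (norm (h s))\<^sup>2)"
      by (rule energy_sum_norm[where \<theta>=lam]) (use y_deriv finite_Lam high ch t \<kappa>_nonneg in auto)
    also have "(\<Sum>z\<in>Lam n - Low. (norm (y z 0))\<^sup>2) = (\<Sum>z\<in>Lam n - Low. (norm (P z w))\<^sup>2)"
      by (simp add: y_0)
    also have "\<dots> \<le> (norm w)\<^sup>2" using finite_Lam by (intro bessel) simp
    finally have "exp (- (\<delta> * t)) * (exp (\<delta> * t) * (\<Sum>z\<in>Lam n - Low. (norm (y z t))\<^sup>2))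
        \<le> exp (- (\<delta> * t)) * ((norm w)\<^sup>2 + \<kappa> * integral {0..t} (\<lambda>s. exp (\<delta> * s) * (norm (h s))\<^sup>2))"
      by (intro mult_left_mono) auto
    then have "(\<Sum>z\<in>Lam n - Low. (norm (y z t))\<^sup>2)
        \<le> exp (- (\<delta> * t)) * ((norm w)\<^sup>2 + \<kappa> * integral {0..t} (\<lambda>s. exp (\<delta> * s) * (norm (h s))\<^sup>2))"
      unfolding mult.assoc[symmetric] exp_add[symmetric] by simp
    moreover have "(\<Sum>z\<in>Lam n \<inter> Low. (norm (y z t))\<^sup>2) \<le> (\<Sum>z\<in>Low. (norm (y z t))\<^sup>2)"
      by (rule sum_mono2[OF finite_Low]) auto
    ultimately show ?thesis using sum.Int_Diff[OF finite_Lam, of "\<lambda>z. (norm (y z t))\<^sup>2" n Low] by linarith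
  qed
  have "\<exists>x. (\<lambda>n. \<Sum>z\<in>Lam n. y z t) \<longlonglongrightarrow> x \<and> (\<forall>z. P z x = y z t)" if "t \<ge> 0" for t
    using riesz_fischer[OF y_in bound[OF that]] by metis
  then obtain Y where Y_lim: "\<And>t. t \<ge> 0 \<Longrightarrow> (\<lambda>n. \<Sum>z\<in>Lam n. y z t) \<longlonglongrightarrow> Y t"
    and PY: "\<And>t z. t \<ge> 0 \<Longrightarrow> P z (Y t) = y z t" by metis
  have y_cont: "continuous_on {0..} (y z)" for z
    using y_deriv by (auto simp: continuous_on_eq_continuous_within intro: has_vector_derivative_continuous)
  \<comment> \<open>For n \<ge> lam only high modes remain, and the energy estimate bounds them by
    tails of \<open>w\<close> and \<open>h\<close> uniformly for t in [0, T]. Uniform convergence of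
    the partial sums then gives continuity of \<open>Y\<close>.\<close>
  have tail: "norm (Y t - (\<Sum>z\<in>Lam n. y z t)) \<le> sqrt ((norm (w - Q n w))\<^sup>2
      + \<kappa> * integral {0..T} (\<lambda>s. exp (\<delta> * s) * (norm (h s - Q n (h s)))\<^sup>2))"
    if t: "0 \<le> t" "t \<le> T" and n: "lam \<le> real n" for t T n
  proof -
    have chT: "continuous_on {0..S} h" for S by (rule continuous_on_subset[OF ch]) auto
    have cQ: "continuous_on {0..S} (\<lambda>s. Q n (h s))" for S
      by (rule bounded_linear.continuous_on[OF bounded_linear_Q chT])
    let ?I = "\<lambda>S. integral {0..S} (\<lambda>s. exp (\<delta> * s) * (norm (h s - Q n (h s)))\<^sup>2)"
    have "(norm (Y t - (\<Sum>z\<in>Lam n. y z t)))\<^sup>2 \<le> (norm (w - Q n w))\<^sup>2 + \<kappa> * ?I T"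
    proof (rule norm_le_if_partial)
      fix m
      let ?F = "Lam m - Lam n"
      have F: "z \<in> Lam m - Low" if "z \<in> ?F" for z using that n by (auto simp: Lam_def Low_def)
      have "P z (Y t - (\<Sum>z\<in>Lam n. y z t)) = (if z \<in> Lam n then 0 else y z t)" for z
      proof (cases "z \<in> Lam n")
        case True
        then show ?thesis using P_sum_eigen[of "\<lambda>z. y z t" z "Lam n"] y_in finite_Lam t by (simp add: P_diff PY)
      next
        case False
        have "P z (\<Sum>z\<in>Lam n. y z t) = 0" unfolding P_sum
          by (rule sum.neutral) (use False in \<open>auto intro!: P_eq_0[OF y_in]\<close>)
        then show ?thesis using False t by (simp add: P_diff PY)
      qed
      then have "(\<Sum>z\<in>Lam m. (norm (P z (Y t - (\<Sum>z\<in>Lam n. y z t))))\<^sup>2)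
          = (\<Sum>z\<in>Lam m. if z \<in> Lam n then 0 else (norm (y z t))\<^sup>2)"
        by (intro sum.cong) auto
      also have "\<dots> = (\<Sum>z\<in>?F. (norm (y z t))\<^sup>2)"
        by (rule sum.mono_neutral_cong_right) (auto simp: finite_Lam)
      also have "\<dots> \<le> exp (\<delta> * t) * (\<Sum>z\<in>?F. (norm (y z t))\<^sup>2)"
      proof -
        have "1 * (\<Sum>z\<in>?F. (norm (y z t))\<^sup>2) \<le> exp (\<delta> * t) * (\<Sum>z\<in>?F. (norm (y z t))\<^sup>2)"
          by (rule mult_right_mono) (use t \<delta>_pos in \<open>auto intro: sum_nonneg\<close>)
        then show ?thesis by simp
      qed
      also have "\<dots> \<le> (\<Sum>z\<in>?F. (norm (y z 0))\<^sup>2)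
          + \<kappa> * integral {0..t} (\<lambda>s. exp (\<delta> * s) * (\<Sum>z\<in>?F. (norm (P z (h s)))\<^sup>2))"
        by (rule energy_sum[where \<theta>=lam]) (use y_deriv finite_Lam high[OF F] ch t in auto)
      also have "(\<Sum>z\<in>?F. (norm (y z 0))\<^sup>2) = (\<Sum>z\<in>?F. (norm (P z w))\<^sup>2)"
        using F by (intro sum.cong refl) (simp add: y_0)
      also have "\<dots> \<le> (norm (w - Q n w))\<^sup>2" using finite_Lam by (intro tail_le) auto
      also have "integral {0..t} (\<lambda>s. exp (\<delta> * s) * (\<Sum>z\<in>?F. (norm (P z (h s)))\<^sup>2)) \<le> ?I t"
        using finite_Lam
        by (intro integral_le integrable_continuous_real continuous_intros continuous_on_P chT cQ mult_left_mono tail_le) auto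
      also have "?I t \<le> ?I T"
        using t by (intro integral_subset_le integrable_continuous_real continuous_intros chT cQ) auto
      finally show "(\<Sum>z\<in>Lam m. (norm (P z (Y t - (\<Sum>z\<in>Lam n. y z t))))\<^sup>2) \<le> (norm (w - Q n w))\<^sup>2 + \<kappa> * ?I T"
        using \<kappa>_nonneg by (simp add: mult_left_mono)
    qed
    then show ?thesis by (rule real_le_rsqrt)
  qed
  have cont: "continuous_on {0..T} Y" for T
  proof (rule uniform_limit_theorem)
    show "\<forall>\<^sub>F n in sequentially. continuous_on {0..T} (\<lambda>t. \<Sum>z\<in>Lam n. y z t)"
      by (intro always_eventually allI continuous_on_sum continuous_on_subset[OF y_cont]) auto
    let ?r = "\<lambda>n. sqrt ((norm (w - Q n w))\<^sup>2 + \<kappa> * integral {0..T} (\<lambda>s. exp (\<delta> * s) * (norm (h s - Q n (h s)))\<^sup>2))"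
    have "?r \<longlonglongrightarrow> sqrt ((norm (w - w))\<^sup>2 + \<kappa> * 0)"
      by (intro tendsto_intros Q_tendsto integral_tail_tendsto continuous_on_subset[OF ch]) auto
    then have r: "?r \<longlonglongrightarrow> 0" by simp
    show "uniform_limit {0..T} (\<lambda>n t. \<Sum>z\<in>Lam n. y z t) Y sequentially"
    proof (rule uniform_limitI)
      fix e :: real assume e: "e > 0"
      obtain N where N: "lam \<le> real N" using real_arch_simple by blast
      show "\<forall>\<^sub>F n in sequentially. \<forall>t\<in>{0..T}. dist (\<Sum>z\<in>Lam n. y z t) (Y t) < e"
        using order_tendstoD(2)[OF r e] eventually_ge_at_top[of N]
      proof eventually_elim
        fix n assume n: "?r n < e" "N \<le> n"
        have n_lam: "lam \<le> real n" using N n(2) by simp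
        show "\<forall>t\<in>{0..T}. dist (\<Sum>z\<in>Lam n. y z t) (Y t) < e"
        proof
          fix t assume "t \<in> {0..T}"
          then have "norm (Y t - (\<Sum>z\<in>Lam n. y z t)) < e"
            using tail[of t T n] n_lam n(1) by simp
          then show "dist (\<Sum>z\<in>Lam n. y z t) (Y t) < e" by (simp add: dist_norm norm_minus_commute)
        qed
      qed
    qed
  qed simp
  show ?thesis
  proof (rule that)
    show "continuous_on {0..} Y"
      unfolding continuous_on_eq_continuous_within
    proof
      fix t :: real assume t: "t \<in> {0..}"
      have "continuous (at t within {0..t + 1}) Y"
        using cont[of "t + 1"] t by (simp add: continuous_on_eq_continuous_within)
      moreover have "at t within {0..t + 1} = at t within {0..}"
        by (rule at_within_nhd[of t "{..<t + 1}"]) (use t in auto)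
      ultimately show "continuous (at t within {0..}) Y" by (simp add: continuous_within)
    qed
    show "modes lam h Y" unfolding modes_def
    proof (intro allI impI)
      fix z t :: real assume t: "0 \<le> t"
      show "((\<lambda>t. P z (Y t)) has_vector_derivative
          - (z - lam) *\<^sub>R P z (Y t) + sqrt (1 + z) *\<^sub>R P z (h t)) (at t within {0..})"
        using y_deriv[OF t, of z] unfolding PY[OF t]
        by (rule has_vector_derivative_transform[rotated 2]) (use t PY in auto)
    qed
    show "P z (Y 0) = P z w" if "lam < z" for z
      using y_0[of z] that by (simp add: PY Low_def)
    show "((\<lambda>t. P z (Y t)) \<longlongrightarrow> P z v) at_top" if "z \<le> lam" for z
    proof (cases "z \<in> Low")
      case True
      from y_lim[OF this] show ?thesis
        by (rule Lim_transform_eventually) (rule eventually_mono[OF eventually_ge_at_top[of 0]], simp add: PY)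
    next
      case False
      then have "\<not> eigenvalue D A z" using that by (simp add: Low_def)
      then show ?thesis by (simp add: P_not_eigenvalue)
    qed
  qed
qed

end

section \<open>The energy space and regularity\<close>

text \<open>The positive eigenvalue pins down the chosen resolution through
  \<open>resolves_diagonal\<close>, and with it A^(1/2).\<close>

locale discrete_positive = discrete_selfadjoint D A
  for D :: "'a::{real_inner,complete_space} set" and A :: "'a \<Rightarrow> 'a" +
  assumes positive_eigenvalue: "\<exists>lam>0. eigenvalue D A lam"
begin

lemma half_domain_eq: "half_domain D A = mult_dom sqrt"
  and half_power_eq: "x \<in> mult_dom sqrt \<Longrightarrow> half_power D A x = mult sqrt x"
  using positive_eigenvalue half_domain_power by blast+

lemma P_half_power: "u \<in> half_domain D A \<Longrightarrow> P z (half_power D A u) = sqrt z *\<^sub>R P z u"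
  by (simp add: half_domain_eq half_power_eq P_mult)

text \<open>The inverse of \<open>(1 + A)\<^sup>1\<^sup>/\<^sup>2\<close>: an isometry of \<open>H\<close> onto \<open>D(A\<^sup>1\<^sup>/\<^sup>2)\<close> with the half norm.\<close>
definition G :: "'a \<Rightarrow> 'a" where "G x = mult (\<lambda>z. 1 / sqrt (1 + z)) x"

lemma G_dom: "x \<in> mult_dom (\<lambda>z. 1 / sqrt (1 + z))"
proof (rule mult_dom_boundedI)
  fix n
  have "(\<Sum>z\<in>Lam n. (1 / sqrt (1 + z))\<^sup>2 * (norm (P z x))\<^sup>2) \<le> (\<Sum>z\<in>Lam n. (norm (P z x))\<^sup>2)"
  proof (rule sum_mono)
    fix z assume "z \<in> Lam n"
    then have "(1 / sqrt (1 + z))\<^sup>2 \<le> 1" using Lam_nonneg[of z n] by (simp add: power_divide)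
    then show "(1 / sqrt (1 + z))\<^sup>2 * (norm (P z x))\<^sup>2 \<le> (norm (P z x))\<^sup>2"
      by (rule mult_left_le_one_le[rotated 2]) simp_all
  qed
  also have "\<dots> \<le> (norm x)\<^sup>2" by (rule bessel[OF finite_Lam])
  finally show "(\<Sum>z\<in>Lam n. (1 / sqrt (1 + z))\<^sup>2 * (norm (P z x))\<^sup>2) \<le> (norm x)\<^sup>2" .
qed

lemma P_G: "P z (G x) = (1 / sqrt (1 + z)) *\<^sub>R P z x"
  unfolding G_def by (rule P_mult[OF G_dom])

lemma G_add: "G (x + y) = G x + G y"
  and G_diff: "G (x - y) = G x - G y"
  and G_scale: "G (c *\<^sub>R x) = c *\<^sub>R G x"
  by (rule P_ext; simp add: P_G P_add P_diff P_scale scaleR_add_right scaleR_diff_right)+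

lemma norm_sqrt_eigen: "z \<in> Lam n \<Longrightarrow> (sqrt z)\<^sup>2 = z" "z \<in> Lam n \<Longrightarrow> (1 / sqrt (1 + z))\<^sup>2 = 1 / (1 + z)"
  using Lam_nonneg[of z n] by (auto simp: power_divide)

lemma G_half_domain: "G x \<in> half_domain D A"
  unfolding half_domain_eq
proof (rule mult_dom_boundedI)
  fix n
  have "(\<Sum>z\<in>Lam n. (sqrt z)\<^sup>2 * (norm (P z (G x)))\<^sup>2) \<le> (\<Sum>z\<in>Lam n. (norm (P z x))\<^sup>2)"
  proof (rule sum_mono)
    fix z assume z: "z \<in> Lam n"
    have "z * (1 / (1 + z)) \<le> 1" using Lam_nonneg[OF z] by simp
    then have "z * (1 / (1 + z)) * (norm (P z x))\<^sup>2 \<le> 1 * (norm (P z x))\<^sup>2" by (rule mult_right_mono) simp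
    then show "(sqrt z)\<^sup>2 * (norm (P z (G x)))\<^sup>2 \<le> (norm (P z x))\<^sup>2"
      unfolding P_G norm_scaleR power_mult_distrib power2_abs norm_sqrt_eigen[OF z] by simp
  qed
  also have "\<dots> \<le> (norm x)\<^sup>2" by (rule bessel[OF finite_Lam])
  finally show "(\<Sum>z\<in>Lam n. (sqrt z)\<^sup>2 * (norm (P z (G x)))\<^sup>2) \<le> (norm x)\<^sup>2" .
qed

text \<open>In each mode 1/(1 + z) + z/(1 + z) = 1; Parseval sums this up.\<close>

lemma half_norm_G: "half_norm D A (G x) = norm x"
proof -
  let ?u = "G x" and ?v = "half_power D A (G x)"
  have "(\<lambda>n. (\<Sum>z\<in>Lam n. (norm (P z ?u))\<^sup>2) + (\<Sum>z\<in>Lam n. (norm (P z ?v))\<^sup>2)) \<longlonglongrightarrow> (norm ?u)\<^sup>2 + (norm ?v)\<^sup>2"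
    by (intro tendsto_add parseval_norm)
  moreover have "(\<Sum>z\<in>Lam n. (norm (P z ?u))\<^sup>2) + (\<Sum>z\<in>Lam n. (norm (P z ?v))\<^sup>2) = (\<Sum>z\<in>Lam n. (norm (P z x))\<^sup>2)" for n
    unfolding sum.distrib[symmetric]
  proof (rule sum.cong[OF refl])
    fix z assume z: "z \<in> Lam n"
    show "(norm (P z ?u))\<^sup>2 + (norm (P z ?v))\<^sup>2 = (norm (P z x))\<^sup>2"
      unfolding P_half_power[OF G_half_domain] P_G norm_scaleR power_mult_distrib power2_abs norm_sqrt_eigen[OF z]
    proof -
      have "1 / (1 + z) + z * (1 / (1 + z)) = 1"
        using Lam_nonneg[OF z] by (simp add: add_divide_distrib[symmetric])
      then show "1 / (1 + z) * (norm (P z x))\<^sup>2 + z * (1 / (1 + z) * (norm (P z x))\<^sup>2) = (norm (P z x))\<^sup>2"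
        unfolding mult.assoc[symmetric] distrib_right[symmetric] by simp
    qed
  qed
  ultimately have "(norm ?u)\<^sup>2 + (norm ?v)\<^sup>2 = (norm x)\<^sup>2"
    using parseval_norm[of x] by (simp add: LIMSEQ_unique)
  then show ?thesis by (simp add: half_norm_def)
qed

lemma norm_G_le: "norm (G x) \<le> norm x"
proof -
  have "norm (G x) \<le> half_norm D A (G x)" unfolding half_norm_def by (rule real_le_rsqrt) simp
  then show ?thesis by (simp add: half_norm_G)
qed

lemma bounded_linear_G: "bounded_linear G"
  by (rule bounded_linear_intro[where K=1]) (auto simp: G_add G_scale norm_G_le)

text \<open>The preimage is (1 + A)^(1/2) u, which exists because (1 + z) |P z u|^2 splits into two
  parts with bounded sums.\<close>

lemma half_domain_G:
  assumes "u \<in> half_domain D A" obtains x where "u = G x"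
proof -
  have u: "u \<in> mult_dom sqrt" using assms by (simp add: half_domain_eq)
  have dom: "u \<in> mult_dom (\<lambda>z. sqrt (1 + z))"
  proof (rule mult_dom_boundedI)
    fix n
    have "(\<Sum>z\<in>Lam n. (sqrt (1 + z))\<^sup>2 * (norm (P z u))\<^sup>2)
        = (\<Sum>z\<in>Lam n. (norm (P z u))\<^sup>2) + (\<Sum>z\<in>Lam n. (sqrt z)\<^sup>2 * (norm (P z u))\<^sup>2)"
      unfolding sum.distrib[symmetric] by (rule sum.cong) (auto simp: algebra_simps dest!: Lam_nonneg)
    also have "\<dots> \<le> (norm u)\<^sup>2 + (norm (mult sqrt u))\<^sup>2"
      by (intro add_mono bessel mult_bounded u finite_Lam)
    finally show "(\<Sum>z\<in>Lam n. (sqrt (1 + z))\<^sup>2 * (norm (P z u))\<^sup>2) \<le> (norm u)\<^sup>2 + (norm (mult sqrt u))\<^sup>2" .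
  qed
  have "u = G (mult (\<lambda>z. sqrt (1 + z)) u)"
  proof (rule P_ext)
    fix z
    show "P z u = P z (G (mult (\<lambda>z. sqrt (1 + z)) u))"
    proof (cases "eigenvalue D A z")
      case True
      then show ?thesis using eigenvalue_nonneg[OF True] by (simp add: P_G P_mult[OF dom])
    qed (simp add: P_not_eigenvalue)
  qed
  then show ?thesis by (rule that)
qed

lemma half_ball_G: "G x \<in> half_ball D A R \<longleftrightarrow> norm x < R"
  by (simp add: half_ball_def G_half_domain half_norm_G)

text \<open>A bounded substitute for \<open>A\<close>: continuous along continuous curves, with norm
  increasing in \<open>n\<close>, and convergent to \<open>A u\<close> for \<open>u\<close> in
  \<open>D\<close>.\<close>

definition truncA :: "nat \<Rightarrow> 'a \<Rightarrow> 'a" where "truncA n u = (\<Sum>z\<in>Lam n. z *\<^sub>R P z u)"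

lemma truncA_eq_Q: "u \<in> D \<Longrightarrow> truncA n u = Q n (A u)"
  by (simp add: truncA_def Q_def P_A)

lemma bounded_linear_truncA: "bounded_linear (truncA n)"
  unfolding truncA_def[abs_def]
  by (intro bounded_linear_sum bounded_linear_const_scaleR bounded_linear_P)

lemma norm_truncA: "(norm (truncA n u))\<^sup>2 = (\<Sum>z\<in>Lam n. z\<^sup>2 * (norm (P z u))\<^sup>2)"
  unfolding truncA_def
  by (subst norm_sum_eigen[OF finite_Lam])
    (auto simp: power_mult_distrib intro: subspace_scale[OF subspace_eigenspace] P_in)

lemma incseq_norm_truncA: "incseq (\<lambda>n. (norm (truncA n u))\<^sup>2)"
  unfolding norm_truncA by (intro monoI sum_mono2 finite_Lam Lam_mono) auto

text \<open>The assumption on modes says that \<open>u = G x\<close> solves \<open>u' + A u = g\<close>.\<close>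
context
  fixes x g :: "real \<Rightarrow> 'a"
  assumes x: "continuous_on {0..} x" and g: "continuous_on {0..} g" and modes: "modes 0 g x"
begin

lemma cont_x: "continuous_on {0..T} x" by (rule continuous_on_subset[OF x]) auto

lemma cont_g: "continuous_on {0..T} g" by (rule continuous_on_subset[OF g]) auto

lemma cont_G: "continuous_on {0..T} (\<lambda>t. G (x t))"
  by (rule bounded_linear.continuous_on[OF bounded_linear_G cont_x])

lemma cont_truncA: "continuous_on {0..T} (\<lambda>t. truncA n (G (x t)))"
  by (rule bounded_linear.continuous_on[OF bounded_linear_truncA cont_G])

lemma G_modes:
  assumes t: "t \<ge> 0"
  shows "((\<lambda>t. P z (G (x t))) has_vector_derivative - z *\<^sub>R P z (G (x t)) + P z (g t)) (at t within {0..})"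
proof (cases "eigenvalue D A z")
  case True
  then have z: "0 \<le> z" by (rule eigenvalue_nonneg)
  have "((\<lambda>t. P z (x t)) has_vector_derivative - z *\<^sub>R P z (x t) + sqrt (1 + z) *\<^sub>R P z (g t)) (at t within {0..})"
    using modes t unfolding modes_def by simp
  from bounded_linear.has_vector_derivative[OF bounded_linear_scaleR_right this, of "1 / sqrt (1 + z)"]
  show ?thesis using z by (simp add: P_G scaleR_add_right scaleR_diff_right mult.commute)
qed (simp add: P_not_eigenvalue)

text \<open>Multiplying each mode equation by \<open>z\<close> times the mode controls z^2 |u|^2 by
  the forcing and the initial energy z |u(0)|^2, which is at most |P z (x 0)|^2. The bound does not
  depend on \<open>n\<close>; it is the maximal regularity that puts the solution in L^2 with values
  in the domain of \<open>A\<close>.\<close>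

lemma truncA_energy:
  assumes T: "T \<ge> 0"
  shows "integral {0..T} (\<lambda>t. (norm (truncA n (G (x t))))\<^sup>2) \<le> (norm (x 0))\<^sup>2 + integral {0..T} (\<lambda>t. (norm (g t))\<^sup>2)"
proof -
  let ?u = "\<lambda>z t. P z (G (x t))"
  have cu: "continuous_on {0..T} (?u z)" for z by (intro continuous_on_P cont_G)
  have cgz: "continuous_on {0..T} (\<lambda>t. P z (g t))" for z by (intro continuous_on_P cont_g)
  have mode: "integral {0..T} (\<lambda>t. z\<^sup>2 * (norm (?u z t))\<^sup>2) \<le> (norm (P z (x 0)))\<^sup>2 + integral {0..T} (\<lambda>t. (norm (P z (g t)))\<^sup>2)"
    if z: "z \<in> Lam n" for z
  proof -
    have z0: "0 \<le> z" by (rule Lam_nonneg[OF z])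
    let ?q = "\<lambda>t. z\<^sup>2 * (norm (?u z t))\<^sup>2 - (norm (P z (g t)))\<^sup>2"
    define F where "F t = z * (norm (?u z t))\<^sup>2 + integral {0..t} ?q" for t
    define F' where "F' t = z * (2 * (?u z t \<bullet> (- z *\<^sub>R ?u z t + P z (g t)))) + ?q t" for t
    have cq: "continuous_on {0..T} ?q" by (intro continuous_intros cu cgz)
    have "F T \<le> F 0"
    proof (rule nonincreasing_if_deriv_nonpos[OF _ _ T])
      fix s :: real assume s: "0 \<le> s" "s \<le> T"
      have "((\<lambda>t. P z (G (x t))) has_vector_derivative - z *\<^sub>R ?u z s + P z (g s)) (at s within {0..T})"
        by (rule has_vector_derivative_within_subset[OF G_modes[OF s(1)]]) auto
      then show "(F has_real_derivative F' s) (at s within {0..T})"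
        unfolding F_def F'_def using s
        by (intro DERIV_add DERIV_cmult has_real_derivative_norm_square integral_has_real_derivative[OF cq]) auto
      have "2 * z * (?u z s \<bullet> P z (g s)) \<le> z\<^sup>2 * (norm (?u z s))\<^sup>2 + (norm (P z (g s)))\<^sup>2"
      proof -
        have "0 \<le> (norm (z *\<^sub>R ?u z s - P z (g s)))\<^sup>2" by simp
        also have "\<dots> = z\<^sup>2 * (norm (?u z s))\<^sup>2 - 2 * z * (?u z s \<bullet> P z (g s)) + (norm (P z (g s)))\<^sup>2"
          by (simp add: power2_norm_eq_inner inner_simps inner_commute power2_eq_square[of z])
        finally show ?thesis by simp
      qed
      then show "F' s \<le> 0"
        by (simp add: F'_def inner_simps power2_norm_eq_inner[symmetric] power2_eq_square[of z] algebra_simps)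
    qed
    then have "integral {0..T} ?q \<le> z * (norm (?u z 0))\<^sup>2"
      using mult_nonneg_nonneg[OF z0 zero_le_power2[of "norm (?u z T)"]] by (simp add: F_def)
    also have "z * (norm (?u z 0))\<^sup>2 \<le> (norm (P z (x 0)))\<^sup>2"
    proof -
      have "z * (1 / (1 + z)) * (norm (P z (x 0)))\<^sup>2 \<le> 1 * (norm (P z (x 0)))\<^sup>2"
        using z0 by (intro mult_right_mono) auto
      then show ?thesis
        unfolding P_G norm_scaleR power_mult_distrib power2_abs norm_sqrt_eigen[OF z] by simp
    qed
    finally show ?thesis
      by (subst (asm) integral_diff) (auto intro!: integrable_continuous_real continuous_intros cu cgz)
  qed
  have "integral {0..T} (\<lambda>t. (norm (truncA n (G (x t))))\<^sup>2) = (\<Sum>z\<in>Lam n. integral {0..T} (\<lambda>t. z\<^sup>2 * (norm (?u z t))\<^sup>2))"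
    unfolding norm_truncA
    by (rule integral_sum[OF finite_Lam], rule integrable_continuous_real, intro continuous_intros cu)
  also have "\<dots> \<le> (\<Sum>z\<in>Lam n. (norm (P z (x 0)))\<^sup>2 + integral {0..T} (\<lambda>t. (norm (P z (g t)))\<^sup>2))"
    by (rule sum_mono) (rule mode)
  also have "\<dots> = (\<Sum>z\<in>Lam n. (norm (P z (x 0)))\<^sup>2) + integral {0..T} (\<lambda>t. \<Sum>z\<in>Lam n. (norm (P z (g t)))\<^sup>2)"
    unfolding sum.distrib
    by (subst integral_sum[OF finite_Lam]) (auto intro!: integrable_continuous_real continuous_intros cgz)
  also have "\<dots> \<le> (norm (x 0))\<^sup>2 + integral {0..T} (\<lambda>t. (norm (g t))\<^sup>2)"
    by (intro add_mono bessel finite_Lam integral_le integrable_continuous_real continuous_intros cgz cont_g)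
  finally show ?thesis .
qed

section \<open>Regularity on a bounded time interval\<close>

context
  fixes T :: real assumes T: "T > 0"
begin

abbreviation M where "M \<equiv> lebesgue_on {0<..<T}"

lemma nn_integral_SUP_truncA:
  "(\<integral>\<^sup>+ t. (SUP n. ennreal ((norm (truncA n (G (x t))))\<^sup>2)) \<partial>M) < \<infinity>"
proof -
  have "(\<integral>\<^sup>+ t. (SUP n. ennreal ((norm (truncA n (G (x t))))\<^sup>2)) \<partial>M)
      = (SUP n. \<integral>\<^sup>+ t. ennreal ((norm (truncA n (G (x t))))\<^sup>2) \<partial>M)"
  proof (rule nn_integral_monotone_convergence_SUP)
    show "incseq (\<lambda>n t. ennreal ((norm (truncA n (G (x t))))\<^sup>2))"
      using incseq_norm_truncA by (auto simp: mono_def le_fun_def intro!: ennreal_leI)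
    have "continuous_on {0<..<T} (\<lambda>t. (norm (truncA n (G (x t))))\<^sup>2)" for n
      by (intro continuous_intros continuous_on_subset[OF cont_truncA[of T]]) auto
    then show "(\<lambda>t. ennreal ((norm (truncA n (G (x t))))\<^sup>2)) \<in> borel_measurable M" for n
      by (intro measurable_compose[OF continuous_imp_measurable_on_sets_lebesgue measurable_ennreal]) auto
  qed
  also have "\<dots> \<le> ennreal ((norm (x 0))\<^sup>2 + integral {0..T} (\<lambda>t. (norm (g t))\<^sup>2))"
  proof (rule SUP_least)
    fix n
    have "(\<integral>\<^sup>+ t. ennreal ((norm (truncA n (G (x t))))\<^sup>2) \<partial>M) = ennreal (integral {0..T} (\<lambda>t. (norm (truncA n (G (x t))))\<^sup>2))"
      by (rule nn_integral_lebesgue_on_interval) (intro continuous_intros cont_truncA, simp)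
    also have "\<dots> \<le> ennreal ((norm (x 0))\<^sup>2 + integral {0..T} (\<lambda>t. (norm (g t))\<^sup>2))"
      using T by (intro ennreal_leI truncA_energy) simp
    finally show "(\<integral>\<^sup>+ t. ennreal ((norm (truncA n (G (x t))))\<^sup>2) \<partial>M) \<le> \<dots>" .
  qed
  also have "\<dots> < \<infinity>" by simp
  finally show ?thesis .
qed

text \<open>The supremum of the truncated energies is integrable, hence finite almost everywhere,
  and finiteness at \<open>t\<close> is membership in the multiplier domain that equals
  \<open>D\<close>.\<close>

lemma AE_domain: "AE t in M. G (x t) \<in> D"
proof -
  have "continuous_on {0<..<T} (\<lambda>t. (norm (truncA n (G (x t))))\<^sup>2)" for n
    by (intro continuous_intros continuous_on_subset[OF cont_truncA[of T]]) auto
  then have "(\<lambda>t. SUP n. ennreal ((norm (truncA n (G (x t))))\<^sup>2)) \<in> borel_measurable M"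
    by (intro borel_measurable_SUP measurable_compose[OF continuous_imp_measurable_on_sets_lebesgue measurable_ennreal]) auto
  then have "AE t in M. (SUP n. ennreal ((norm (truncA n (G (x t))))\<^sup>2)) \<noteq> \<infinity>"
    using nn_integral_SUP_truncA by (intro nn_integral_PInf_AE) auto
  then show ?thesis
  proof eventually_elim
    fix t assume fin: "(SUP n. ennreal ((norm (truncA n (G (x t))))\<^sup>2)) \<noteq> \<infinity>"
    define c where "c = (SUP n. ennreal ((norm (truncA n (G (x t))))\<^sup>2))"
    have "G (x t) \<in> mult_dom (\<lambda>z. z)"
    proof (rule mult_dom_boundedI)
      fix n
      have "ennreal ((norm (truncA n (G (x t))))\<^sup>2) \<le> c" unfolding c_def by (rule SUP_upper) simp
      also have "c \<noteq> top" using fin unfolding c_def infinity_ennreal_def .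
      then have "c = ennreal (enn2real c)" by (simp add: ennreal_enn2real_if)
      finally have "(norm (truncA n (G (x t))))\<^sup>2 \<le> enn2real c" by (simp add: enn2real_nonneg)
      then show "(\<Sum>z\<in>Lam n. z\<^sup>2 * (norm (P z (G (x t))))\<^sup>2) \<le> enn2real c" by (simp only: norm_truncA)
    qed
    then show "G (x t) \<in> D" using D_eq_mult_dom by blast
  qed
qed

lemma AE_truncA_tendsto: "AE t in M. (\<lambda>n. truncA n (G (x t))) \<longlonglongrightarrow> A (G (x t))"
  using AE_domain by (rule eventually_mono) (simp add: truncA_eq_Q Q_tendsto)

lemma AE_SUP_truncA: "AE t in M. ennreal ((norm (A (G (x t))))\<^sup>2) = (SUP n. ennreal ((norm (truncA n (G (x t))))\<^sup>2))"
  using AE_truncA_tendsto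
proof (rule eventually_mono)
  fix t assume "(\<lambda>n. truncA n (G (x t))) \<longlonglongrightarrow> A (G (x t))"
  then have "(\<lambda>n. ennreal ((norm (truncA n (G (x t))))\<^sup>2)) \<longlonglongrightarrow> ennreal ((norm (A (G (x t))))\<^sup>2)"
    by (intro tendsto_ennrealI tendsto_intros)
  moreover have "(\<lambda>n. ennreal ((norm (truncA n (G (x t))))\<^sup>2)) \<longlonglongrightarrow> (SUP n. ennreal ((norm (truncA n (G (x t))))\<^sup>2))"
    using incseq_norm_truncA by (intro LIMSEQ_SUP) (auto simp: mono_def intro!: ennreal_leI)
  ultimately show "ennreal ((norm (A (G (x t))))\<^sup>2) = (SUP n. ennreal ((norm (truncA n (G (x t))))\<^sup>2))"
    by (rule LIMSEQ_unique)
qed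

lemma nn_integral_A: "(\<integral>\<^sup>+ t. ennreal ((norm (A (G (x t))))\<^sup>2) \<partial>M) < \<infinity>"
  using nn_integral_SUP_truncA nn_integral_cong_AE[OF AE_SUP_truncA] by simp

lemma strongly_measurable_A: "strongly_measurable M (\<lambda>t. A (G (x t)))"
  by (rule strongly_measurable_limit[OF cont_truncA T AE_truncA_tendsto])

lemma A_measurable: "(\<lambda>t. ennreal ((norm (A (G (x t))))\<^sup>2)) \<in> borel_measurable M"
  by (intro measurable_compose[OF _ measurable_ennreal]
      strongly_measurable_compose_measurable[OF _ strongly_measurable_A] continuous_intros) simp_all

text \<open>The factor 2 leaves room for |g - A u|^2 \<le> 2 |g|^2 + 2 |A u|^2, so that the lemma
  serves the solution, its graph pair and its time derivative alike.\<close>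

lemma bochner_L2_bound:
  fixes w :: "real \<Rightarrow> 'b::real_normed_vector"
  assumes "strongly_measurable M w" and k: "continuous_on {0..T} k" "\<And>t. 0 \<le> k t"
    and le: "\<And>t. (norm (w t))\<^sup>2 \<le> k t + 2 * (norm (A (G (x t))))\<^sup>2"
  shows "bochner_L2 M w"
proof -
  have km: "(\<lambda>t. ennreal (k t)) \<in> borel_measurable M"
    by (intro measurable_compose[OF continuous_imp_measurable_on_sets_lebesgue measurable_ennreal]
        continuous_on_subset[OF k(1)]) auto
  have "(\<integral>\<^sup>+ t. ennreal ((norm (w t))\<^sup>2) \<partial>M) \<le> (\<integral>\<^sup>+ t. ennreal (k t) + 2 * ennreal ((norm (A (G (x t))))\<^sup>2) \<partial>M)"
  proof (rule nn_integral_mono)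
    fix t
    have "ennreal ((norm (w t))\<^sup>2) \<le> ennreal (k t + 2 * (norm (A (G (x t))))\<^sup>2)" by (rule ennreal_leI[OF le])
    also have "\<dots> = ennreal (k t) + 2 * ennreal ((norm (A (G (x t))))\<^sup>2)"
      using k(2) by (simp add: ennreal_mult)
    finally show "ennreal ((norm (w t))\<^sup>2) \<le> \<dots>" .
  qed
  also have "\<dots> = (\<integral>\<^sup>+ t. ennreal (k t) \<partial>M) + 2 * (\<integral>\<^sup>+ t. ennreal ((norm (A (G (x t))))\<^sup>2) \<partial>M)"
    using km A_measurable by (simp add: nn_integral_add nn_integral_cmult)
  also have "\<dots> < \<infinity>"
    using nn_integral_A nn_integral_lebesgue_on_interval[OF k(1) k(2)] by (simp add: ennreal_mult_less_top)
  finally show ?thesis using assms(1) by (simp add: bochner_L2_def)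
qed

lemma L2_domain_solution: "L2_domain D A T (\<lambda>t. G (x t))"
  unfolding L2_domain_def
proof
  show "AE t in M. G (x t) \<in> D" by (rule AE_domain)
  show "bochner_L2 M (\<lambda>t. (G (x t), A (G (x t))))"
  proof (rule bochner_L2_bound)
    show "strongly_measurable M (\<lambda>t. (G (x t), A (G (x t))))"
    proof (rule strongly_measurable_limit[OF _ T])
      show "continuous_on {0..T} (\<lambda>t. (G (x t), truncA n (G (x t))))" for n
        by (intro continuous_intros cont_G cont_truncA)
      show "AE t in M. (\<lambda>n. (G (x t), truncA n (G (x t)))) \<longlonglongrightarrow> (G (x t), A (G (x t)))"
        using AE_truncA_tendsto by (rule eventually_mono) (rule tendsto_Pair[OF tendsto_const])
    qed
    show "continuous_on {0..T} (\<lambda>t. (norm (G (x t)))\<^sup>2)" by (intro continuous_intros cont_G)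
    show "(norm (G (x t), A (G (x t))))\<^sup>2 \<le> (norm (G (x t)))\<^sup>2 + 2 * (norm (A (G (x t))))\<^sup>2" for t
      by (simp add: norm_Pair)
  qed simp
qed

text \<open>The truncation errors are dominated by a multiple of 1 + |A u|^2, which is integrable on
  the bounded interval, so dominated convergence gives the mean convergence that
  \<open>has_bochner_limit\<close> asks for.\<close>

lemma has_bochner_test:
  assumes \<phi>: "continuous_on {0..T} \<phi>"
  shows "\<exists>I. has_bochner M (\<lambda>t. \<phi> t *\<^sub>R (g t - A (G (x t)))) I"
proof (rule has_bochner_limit[OF _ T])
  let ?h = "\<lambda>n t. \<phi> t *\<^sub>R (g t - truncA n (G (x t)))"
  show ch: "continuous_on {0..T} (?h n)" for n by (intro continuous_intros \<phi> cont_g cont_truncA)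
  show AE: "AE t in M. (\<lambda>n. ?h n t) \<longlonglongrightarrow> \<phi> t *\<^sub>R (g t - A (G (x t)))"
    using AE_truncA_tendsto by (rule eventually_mono) (rule tendsto_scaleR[OF tendsto_const tendsto_diff[OF tendsto_const]])
  have "bounded (\<phi> ` {0..T})" using \<phi> by (intro compact_imp_bounded compact_continuous_image) auto
  then obtain B where B: "B > 0" "\<And>t. t \<in> {0..T} \<Longrightarrow> \<bar>\<phi> t\<bar> \<le> B" by (auto simp: bounded_pos)
  have sm: "strongly_measurable M (\<lambda>t. \<phi> t *\<^sub>R (g t - A (G (x t))) - ?h n t)" for n
  proof (rule strongly_measurable_limit[OF _ T])
    show "continuous_on {0..T} (\<lambda>t. ?h m t - ?h n t)" for m by (intro continuous_intros ch)
    show "AE t in M. (\<lambda>m. ?h m t - ?h n t) \<longlonglongrightarrow> \<phi> t *\<^sub>R (g t - A (G (x t))) - ?h n t"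
      using AE by (rule eventually_mono) (rule tendsto_diff[OF _ tendsto_const])
  qed
  have "(\<lambda>n. \<integral>\<^sup>+ t. ennreal (norm (\<phi> t *\<^sub>R (g t - A (G (x t))) - ?h n t)) \<partial>M) \<longlonglongrightarrow> (\<integral>\<^sup>+ t. 0 \<partial>M)"
  proof (rule nn_integral_dominated_convergence[where w="\<lambda>t. ennreal B * (1 + ennreal ((norm (A (G (x t))))\<^sup>2))"])
    show "(\<lambda>t. ennreal (norm (\<phi> t *\<^sub>R (g t - A (G (x t))) - ?h n t))) \<in> borel_measurable M" for n
      by (intro measurable_compose[OF _ measurable_ennreal]
        strongly_measurable_compose_measurable[OF lebesgue_on_interval_set sm] continuous_intros)
    show "(\<lambda>t. ennreal B * (1 + ennreal ((norm (A (G (x t))))\<^sup>2))) \<in> borel_measurable M"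
      using A_measurable by simp
    have "(\<integral>\<^sup>+ t. ennreal B * (1 + ennreal ((norm (A (G (x t))))\<^sup>2)) \<partial>M)
        = ennreal B * (ennreal T + (\<integral>\<^sup>+ t. ennreal ((norm (A (G (x t))))\<^sup>2) \<partial>M))"
      using A_measurable emeasure_lebesgue_on_interval[of T] T
      by (simp add: nn_integral_cmult nn_integral_add)
    also have "\<dots> < \<infinity>" using nn_integral_A by (simp add: ennreal_mult_less_top)
    finally show "(\<integral>\<^sup>+ t. ennreal B * (1 + ennreal ((norm (A (G (x t))))\<^sup>2)) \<partial>M) < \<infinity>" .
    have inT: "AE t in M. t \<in> {0..T}" by (rule AE_I2) simp
    show "AE t in M. ennreal (norm (\<phi> t *\<^sub>R (g t - A (G (x t))) - ?h n t)) \<le> ennreal B * (1 + ennreal ((norm (A (G (x t))))\<^sup>2))" for n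
      using AE_domain inT
    proof eventually_elim
      fix t assume t: "G (x t) \<in> D" "t \<in> {0..T}"
      let ?a = "A (G (x t))"
      have "\<phi> t *\<^sub>R (g t - ?a) - ?h n t = - \<phi> t *\<^sub>R (?a - Q n ?a)"
        by (simp add: truncA_eq_Q[OF t(1)] algebra_simps)
      then have "norm (\<phi> t *\<^sub>R (g t - ?a) - ?h n t) = \<bar>\<phi> t\<bar> * norm (?a - Q n ?a)" by simp
      also have "\<dots> \<le> B * norm ?a" using B(1) by (intro mult_mono B(2) t norm_diff_Q_le) auto
      also have "norm ?a \<le> 1 + (norm ?a)\<^sup>2"
        using zero_le_power2[of "norm ?a - 1/2"] by (simp add: power2_diff power_divide)
      finally have "norm (\<phi> t *\<^sub>R (g t - ?a) - ?h n t) \<le> B * (1 + (norm ?a)\<^sup>2)" using B(1) by simp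
      then have "ennreal (norm (\<phi> t *\<^sub>R (g t - ?a) - ?h n t)) \<le> ennreal (B * (1 + (norm ?a)\<^sup>2))" by (rule ennreal_leI)
      also have "\<dots> = ennreal B * (1 + ennreal ((norm ?a)\<^sup>2))" using B(1) by (simp add: ennreal_mult)
      finally show "ennreal (norm (\<phi> t *\<^sub>R (g t - ?a) - ?h n t)) \<le> ennreal B * (1 + ennreal ((norm ?a)\<^sup>2))" .
    qed
    show "AE t in M. (\<lambda>n. ennreal (norm (\<phi> t *\<^sub>R (g t - A (G (x t))) - ?h n t))) \<longlonglongrightarrow> 0"
      using AE
    proof (rule eventually_mono)
      fix t assume "(\<lambda>n. ?h n t) \<longlonglongrightarrow> \<phi> t *\<^sub>R (g t - A (G (x t)))"
      from tendsto_norm[OF tendsto_diff[OF tendsto_const[of "\<phi> t *\<^sub>R (g t - A (G (x t)))"] this]]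
      have "(\<lambda>n. norm (\<phi> t *\<^sub>R (g t - A (G (x t))) - ?h n t)) \<longlonglongrightarrow> 0" by simp
      from tendsto_ennrealI[OF this] show "(\<lambda>n. ennreal (norm (\<phi> t *\<^sub>R (g t - A (G (x t))) - ?h n t))) \<longlonglongrightarrow> 0" by simp
    qed
  qed simp
  then show "(\<lambda>n. \<integral>\<^sup>+ t. ennreal (norm (\<phi> t *\<^sub>R (g t - A (G (x t))) - ?h n t)) \<partial>M) \<longlonglongrightarrow> 0" by simp
qed

end

end

end

section \<open>Absolute continuity of the energy, the weak derivative, and the solution
  property\<close>

lemma sum_integral_disjoint_le:
  fixes q :: "real \<Rightarrow> real" and n :: nat
  assumes q: "continuous_on {0..T} q" "\<And>t. t \<in> {0..T} \<Longrightarrow> 0 \<le> q t"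
    and xy: "\<And>i. i < n \<Longrightarrow> 0 \<le> x i \<and> x i \<le> y i \<and> y i \<le> T"
    and disj: "\<And>i j. i < n \<Longrightarrow> j < n \<Longrightarrow> i \<noteq> j \<Longrightarrow> {x i<..<y i} \<inter> {x j<..<y j} = {}"
  shows "(\<Sum>i<n. integral {x i..y i} q) \<le> integral {0..T} q"
proof -
  let ?r = "\<lambda>i t. if t \<in> {x i<..<y i} then q t else 0"
  have r: "(?r i has_integral integral {x i..y i} q) {0..T}" if i: "i < n" for i
  proof -
    have "q integrable_on {x i..y i}"
      using xy[OF i] by (intro integrable_continuous_real continuous_on_subset[OF q(1)]) auto
    then have "(q has_integral integral {x i..y i} q) {x i<..<y i}"
      using has_integral_open_interval[of q _ "x i" "y i"] by (simp add: box_real integrable_integral)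
    then show ?thesis
      using xy[OF i] by (subst has_integral_restrict) auto
  qed
  have "((\<lambda>t. \<Sum>i<n. ?r i t) has_integral (\<Sum>i<n. integral {x i..y i} q)) {0..T}"
    by (rule has_integral_sum[OF finite_lessThan]) (use r in auto)
  moreover have "(q has_integral integral {0..T} q) {0..T}"
    by (intro integrable_integral integrable_continuous_real q)
  moreover have "(\<Sum>i<n. ?r i t) \<le> q t" if t: "t \<in> {0..T}" for t
  proof (cases "\<exists>i<n. t \<in> {x i<..<y i}")
    case True
    then obtain i where i: "i < n" "t \<in> {x i<..<y i}" by blast
    have "?r j t = 0" if "j \<in> {..<n} - {i}" for j
      using disj[of i j] that i by auto
    then have "(\<Sum>j\<in>{..<n} - {i}. ?r j t) = 0" by (rule sum.neutral[OF ballI])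
    then have "(\<Sum>j<n. ?r j t) = ?r i t" using sum.remove[of "{..<n}" i "\<lambda>j. ?r j t"] i by simp
    then show ?thesis using i by simp
  next
    case False
    then have "(\<Sum>i<n. ?r i t) = 0" by (intro sum.neutral) auto
    then show ?thesis using q(2)[OF t] by simp
  qed
  ultimately show ?thesis by (rule has_integral_le)
qed

context discrete_positive
begin

context
  fixes x g :: "real \<Rightarrow> 'a"
  assumes x: "continuous_on {0..} x" and g: "continuous_on {0..} g" and modes: "modes 0 g x"
begin

lemmas cont = cont_x[OF x g modes] cont_g[OF x g modes] cont_G[OF x g modes] cont_truncA[OF x g modes]
lemmas deriv = G_modes[OF x g modes]

text \<open>Along a mode the derivative of z |u|^2 is - 2 |z u|^2 + 2 (z u) . g, whose absolute
  value is at most 3 z^2 |u|^2 + |g|^2 by Young's inequality.\<close>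

lemma half_energy_increment:
  assumes F: "finite F" and st: "0 \<le> s" "s \<le> t"
  shows "\<bar>(\<Sum>z\<in>F. z * (norm (P z (G (x t))))\<^sup>2) - (\<Sum>z\<in>F. z * (norm (P z (G (x s))))\<^sup>2)\<bar>
    \<le> integral {s..t} (\<lambda>r. \<Sum>z\<in>F. 3 * z\<^sup>2 * (norm (P z (G (x r))))\<^sup>2 + (norm (P z (g r)))\<^sup>2)"
proof (cases "s = t")
  case False
  then have lt: "s < t" using st by simp
  let ?u = "\<lambda>z r. P z (G (x r))" and ?g = "\<lambda>z r. P z (g r)"
  let ?q = "\<lambda>r. \<Sum>z\<in>F. 3 * z\<^sup>2 * (norm (?u z r))\<^sup>2 + (norm (?g z r))\<^sup>2"
  let ?E = "\<lambda>r. \<Sum>z\<in>F. z * (norm (?u z r))\<^sup>2"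
  let ?E' = "\<lambda>r. \<Sum>z\<in>F. z * (2 * (?u z r \<bullet> (- z *\<^sub>R ?u z r + ?g z r)))"
  have cu: "continuous_on {0..T} (?u z)" "continuous_on {0..T} (?g z)" for z T by (intro continuous_on_P cont)+
  have cq: "continuous_on {0..T} ?q" for T by (intro continuous_intros cu)
  have "norm (?E t - ?E s) \<le> integral {0..t} ?q - integral {0..s} ?q"
  proof (rule differentiable_bound_general[where f'="?E'" and \<phi>'="?q"])
    show "s < t" by (rule lt)
    show "continuous_on {s..t} ?E"
      by (rule continuous_on_subset[of "{0..t}"]) (use st in \<open>auto intro!: continuous_intros cu\<close>)
    have "continuous_on {0..t} (\<lambda>r. integral {0..r} ?q)"
      by (rule indefinite_integral_continuous_1[OF integrable_continuous_real[OF cq]])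
    then show "continuous_on {s..t} (\<lambda>r. integral {0..r} ?q)" by (rule continuous_on_subset) (use st in auto)
    fix r assume r: "s < r" "r < t"
    then have r0: "r \<ge> 0" using st by simp
    have w1: "at r within {0..} = at r" by (rule at_within_interior) (use r st in simp)
    have w2: "at r within {0..t} = at r" by (rule at_within_interior) (use r st in simp)
    have "(?E has_real_derivative ?E' r) (at r)"
      by (intro DERIV_sum DERIV_cmult has_real_derivative_norm_square) (use deriv[OF r0] w1 in simp)
    then show "(?E has_vector_derivative ?E' r) (at r)" by (simp add: has_real_derivative_iff_has_vector_derivative)
    have "((\<lambda>r. integral {0..r} ?q) has_real_derivative ?q r) (at r within {0..t})"
      by (rule integral_has_real_derivative[OF cq]) (use r r0 in auto)
    then show "((\<lambda>r. integral {0..r} ?q) has_vector_derivative ?q r) (at r)"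
      unfolding w2 by (simp add: has_real_derivative_iff_has_vector_derivative)
    have "\<bar>z * (2 * (?u z r \<bullet> (- z *\<^sub>R ?u z r + ?g z r)))\<bar> \<le> 3 * z\<^sup>2 * (norm (?u z r))\<^sup>2 + (norm (?g z r))\<^sup>2" for z
    proof -
      let ?a = "norm (z *\<^sub>R ?u z r)" and ?b = "norm (?g z r)"
      have "z * (2 * (?u z r \<bullet> (- z *\<^sub>R ?u z r + ?g z r))) = - 2 * ?a\<^sup>2 + 2 * ((z *\<^sub>R ?u z r) \<bullet> ?g z r)"
        by (simp only: power2_norm_eq_inner) (simp add: inner_simps algebra_simps)
      moreover have "\<bar>(z *\<^sub>R ?u z r) \<bullet> ?g z r\<bar> \<le> ?a * ?b" by (rule Cauchy_Schwarz_ineq2)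
      moreover have "2 * (?a * ?b) \<le> ?a\<^sup>2 + ?b\<^sup>2" using sum_squares_bound[of ?a ?b] by (simp add: mult.assoc)
      moreover have "0 \<le> ?a\<^sup>2" by simp
      ultimately have "\<bar>z * (2 * (?u z r \<bullet> (- z *\<^sub>R ?u z r + ?g z r)))\<bar> \<le> 3 * ?a\<^sup>2 + ?b\<^sup>2" by linarith
      then show ?thesis by (simp add: power_mult_distrib)
    qed
    then show "norm (?E' r) \<le> ?q r" unfolding real_norm_def by (intro order_trans[OF sum_abs] sum_mono)
  qed
  also have "integral {0..t} ?q - integral {0..s} ?q = integral {s..t} ?q"
    using Henstock_Kurzweil_Integration.integral_combine[of 0 s t ?q] st integrable_continuous_real[OF cq] by simp
  finally show ?thesis by simp
qed simp

text \<open>Increments of the truncated energy are bounded by integrals of \<open>q (Lam m)\<close>.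
  Split at a fixed \<open>N\<close>: the part from \<open>Lam N\<close> has a bounded integrand,
  while the remainder has total integral at most \<epsilon>/4 for all m \<ge> N, because the
  integrals \<open>I\<close> form a bounded increasing sequence. The estimate survives the limit in
  m.\<close>

lemma absolutely_continuous_half_power:
  assumes T: "T > 0"
  shows "absolutely_continuous_fun 0 T (\<lambda>t. (norm (half_power D A (G (x t))))\<^sup>2)"
proof -
  let ?u = "\<lambda>z r. P z (G (x r))" and ?g = "\<lambda>z r. P z (g r)"
  define q where "q F r = (\<Sum>z\<in>F. 3 * z\<^sup>2 * (norm (?u z r))\<^sup>2 + (norm (?g z r))\<^sup>2)" for F r
  define E where "E n t = (\<Sum>z\<in>Lam n. z * (norm (?u z t))\<^sup>2)" for n t
  have cu: "continuous_on {0..S} (?u z)" "continuous_on {0..S} (?g z)" for z S by (intro continuous_on_P cont)+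
  have cq: "continuous_on {0..S} (q F)" for S F unfolding q_def by (intro continuous_intros cu)
  have q0: "0 \<le> q F r" for F r unfolding q_def by (intro sum_nonneg) simp
  have E_lim: "(\<lambda>n. E n t) \<longlonglongrightarrow> (norm (half_power D A (G (x t))))\<^sup>2" for t
  proof -
    have "E n t = (\<Sum>z\<in>Lam n. (norm (P z (half_power D A (G (x t)))))\<^sup>2)" for n
      unfolding E_def by (rule sum.cong) (auto simp: P_half_power[OF G_half_domain] power_mult_distrib norm_sqrt_eigen)
    then show ?thesis using parseval_norm by simp
  qed
  have q_split: "q (Lam m) r = q (Lam n) r + q (Lam m - Lam n) r" if "n \<le> m" for m n r
    unfolding q_def by (subst add.commute) (rule sum.subset_diff[OF Lam_mono[OF that] finite_Lam])
  define I where "I n = integral {0..T} (q (Lam n))" for n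
  have I_eq: "integral {0..T} (q (Lam n)) + integral {0..T} (q (Lam m - Lam n)) = integral {0..T} (q (Lam m))" if "n \<le> m" for m n
    using integral_add[OF integrable_continuous_real[OF cq[of T "Lam n"]] integrable_continuous_real[OF cq[of T "Lam m - Lam n"]]]
    by (simp add: q_split[OF that, symmetric])
  have I_bound: "I n \<le> 3 * ((norm (x 0))\<^sup>2 + integral {0..T} (\<lambda>t. (norm (g t))\<^sup>2)) + integral {0..T} (\<lambda>t. (norm (g t))\<^sup>2)" for n
  proof -
    have cA: "(\<lambda>r. 3 * (norm (truncA n (G (x r))))\<^sup>2) integrable_on {0..T}"
      and cg: "(\<lambda>r. (norm (g r))\<^sup>2) integrable_on {0..T}"
      by (intro integrable_continuous_real continuous_intros cont)+
    have "I n \<le> integral {0..T} (\<lambda>r. 3 * (norm (truncA n (G (x r))))\<^sup>2 + (norm (g r))\<^sup>2)"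
      unfolding I_def
    proof (rule integral_le[OF integrable_continuous_real[OF cq] integrable_add[OF cA cg]])
      fix r
      show "q (Lam n) r \<le> 3 * (norm (truncA n (G (x r))))\<^sup>2 + (norm (g r))\<^sup>2"
        using bessel[OF finite_Lam[of n], of "g r"] by (simp add: q_def sum.distrib norm_truncA sum_distrib_left mult.assoc)
    qed
    also have "\<dots> = 3 * integral {0..T} (\<lambda>r. (norm (truncA n (G (x r))))\<^sup>2) + integral {0..T} (\<lambda>r. (norm (g r))\<^sup>2)"
      by (simp add: integral_add[OF cA cg])
    also have "\<dots> \<le> 3 * ((norm (x 0))\<^sup>2 + integral {0..T} (\<lambda>t. (norm (g t))\<^sup>2)) + integral {0..T} (\<lambda>t. (norm (g t))\<^sup>2)"
      using truncA_energy[OF x g modes, of T n] T by simp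
    finally show ?thesis .
  qed
  have "incseq I"
  proof (rule monoI)
    fix n m :: nat assume "n \<le> m"
    moreover have "0 \<le> integral {0..T} (q (Lam m - Lam n))"
      by (rule integral_nonneg[OF integrable_continuous_real[OF cq]]) (rule q0)
    ultimately show "I n \<le> I m" using I_eq[of n m] by (simp add: I_def)
  qed
  then have "convergent I"
    by (rule incseq_convergent) (use I_bound in \<open>auto simp: convergent_def\<close>)
  then have cauchy: "Cauchy I" by (rule convergent_Cauchy)
  show ?thesis unfolding absolutely_continuous_fun_def
  proof (intro allI impI)
    fix \<epsilon> :: real assume \<epsilon>: "\<epsilon> > 0"
    obtain N where N: "\<And>m n. N \<le> m \<Longrightarrow> N \<le> n \<Longrightarrow> norm (I m - I n) < \<epsilon> / 4"
      using CauchyD[OF cauchy, of "\<epsilon> / 4"] \<epsilon> by auto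
    have "bounded (q (Lam N) ` {0..T})" by (intro compact_imp_bounded compact_continuous_image cq) simp
    then obtain B where B: "B > 0" "\<And>r. r \<in> {0..T} \<Longrightarrow> q (Lam N) r \<le> B"
      by (auto simp: bounded_pos abs_le_iff)
    show "\<exists>\<delta>>0. \<forall>(n::nat) a b. (\<forall>i<n. 0 \<le> a i \<and> a i \<le> b i \<and> b i \<le> T) \<longrightarrow>
        (\<forall>i<n. \<forall>j<n. i \<noteq> j \<longrightarrow> {a i<..<b i} \<inter> {a j<..<b j} = {}) \<longrightarrow>
        (\<Sum>i<n. b i - a i) < \<delta> \<longrightarrow>
        (\<Sum>i<n. \<bar>(norm (half_power D A (G (x (b i)))))\<^sup>2 - (norm (half_power D A (G (x (a i)))))\<^sup>2\<bar>) < \<epsilon>"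
    \<comment> \<open>This total length costs at most \<epsilon>/4 in the bounded part. Together
      with the remainder the sum is at most \<epsilon>/2, which keeps the limit in m strictly below
      \<epsilon>.\<close>
    proof (intro exI[of _ "\<epsilon> / (4 * B)"] conjI allI impI)
      show "0 < \<epsilon> / (4 * B)" using \<epsilon> B by simp
      fix n :: nat and a b :: "nat \<Rightarrow> real"
      assume ab: "\<forall>i<n. 0 \<le> a i \<and> a i \<le> b i \<and> b i \<le> T"
        and disj: "\<forall>i<n. \<forall>j<n. i \<noteq> j \<longrightarrow> {a i<..<b i} \<inter> {a j<..<b j} = {}"
        and len: "(\<Sum>i<n. b i - a i) < \<epsilon> / (4 * B)"
      have part: "(\<Sum>i<n. \<bar>E m (b i) - E m (a i)\<bar>) \<le> \<epsilon> / 2" if m: "N \<le> m" for m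
      proof -
        have "\<bar>E m (b i) - E m (a i)\<bar> \<le> B * (b i - a i) + integral {a i..b i} (q (Lam m - Lam N))" if i: "i < n" for i
        proof -
          have sub: "{a i..b i} \<subseteq> {0..T}" using ab i by auto
          have int: "q F integrable_on {a i..b i}" for F
            by (intro integrable_continuous_real continuous_on_subset[OF cq sub])
          have "\<bar>E m (b i) - E m (a i)\<bar> \<le> integral {a i..b i} (q (Lam m))"
            unfolding E_def q_def using half_energy_increment[OF finite_Lam[of m], of "a i" "b i"] ab i by simp
          also have "q (Lam m) = (\<lambda>r. q (Lam N) r + q (Lam m - Lam N) r)"
            by (rule ext) (rule q_split[OF m])
          also have "integral {a i..b i} \<dots> = integral {a i..b i} (q (Lam N)) + integral {a i..b i} (q (Lam m - Lam N))"
            by (rule integral_add[OF int int])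
          also have "integral {a i..b i} (q (Lam N)) \<le> integral {a i..b i} (\<lambda>r. B)"
            by (rule integral_le[OF int]) (use B(2) sub in auto)
          also have "integral {a i..b i} (\<lambda>r. B) = B * (b i - a i)" using ab i by simp
          finally show ?thesis by simp
        qed
        then have "(\<Sum>i<n. \<bar>E m (b i) - E m (a i)\<bar>) \<le> (\<Sum>i<n. B * (b i - a i) + integral {a i..b i} (q (Lam m - Lam N)))"
          by (intro sum_mono) simp
        also have "\<dots> = B * (\<Sum>i<n. b i - a i) + (\<Sum>i<n. integral {a i..b i} (q (Lam m - Lam N)))"
          by (simp add: sum.distrib sum_distrib_left)
        also have "(\<Sum>i<n. integral {a i..b i} (q (Lam m - Lam N))) \<le> integral {0..T} (q (Lam m - Lam N))"
          by (rule sum_integral_disjoint_le) (use cq q0 ab disj in auto)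
        also have "\<dots> = I m - I N" using I_eq[OF m] by (simp add: I_def)
        also have "\<dots> \<le> \<epsilon> / 4" using N[OF m order_refl] unfolding real_norm_def by linarith
        also have "B * (\<Sum>i<n. b i - a i) \<le> B * (\<epsilon> / (4 * B))" using len B(1) by (intro mult_left_mono) auto
        finally show ?thesis using B(1) by simp
      qed
      have "(\<lambda>m. \<Sum>i<n. \<bar>E m (b i) - E m (a i)\<bar>) \<longlonglongrightarrow>
          (\<Sum>i<n. \<bar>(norm (half_power D A (G (x (b i)))))\<^sup>2 - (norm (half_power D A (G (x (a i)))))\<^sup>2\<bar>)"
        by (intro tendsto_intros E_lim)
      then have "(\<Sum>i<n. \<bar>(norm (half_power D A (G (x (b i)))))\<^sup>2 - (norm (half_power D A (G (x (a i)))))\<^sup>2\<bar>) \<le> \<epsilon> / 2"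
        by (rule LIMSEQ_le_const2) (use part in blast)
      then show "(\<Sum>i<n. \<bar>(norm (half_power D A (G (x (b i)))))\<^sup>2 - (norm (half_power D A (G (x (a i)))))\<^sup>2\<bar>) < \<epsilon>"
        using \<epsilon> by simp
    qed
  qed
qed

text \<open>Both vector integrals exist by earlier lemmas; that they are opposite is tested on
  eigenvectors, which are total. There \<open>A\<close> moves onto the eigenvector, the scalar
  function is classically differentiable, and integration by parts has no boundary terms since
  \<phi> vanishes at both ends.\<close>

lemma weak_derivative_solution:
  assumes T: "T > 0"
  shows "weak_derivative T (\<lambda>t. G (x t)) (\<lambda>t. g t - A (G (x t)))"
  unfolding weak_derivative_def
proof (intro allI impI)
  fix \<phi> assume \<phi>: "test_function T \<phi>"
  let ?M = "lebesgue_on {0<..<T}"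
  have c: "continuous_on S \<phi>" "continuous_on S (deriv \<phi>)" for S using test_functionD[OF \<phi>] by auto
  have "\<exists>I. has_bochner ?M (\<lambda>t. deriv \<phi> t *\<^sub>R G (x t)) I"
    by (rule has_bochner_continuous[OF _ T]) (intro continuous_intros c cont)
  then obtain I1 where I1: "has_bochner ?M (\<lambda>t. deriv \<phi> t *\<^sub>R G (x t)) I1" by blast
  obtain I2 where I2: "has_bochner ?M (\<lambda>t. \<phi> t *\<^sub>R (g t - A (G (x t)))) I2"
    using has_bochner_test[OF x g modes T c(1)] by blast
  have "(I1 + I2) \<bullet> e = 0" if e: "e \<in> eigenspace z" for z e
  proof -
    let ?a = "\<lambda>t. G (x t) \<bullet> e" and ?b = "\<lambda>t. - z * (G (x t) \<bullet> e) + g t \<bullet> e"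
    have ca: "continuous_on {0..T} ?a" "continuous_on {0..T} ?b" by (intro continuous_intros cont)+
    have "has_bochner_integral ?M (\<lambda>t. deriv \<phi> t * ?a t) (I1 \<bullet> e)"
      using has_bochner_inner[OF _ I1, of e] by simp
    moreover have "has_bochner_integral ?M (\<lambda>t. deriv \<phi> t * ?a t) (integral {0..T} (\<lambda>t. deriv \<phi> t * ?a t))"
      by (intro integral_lebesgue_on_interval continuous_intros c ca)
    ultimately have i1: "I1 \<bullet> e = integral {0..T} (\<lambda>t. deriv \<phi> t * ?a t)" by (rule has_bochner_integral_eq)
    have hb: "has_bochner_integral ?M (\<lambda>t. (\<phi> t *\<^sub>R (g t - A (G (x t)))) \<bullet> e) (I2 \<bullet> e)"
      using has_bochner_inner[OF _ I2, of e] by simp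
    have "AE t in ?M. (\<phi> t *\<^sub>R (g t - A (G (x t)))) \<bullet> e = \<phi> t * ?b t"
      using AE_domain[OF x g modes T]
    proof eventually_elim
      fix t assume "G (x t) \<in> D"
      moreover have "e \<in> D" "A e = z *\<^sub>R e" using e by (auto simp: eigenspace_def)
      ultimately have "A (G (x t)) \<bullet> e = z * (G (x t) \<bullet> e)" using A_symmetric by simp
      then show "(\<phi> t *\<^sub>R (g t - A (G (x t)))) \<bullet> e = \<phi> t * ?b t" by (simp add: inner_diff_left)
    qed
    moreover have ib: "has_bochner_integral ?M (\<lambda>t. \<phi> t * ?b t) (integral {0..T} (\<lambda>t. \<phi> t * ?b t))"
      by (intro integral_lebesgue_on_interval continuous_intros c ca)
    ultimately have "has_bochner_integral ?M (\<lambda>t. (\<phi> t *\<^sub>R (g t - A (G (x t)))) \<bullet> e) (integral {0..T} (\<lambda>t. \<phi> t * ?b t))"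
      using hb by (subst has_bochner_integral_cong_AE) (auto simp: has_bochner_integral_iff)
    with hb have i2: "I2 \<bullet> e = integral {0..T} (\<lambda>t. \<phi> t * ?b t)" by (rule has_bochner_integral_eq)
    have "((\<lambda>t. deriv \<phi> t * ?a t + \<phi> t * ?b t) has_integral (\<phi> T * ?a T - \<phi> 0 * ?a 0)) {0..T}"
    proof (rule fundamental_theorem_of_calculus)
      fix t assume t: "t \<in> {0..T}"
      have "((\<lambda>t. P z (G (x t)) \<bullet> e) has_vector_derivative (- z *\<^sub>R P z (G (x t)) + P z (g t)) \<bullet> e) (at t within {0..T})"
        by (rule bounded_linear.has_vector_derivative[OF bounded_linear_inner_left has_vector_derivative_within_subset[OF deriv]])
          (use t in auto)
      then have "(?a has_real_derivative ?b t) (at t within {0..T})"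
        by (simp add: has_real_derivative_iff_has_vector_derivative P_orth[OF e] inner_diff_left)
      from DERIV_mult[OF has_field_derivative_at_within[OF test_functionD(1)[OF \<phi>]] this]
      show "((\<lambda>t. \<phi> t * ?a t) has_vector_derivative deriv \<phi> t * ?a t + \<phi> t * ?b t) (at t within {0..T})"
        by (simp add: has_real_derivative_iff_has_vector_derivative mult.commute)
    qed (use T in simp)
    moreover have "(\<lambda>t. deriv \<phi> t * ?a t) integrable_on {0..T}" "(\<lambda>t. \<phi> t * ?b t) integrable_on {0..T}"
      by (intro integrable_continuous_real continuous_intros c ca)+
    ultimately have "integral {0..T} (\<lambda>t. deriv \<phi> t * ?a t) + integral {0..T} (\<lambda>t. \<phi> t * ?b t) = 0"
      using test_functionD(4,5)[OF \<phi>] integral_add[of "\<lambda>t. deriv \<phi> t * ?a t" "{0..T}" "\<lambda>t. \<phi> t * ?b t"]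
      by (auto dest!: integral_unique)
    then show ?thesis using i1 i2 by (simp add: inner_add_left)
  qed
  then have "I1 + I2 = 0" by (rule total)
  then have "I2 = - I1" by (simp add: eq_neg_iff_add_eq_0 add.commute)
  then show "\<exists>I. has_bochner ?M (\<lambda>t. deriv \<phi> t *\<^sub>R G (x t)) I \<and> has_bochner ?M (\<lambda>t. \<phi> t *\<^sub>R (g t - A (G (x t)))) (- I)"
    using I1 I2 by blast
qed

lemma W12_solution:
  assumes T: "T > 0"
  shows "W12_with_derivative T (\<lambda>t. G (x t)) (\<lambda>t. g t - A (G (x t)))"
proof -
  let ?M = "lebesgue_on {0<..<T}"
  have "bochner_L2 ?M (\<lambda>t. G (x t))"
  proof (rule bochner_L2_bound[OF x g modes T])
    show "strongly_measurable ?M (\<lambda>t. G (x t))"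
      by (rule strongly_measurable_limit[of T "\<lambda>n t. G (x t)"]) (use T cont in auto)
    show "continuous_on {0..T} (\<lambda>t. (norm (G (x t)))\<^sup>2)" by (intro continuous_intros cont)
  qed auto
  moreover have "bochner_L2 ?M (\<lambda>t. g t - A (G (x t)))"
  proof (rule bochner_L2_bound[OF x g modes T])
    show "strongly_measurable ?M (\<lambda>t. g t - A (G (x t)))"
    proof (rule strongly_measurable_limit[OF _ T])
      show "continuous_on {0..T} (\<lambda>t. g t - truncA n (G (x t)))" for n by (intro continuous_intros cont)
      show "AE t in ?M. (\<lambda>n. g t - truncA n (G (x t))) \<longlonglongrightarrow> g t - A (G (x t))"
        using AE_truncA_tendsto[OF x g modes T] by (rule eventually_mono) (rule tendsto_diff[OF tendsto_const])
    qed
    show "continuous_on {0..T} (\<lambda>t. 2 * (norm (g t))\<^sup>2)" by (intro continuous_intros cont)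
    show "(norm (g t - A (G (x t))))\<^sup>2 \<le> 2 * (norm (g t))\<^sup>2 + 2 * (norm (A (G (x t))))\<^sup>2" for t
    proof -
      have "0 \<le> (norm (g t + A (G (x t))))\<^sup>2" by simp
      then show ?thesis by (simp add: power2_norm_eq_inner inner_simps inner_commute)
    qed
  qed simp
  ultimately show ?thesis
    using weak_derivative_solution[OF T] by (simp add: W12_with_derivative_def)
qed

lemma is_solution_if_modes:
  assumes R: "\<And>t. t \<ge> 0 \<Longrightarrow> norm (x t) < R" and f: "\<And>t. t \<ge> 0 \<Longrightarrow> f (G (x t)) = g t"
  shows "is_solution D A R f (G (x 0)) \<infinity> (\<lambda>t. G (x t))"
  unfolding is_solution_def
proof (intro conjI allI impI)
  fix T :: real assume T: "T > 0"
  show "C0_half_domain D A T (\<lambda>t. G (x t))"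
    unfolding C0_half_domain_def
  proof (intro conjI ballI G_half_domain)
    fix t assume t: "t \<in> {0..T}"
    have "continuous (at t within {0..T}) x" using cont(1) t by (simp add: continuous_on_eq_continuous_within)
    then have "((\<lambda>s. norm (x s - x t)) \<longlongrightarrow> norm (x t - x t)) (at t within {0..T})"
      unfolding continuous_within by (intro tendsto_intros)
    then show "((\<lambda>s. half_norm D A (G (x s) - G (x t))) \<longlongrightarrow> 0) (at t within {0..T})"
      by (simp add: G_diff[symmetric] half_norm_G)
  qed
  show "L2_domain D A T (\<lambda>t. G (x t))" by (rule L2_domain_solution[OF x g modes T])
  show "absolutely_continuous_fun 0 T (\<lambda>t. (norm (half_power D A (G (x t))))\<^sup>2)"
    by (rule absolutely_continuous_half_power[OF T])
  have "AE t in lebesgue_on {0<..<T}. (g t - A (G (x t))) + A (G (x t)) = f (G (x t))"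
    by (rule AE_I2) (use f in simp)
  then show "\<exists>u'. W12_with_derivative T (\<lambda>t. G (x t)) u' \<and>
      (AE t in lebesgue_on {0<..<T}. u' t + A (G (x t)) = f (G (x t)))"
    using W12_solution[OF T] by blast
qed (use R in \<open>simp_all add: half_ball_G\<close>)

end

end

section \<open>Uniqueness\<close>

text \<open>The integral of \<psi> times \<open>exp (- (C * s))\<close> starts at 0 and is
  nonincreasing, so the integral is nonpositive, and by \<open>le\<close> so is \<psi>.\<close>

lemma gronwall_zero:
  fixes \<psi> :: "real \<Rightarrow> real"
  assumes \<psi>: "continuous_on {0..T} \<psi>" and C: "0 \<le> C"
    and le: "\<And>t. t \<in> {0..T} \<Longrightarrow> \<psi> t \<le> C * integral {0..t} \<psi>" and t: "t \<in> {0..T}"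
  shows "\<psi> t \<le> 0"
proof -
  define F where "F s = exp (- (C * s)) * integral {0..s} \<psi>" for s
  define F' where "F' s = (- C * exp (- (C * s))) * integral {0..s} \<psi> + \<psi> s * exp (- (C * s))" for s
  have "F t \<le> F 0"
  proof (rule nonincreasing_if_deriv_nonpos)
    fix s assume s: "0 \<le> s" "s \<le> t"
    have "((\<lambda>s. exp (- (C * s))) has_real_derivative - C * exp (- (C * s))) (at s within {0..T})"
      by (auto intro!: derivative_eq_intros)
    moreover have "((\<lambda>s. integral {0..s} \<psi>) has_real_derivative \<psi> s) (at s within {0..T})"
      by (rule integral_has_real_derivative[OF \<psi>]) (use s t in auto)
    ultimately have "(F has_real_derivative F' s) (at s within {0..T})"
      unfolding F_def F'_def by (rule DERIV_mult)
    then show "(F has_real_derivative F' s) (at s within {0..t})" by (rule DERIV_subset) (use t in auto)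
    have "F' s = exp (- (C * s)) * (\<psi> s - C * integral {0..s} \<psi>)" by (simp add: F'_def algebra_simps)
    then show "F' s \<le> 0" using le[of s] s t by (simp add: mult_le_0_iff)
  qed (use t in simp)
  then have "integral {0..t} \<psi> \<le> 0" by (simp add: F_def mult_le_0_iff)
  then have "C * integral {0..t} \<psi> \<le> 0" using C by (simp add: mult_nonneg_nonpos)
  with le[OF t] show ?thesis by simp
qed

context discrete_positive
begin

text \<open>An arbitrary solution satisfies its equation only weakly. Tested against an eigenvector
  it has a continuous weak derivative, because \<open>f\<close> is Lipschitz and \<open>A\<close>
  acts as a scalar, so \<open>weak_derivative_imp_derivative\<close> makes the mode classically
  differentiable.\<close>

lemma solution_modes:
  assumes sol: "is_solution D A R f u0 Tmax v" and T: "0 < T" "ereal T < Tmax"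
    and lip: "\<And>a b. a \<in> half_ball D A R \<Longrightarrow> b \<in> half_ball D A R \<Longrightarrow> norm (f a - f b) \<le> K * half_norm D A (a - b)"
  obtains y where "continuous_on {0..T} y" "\<And>t. t \<in> {0..T} \<Longrightarrow> v t = G (y t)"
    "\<And>t. t \<in> {0..T} \<Longrightarrow> v t \<in> half_ball D A R" "continuous_on {0..T} (\<lambda>t. f (v t))"
    "\<And>z t. t \<in> {0..T} \<Longrightarrow> ((\<lambda>t. P z (v t)) has_vector_derivative - z *\<^sub>R P z (v t) + P z (f (v t))) (at t within {0..T})"
proof -
  let ?M = "lebesgue_on {0<..<T}"
  have ball: "v t \<in> half_ball D A R" if "t \<in> {0..T}" for t
  proof -
    have "ereal t < Tmax" using that T(2) by (auto intro: le_less_trans[of _ "ereal T"])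
    then show ?thesis using sol that by (auto simp: is_solution_def)
  qed
  have C0: "C0_half_domain D A T v" and L2: "L2_domain D A T v"
    using sol T by (auto simp: is_solution_def)
  obtain v' where W: "W12_with_derivative T v v'" and eq: "AE t in ?M. v' t + A (v t) = f (v t)"
    using sol T by (auto simp: is_solution_def)
  have AE_D: "AE t in ?M. v t \<in> D" using L2 by (simp add: L2_domain_def)
  have "\<exists>y. \<forall>t\<in>{0..T}. v t = G (y t)"
    using C0 half_domain_G by (intro bchoice) (metis C0_half_domain_def)
  then obtain y where vG: "\<And>t. t \<in> {0..T} \<Longrightarrow> v t = G (y t)" by blast
  have cont_y: "continuous_on {0..T} y"
    unfolding continuous_on_def
  proof
    fix t assume t: "t \<in> {0..T}"
    have "((\<lambda>s. half_norm D A (v s - v t)) \<longlongrightarrow> 0) (at t within {0..T})"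
      using C0 t by (simp add: C0_half_domain_def)
    moreover have "\<forall>\<^sub>F s in at t within {0..T}. half_norm D A (v s - v t) = norm (y s - y t)"
      unfolding eventually_at_filter using t by (intro always_eventually) (simp add: vG G_diff[symmetric] half_norm_G)
    ultimately have "((\<lambda>s. norm (y s - y t)) \<longlongrightarrow> 0) (at t within {0..T})" by (rule Lim_transform_eventually)
    then show "(y \<longlongrightarrow> y t) (at t within {0..T})" by (simp add: tendsto_norm_zero_iff LIM_zero_iff)
  qed
  have cont_v: "continuous_on {0..T} v"
    by (rule continuous_on_eq[OF bounded_linear.continuous_on[OF bounded_linear_G cont_y]]) (simp add: vG)
  have cont_f: "continuous_on {0..T} (\<lambda>t. f (v t))"
    unfolding continuous_on_def
  proof
    fix t assume t: "t \<in> {0..T}"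
    have "((\<lambda>s. f (v s) - f (v t)) \<longlongrightarrow> 0) (at t within {0..T})"
    proof (rule Lim_null_comparison)
      show "\<forall>\<^sub>F s in at t within {0..T}. norm (f (v s) - f (v t)) \<le> K * norm (y s - y t)"
        unfolding eventually_at_filter
      proof (intro always_eventually allI impI)
        fix s assume s: "s \<noteq> t" "s \<in> {0..T}"
        show "norm (f (v s) - f (v t)) \<le> K * norm (y s - y t)"
          using lip[OF ball[OF s(2)] ball[OF t]] s t by (simp add: vG G_diff[symmetric] half_norm_G)
      qed
      have "((\<lambda>s. K * norm (y s - y t)) \<longlongrightarrow> K * norm (y t - y t)) (at t within {0..T})"
        using cont_y t by (intro tendsto_intros) (auto simp: continuous_on_def)
      then show "((\<lambda>s. K * norm (y s - y t)) \<longlongrightarrow> 0) (at t within {0..T})" by simp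
    qed
    then show "((\<lambda>s. f (v s)) \<longlongrightarrow> f (v t)) (at t within {0..T})" by (simp add: LIM_zero_iff)
  qed
  have scalar: "((\<lambda>t. v t \<bullet> e) has_real_derivative - z * (v t \<bullet> e) + f (v t) \<bullet> e) (at t within {0..T})"
    if e: "e \<in> eigenspace z" and t: "t \<in> {0..T}" for z e t
  proof (rule weak_derivative_imp_derivative[OF _ _ T(1) _ t])
    let ?a = "\<lambda>t. v t \<bullet> e" and ?b = "\<lambda>t. - z * (v t \<bullet> e) + f (v t) \<bullet> e"
    show ca: "continuous_on {0..T} ?a" and cb: "continuous_on {0..T} ?b"
      by (intro continuous_intros cont_v cont_f)+
    fix \<phi> assume \<phi>: "test_function T \<phi>"
    note c = test_functionD(2,3)[OF \<phi>]
    obtain I where I: "has_bochner ?M (\<lambda>t. deriv \<phi> t *\<^sub>R v t) I" "has_bochner ?M (\<lambda>t. \<phi> t *\<^sub>R v' t) (- I)"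
      using W \<phi> unfolding W12_with_derivative_def weak_derivative_def by blast
    have "has_bochner_integral ?M (\<lambda>t. deriv \<phi> t * ?a t) (I \<bullet> e)"
      using has_bochner_inner[OF _ I(1), of e] by simp
    moreover have "has_bochner_integral ?M (\<lambda>t. deriv \<phi> t * ?a t) (integral {0..T} (\<lambda>t. deriv \<phi> t * ?a t))"
      by (intro integral_lebesgue_on_interval continuous_intros c ca)
    ultimately have 1: "I \<bullet> e = integral {0..T} (\<lambda>t. deriv \<phi> t * ?a t)" by (rule has_bochner_integral_eq)
    have hb: "has_bochner_integral ?M (\<lambda>t. (\<phi> t *\<^sub>R v' t) \<bullet> e) (- I \<bullet> e)"
      by (rule has_bochner_inner[OF _ I(2)]) simp
    have "AE t in ?M. (\<phi> t *\<^sub>R v' t) \<bullet> e = \<phi> t * ?b t"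
      using AE_D eq
    proof eventually_elim
      fix t assume t: "v t \<in> D" "v' t + A (v t) = f (v t)"
      have "e \<in> D" "A e = z *\<^sub>R e" using e by (auto simp: eigenspace_def)
      then have "A (v t) \<bullet> e = z * (v t \<bullet> e)" using A_symmetric[OF t(1)] by simp
      moreover have "v' t = f (v t) - A (v t)" using t(2) by (simp add: algebra_simps)
      ultimately show "(\<phi> t *\<^sub>R v' t) \<bullet> e = \<phi> t * ?b t" by (simp add: inner_diff_left)
    qed
    moreover have ib: "has_bochner_integral ?M (\<lambda>t. \<phi> t * ?b t) (integral {0..T} (\<lambda>t. \<phi> t * ?b t))"
      by (intro integral_lebesgue_on_interval continuous_intros c cb)
    ultimately have "has_bochner_integral ?M (\<lambda>t. (\<phi> t *\<^sub>R v' t) \<bullet> e) (integral {0..T} (\<lambda>t. \<phi> t * ?b t))"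
      using hb by (subst has_bochner_integral_cong_AE) (auto simp: has_bochner_integral_iff)
    with hb have "- I \<bullet> e = integral {0..T} (\<lambda>t. \<phi> t * ?b t)" by (rule has_bochner_integral_eq)
    with 1 show "integral {0..T} (\<lambda>t. deriv \<phi> t * ?a t) = - integral {0..T} (\<lambda>t. \<phi> t * ?b t)" by simp
  qed
  have "((\<lambda>t. P z (v t)) has_vector_derivative - z *\<^sub>R P z (v t) + P z (f (v t))) (at t within {0..T})"
    if t: "t \<in> {0..T}" for z t
  proof -
    define h where "h t = - z *\<^sub>R P z (v t) + P z (f (v t))" for t
    have ch: "continuous_on {0..T} h" unfolding h_def by (intro continuous_intros continuous_on_P cont_v cont_f)
    \<comment> \<open>The clamp \<open>min t T\<close> extends \<open>h\<close> continuously to the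
      half line, as \<open>antiderivative_exists\<close> requires.\<close>
    have "continuous_on {0..} (\<lambda>t. h (min t T))"
      by (rule continuous_on_compose2[OF ch]) (use T in \<open>auto intro!: continuous_intros\<close>)
    then obtain H where H: "\<And>t. t \<ge> 0 \<Longrightarrow> (H has_vector_derivative h (min t T)) (at t within {0..})"
      using antiderivative_exists by blast
    have HT: "(H has_vector_derivative h s) (at s within {0..T})" if "s \<in> {0..T}" for s
      using has_vector_derivative_within_subset[OF H[of s], of "{0..T}"] that by simp
    \<comment> \<open>Only scalar derivatives are known so far. The change of
      \<open>P z (v s) - H s\<close> since time 0 is frozen as a vector \<open>e\<close> and paired
      with itself, which makes the question scalar.\<close>
    have const: "P z (v s) - H s = P z (v 0) - H 0" if s: "s \<in> {0..T}" for s
    proof -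
      define e where "e = (P z (v s) - H s) - (P z (v 0) - H 0)"
      let ?d = "\<lambda>s. P z (v s) \<bullet> e - H s \<bullet> e"
      have "(?d has_field_derivative 0) (at r within {0..T})" if r: "r \<in> {0..T}" for r
      proof -
        have dH: "((\<lambda>s. H s \<bullet> e) has_real_derivative h r \<bullet> e) (at r within {0..T})"
          unfolding has_real_derivative_iff_has_vector_derivative
          by (rule bounded_linear.has_vector_derivative[OF bounded_linear_inner_left HT[OF r]])
        have "((\<lambda>s. P z (v s) \<bullet> e) has_real_derivative h r \<bullet> e) (at r within {0..T})"
          using scalar[OF P_in r, of z e] by (simp add: h_def P_sym inner_diff_left)
        from DERIV_diff[OF this dH] show ?thesis by simp
      qed
      then obtain c where "\<And>r. r \<in> {0..T} \<Longrightarrow> ?d r = c"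
        using has_field_derivative_zero_constant[OF convex_real_interval(5), of 0 T ?d] by blast
      then have "?d s = ?d 0" using s T by simp
      then have "e \<bullet> e = 0" by (subst (1) e_def) (simp add: inner_diff_left)
      then show ?thesis by (simp add: e_def)
    qed
    have "((\<lambda>s. H s + (P z (v 0) - H 0)) has_vector_derivative h t) (at t within {0..T})"
      using has_vector_derivative_add[OF HT[OF t] has_vector_derivative_const] by simp
    then have "((\<lambda>s. P z (v s)) has_vector_derivative h t) (at t within {0..T})"
    proof (rule has_vector_derivative_transform[OF t, rotated])
      fix s assume "s \<in> {0..T}"
      then show "P z (v s) = H s + (P z (v 0) - H 0)" using const[of s] by (simp add: algebra_simps)
    qed
    then show ?thesis by (simp add: h_def)
  qed
  with cont_y vG ball cont_f that show ?thesis by blast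
qed

text \<open>Energy estimate for the difference in the half norm, which is the norm of
  \<open>w\<close>. Young's inequality produces (1 + z)^2 |d|^2; the damping 2 z (1 + z) |d|^2
  reduces this to at most (1 + z) |d|^2 = |w|^2 in each mode. Summing over modes and using the
  Lipschitz bound leads to Gronwall's inequality for |w|^2.\<close>

lemma solution_unique:
  assumes u: "is_solution D A R f u0 Tu u" and v: "is_solution D A R f u0 Tv v"
    and T: "0 \<le> T" "ereal T < Tu" "ereal T < Tv" and K: "0 \<le> K"
    and lip: "\<And>a b. a \<in> half_ball D A R \<Longrightarrow> b \<in> half_ball D A R \<Longrightarrow> norm (f a - f b) \<le> K * half_norm D A (a - b)"
  shows "v T = u T"
proof (cases "T = 0")
  case True
  then show ?thesis using u v by (simp add: is_solution_def)
next
  case False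
  then have T0: "0 < T" using T by simp
  obtain x where x: "continuous_on {0..T} x" "\<And>t. t \<in> {0..T} \<Longrightarrow> u t = G (x t)"
    and ub: "\<And>t. t \<in> {0..T} \<Longrightarrow> u t \<in> half_ball D A R" and uc: "continuous_on {0..T} (\<lambda>t. f (u t))"
    and ud: "\<And>z t. t \<in> {0..T} \<Longrightarrow> ((\<lambda>t. P z (u t)) has_vector_derivative - z *\<^sub>R P z (u t) + P z (f (u t))) (at t within {0..T})"
    using solution_modes[OF u T0 T(2) lip] by blast
  obtain y where y: "continuous_on {0..T} y" "\<And>t. t \<in> {0..T} \<Longrightarrow> v t = G (y t)"
    and vb: "\<And>t. t \<in> {0..T} \<Longrightarrow> v t \<in> half_ball D A R" and vc: "continuous_on {0..T} (\<lambda>t. f (v t))"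
    and vd: "\<And>z t. t \<in> {0..T} \<Longrightarrow> ((\<lambda>t. P z (v t)) has_vector_derivative - z *\<^sub>R P z (v t) + P z (f (v t))) (at t within {0..T})"
    using solution_modes[OF v T0 T(3) lip] by blast
  define d where "d t = v t - u t" for t
  define w where "w t = y t - x t" for t
  define k where "k t = f (v t) - f (u t)" for t
  have cw: "continuous_on {0..T} w" unfolding w_def by (intro continuous_intros x y)
  have ck: "continuous_on {0..T} k" unfolding k_def by (intro continuous_intros uc vc)
  have dG: "d t = G (w t)" if "t \<in> {0..T}" for t using x(2) y(2) that by (simp add: d_def w_def G_diff)
  have k_le: "norm (k t) \<le> K * norm (w t)" if t: "t \<in> {0..T}" for t
    using lip[OF vb[OF t] ub[OF t]] dG[OF t] by (simp add: k_def half_norm_G flip: d_def)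
  have dd: "((\<lambda>t. P z (d t)) has_vector_derivative - z *\<^sub>R P z (d t) + P z (k t)) (at t within {0..T})" if "t \<in> {0..T}" for z t
    using has_vector_derivative_diff[OF vd[OF that, of z] ud[OF that, of z]] by (simp add: d_def k_def P_diff algebra_simps)
  have PdPw: "(1 + z) * (norm (P z (d t)))\<^sup>2 = (norm (P z (w t)))\<^sup>2" if "z \<in> Lam n" "t \<in> {0..T}" for z t n
    unfolding dG[OF that(2)] P_G norm_scaleR power_mult_distrib power2_abs norm_sqrt_eigen[OF that(1)]
    using Lam_nonneg[OF that(1)] by simp
  have mode: "(norm (P z (w t)))\<^sup>2 \<le> integral {0..t} (\<lambda>s. (norm (P z (w s)))\<^sup>2 + (norm (P z (k s)))\<^sup>2)"
    if z: "z \<in> Lam n" and t: "t \<in> {0..T}" for z n t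
  proof -
    have z0: "0 \<le> z" by (rule Lam_nonneg[OF z])
    let ?q = "\<lambda>s. (norm (P z (w s)))\<^sup>2 + (norm (P z (k s)))\<^sup>2"
    have cq: "continuous_on {0..T} ?q" by (intro continuous_intros continuous_on_P cw ck)
    define F where "F t = (1 + z) * (norm (P z (d t)))\<^sup>2 - integral {0..t} ?q" for t
    define F' where "F' t = (1 + z) * (2 * (P z (d t) \<bullet> (- z *\<^sub>R P z (d t) + P z (k t)))) - ?q t" for t
    have "F t \<le> F 0"
    proof (rule nonincreasing_if_deriv_nonpos)
      fix s assume s: "0 \<le> s" "s \<le> t"
      then have sT: "s \<in> {0..T}" using t by simp
      have "(F has_real_derivative F' s) (at s within {0..T})"
        unfolding F_def F'_def
        by (intro DERIV_diff DERIV_cmult has_real_derivative_norm_square dd[OF sT] integral_has_real_derivative[OF cq sT])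
      then show "(F has_real_derivative F' s) (at s within {0..t})" by (rule DERIV_subset) (use t in auto)
      let ?a = "norm (P z (d s))" and ?b = "norm (P z (k s))"
      have "2 * (1 + z) * (P z (d s) \<bullet> P z (k s)) \<le> 2 * ((1 + z) * ?a) * ?b"
      proof -
        have "(2 * (1 + z)) * (P z (d s) \<bullet> P z (k s)) \<le> (2 * (1 + z)) * (?a * ?b)"
          by (rule mult_left_mono[OF norm_cauchy_schwarz]) (use z0 in simp)
        then show ?thesis by (simp only: mult.assoc)
      qed
      also have "\<dots> \<le> ((1 + z) * ?a)\<^sup>2 + ?b\<^sup>2" by (rule sum_squares_bound)
      finally have "2 * (1 + z) * (P z (d s) \<bullet> P z (k s)) \<le> ((1 + z) * ?a)\<^sup>2 + ?b\<^sup>2" .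
      moreover have "F' s = - 2 * z * (1 + z) * ?a\<^sup>2 + 2 * (1 + z) * (P z (d s) \<bullet> P z (k s)) - (1 + z) * ?a\<^sup>2 - ?b\<^sup>2"
        by (simp add: F'_def PdPw[OF z sT, symmetric] inner_simps power2_norm_eq_inner[symmetric] algebra_simps)
      ultimately have "F' s \<le> - 2 * z * (1 + z) * ?a\<^sup>2 + ((1 + z) * ?a)\<^sup>2 - (1 + z) * ?a\<^sup>2" by linarith
      also have "\<dots> = - (z * (1 + z) * ?a\<^sup>2)" by (simp add: power2_eq_square algebra_simps)
      also have "\<dots> \<le> 0" using z0 by simp
      finally show "F' s \<le> 0" .
    qed (use t in simp)
    moreover have "P z (d 0) = 0" using u v by (simp add: d_def is_solution_def P_0)
    ultimately have "(1 + z) * (norm (P z (d t)))\<^sup>2 \<le> integral {0..t} ?q" by (simp add: F_def)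
    then show ?thesis by (simp only: PdPw[OF z t])
  qed
  have "(norm (w t))\<^sup>2 \<le> (1 + K\<^sup>2) * integral {0..t} (\<lambda>s. (norm (w s))\<^sup>2)" if t: "t \<in> {0..T}" for t
  proof (rule norm_le_if_partial)
    fix n
    have c: "continuous_on {0..t} w" "continuous_on {0..t} k"
      by (rule continuous_on_subset[OF cw] continuous_on_subset[OF ck], use t in auto)+
    have "(\<Sum>z\<in>Lam n. (norm (P z (w t)))\<^sup>2) \<le> (\<Sum>z\<in>Lam n. integral {0..t} (\<lambda>s. (norm (P z (w s)))\<^sup>2 + (norm (P z (k s)))\<^sup>2))"
      by (rule sum_mono) (rule mode[OF _ t])
    also have "\<dots> = integral {0..t} (\<lambda>s. \<Sum>z\<in>Lam n. (norm (P z (w s)))\<^sup>2 + (norm (P z (k s)))\<^sup>2)"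
      by (rule integral_sum[OF finite_Lam, symmetric], rule integrable_continuous_real)
        (intro continuous_intros continuous_on_P c)
    also have "\<dots> \<le> integral {0..t} (\<lambda>s. (1 + K\<^sup>2) * (norm (w s))\<^sup>2)"
    proof (rule integral_le)
      fix s assume s: "s \<in> {0..t}"
      have "(norm (k s))\<^sup>2 \<le> (K * norm (w s))\<^sup>2" using k_le[of s] s t by (intro power_mono) auto
      then show "(\<Sum>z\<in>Lam n. (norm (P z (w s)))\<^sup>2 + (norm (P z (k s)))\<^sup>2) \<le> (1 + K\<^sup>2) * (norm (w s))\<^sup>2"
        using bessel[OF finite_Lam[of n], of "w s"] bessel[OF finite_Lam[of n], of "k s"]
        by (simp add: sum.distrib algebra_simps power_mult_distrib)
    qed (intro integrable_continuous_real continuous_intros continuous_on_P c)+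
    finally show "(\<Sum>z\<in>Lam n. (norm (P z (w t)))\<^sup>2) \<le> (1 + K\<^sup>2) * integral {0..t} (\<lambda>s. (norm (w s))\<^sup>2)" by simp
  qed
  then have "(norm (w T))\<^sup>2 \<le> 0"
    by (intro gronwall_zero[of T "\<lambda>t. (norm (w t))\<^sup>2" "1 + K\<^sup>2"]) (use T in \<open>auto intro!: continuous_intros cw\<close>)
  then have "w T = 0" by simp
  then have "d T = 0" using dG[of T] T G_diff[of 0 0] by simp
  then show ?thesis by (simp add: d_def)
qed

end

section \<open>The nonlinear problem\<close>

locale nonlinear_problem = spectral_gap D A lam \<delta> \<kappa> "p * lam" + discrete_positive D A
  for D :: "'a::{real_inner,complete_space} set" and A :: "'a \<Rightarrow> 'a" and lam \<delta> \<kappa> p :: real +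
  fixes f :: "'a \<Rightarrow> 'a" and R L :: real
  assumes p_pos: "0 < p" and L_nonneg: "0 \<le> L" and R_pos: "0 < R" and f_zero: "f 0 = 0"
    and f_bound: "u \<in> half_ball D A R \<Longrightarrow> v \<in> half_ball D A R \<Longrightarrow>
      norm (f u - f v) \<le> L * (half_norm D A u powr p + half_norm D A v powr p) * half_norm D A (u - v)"
begin

text \<open>The solutions compared for uniqueness may range over all of
  \<open>half_ball D A R\<close>, so the constant is taken at radius \<open>R\<close> and not at the
  small radius of the fixed point argument.\<close>

lemma f_lipschitz:
  assumes "u \<in> half_ball D A R" "v \<in> half_ball D A R"
  shows "norm (f u - f v) \<le> (2 * L * R powr p) * half_norm D A (u - v)"
proof -
  have *: "half_norm D A w powr p \<le> R powr p" if "w \<in> half_ball D A R" for w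
    using that p_pos by (intro powr_mono2) (auto simp: half_ball_def half_norm_def)
  have "norm (f u - f v) \<le> L * (half_norm D A u powr p + half_norm D A v powr p) * half_norm D A (u - v)"
    by (rule f_bound[OF assms])
  also have "\<dots> \<le> L * (R powr p + R powr p) * half_norm D A (u - v)"
    using L_nonneg *[OF assms(1)] *[OF assms(2)]
    by (intro mult_right_mono mult_left_mono add_mono) (auto simp: half_norm_def)
  finally show ?thesis by (simp add: mult_ac)
qed

lemma G_0: "G 0 = 0" using G_diff[of 0 0] by simp

lemma f_G_diff:
  assumes "norm a \<le> r" "norm b \<le> r" "r < R"
  shows "norm (f (G a) - f (G b)) \<le> 2 * L * r powr p * norm (a - b)"
proof -
  have "norm a powr p \<le> r powr p" "norm b powr p \<le> r powr p"
    using assms p_pos by (auto intro!: powr_mono2)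
  then have "L * (norm a powr p + norm b powr p) * norm (a - b) \<le> L * (r powr p + r powr p) * norm (a - b)"
    using L_nonneg by (intro mult_right_mono mult_left_mono add_mono) auto
  moreover have "norm (f (G a) - f (G b)) \<le> L * (norm a powr p + norm b powr p) * norm (a - b)"
    using f_bound[of "G a" "G b"] assms by (simp add: half_ball_G half_norm_G G_diff[symmetric])
  ultimately show ?thesis by (simp add: mult_ac)
qed

lemma f_G_norm:
  assumes "norm a \<le> r" "r < R"
  shows "norm (f (G a)) \<le> L * r powr p * r"
proof -
  have "norm (f (G a) - f (G 0)) \<le> L * (norm a powr p + 0) * norm (a - 0)"
    using f_bound[of "G a" "G 0"] assms R_pos
    by (simp add: half_ball_G half_norm_G G_diff[symmetric] order_le_less_trans)
  also have "\<dots> \<le> L * r powr p * r"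
    using assms L_nonneg p_pos by (intro mult_mono) (auto intro!: mult_left_mono powr_mono2)
  finally show ?thesis by (simp add: G_0 f_zero)
qed

lemma continuous_f_G:
  assumes x: "continuous_on S x" and r: "\<And>t. t \<in> S \<Longrightarrow> norm (x t) \<le> r" "r < R"
  shows "continuous_on S (\<lambda>t. f (G (x t)))"
  unfolding continuous_on_def
proof
  fix t assume t: "t \<in> S"
  have "((\<lambda>s. f (G (x s)) - f (G (x t))) \<longlongrightarrow> 0) (at t within S)"
  proof (rule Lim_null_comparison)
    show "\<forall>\<^sub>F s in at t within S. norm (f (G (x s)) - f (G (x t))) \<le> 2 * L * r powr p * norm (x s - x t)"
      unfolding eventually_at_filter by (intro always_eventually allI impI f_G_diff r t)
    have "((\<lambda>s. 2 * L * r powr p * norm (x s - x t)) \<longlongrightarrow> 2 * L * r powr p * norm (x t - x t)) (at t within S)"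
      using x t by (intro tendsto_intros) (auto simp: continuous_on_def)
    then show "((\<lambda>s. 2 * L * r powr p * norm (x s - x t)) \<longlongrightarrow> 0) (at t within S)" by simp
  qed
  then show "((\<lambda>s. f (G (x s))) \<longlongrightarrow> f (G (x t))) (at t within S)" by (simp add: LIM_zero_iff)
qed

text \<open>With \<open>u(t) = exp(-\<lambda>t) G (Y(t))\<close> the nonlinearity becomes \<open>rhs Y\<close>, which decays like
  \<open>exp(-p\<lambda>t)\<close> as long as \<open>Y\<close> is bounded.\<close>
definition rhs :: "(real \<Rightarrow> 'a) \<Rightarrow> real \<Rightarrow> 'a" where
  "rhs Y t = exp (lam * t) *\<^sub>R f (G (exp (- (lam * t)) *\<^sub>R Y t))"

lemma scaled_norm_le:
  assumes "norm (Y t) \<le> r" "0 \<le> t" "0 \<le> r"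
  shows "norm (exp (- (lam * t)) *\<^sub>R Y t) \<le> exp (- (lam * t)) * r" "exp (- (lam * t)) * r \<le> r"
    "norm (exp (- (lam * t)) *\<^sub>R Y t) \<le> r"
proof -
  show 1: "norm (exp (- (lam * t)) *\<^sub>R Y t) \<le> exp (- (lam * t)) * r" and 2: "exp (- (lam * t)) * r \<le> r"
    using assms lam_pos by (auto intro!: mult_left_mono mult_left_le_one_le)
  show "norm (exp (- (lam * t)) *\<^sub>R Y t) \<le> r" by (rule order_trans[OF 1 2])
qed

lemma powr_scaled:
  assumes "0 \<le> r" shows "(exp (- (lam * t)) * r) powr p = exp (- (p * lam * t)) * r powr p"
  using assms by (simp add: powr_mult exp_powr_real mult_ac)

lemma rhs_decaying:
  assumes Y: "continuous_on {0..} Y" "\<And>t. t \<ge> 0 \<Longrightarrow> norm (Y t) \<le> r" and r: "0 \<le> r" "r < R"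
  shows "decaying (L * r powr p * r) (rhs Y)"
  unfolding decaying_def
proof (intro conjI allI impI)
  show "0 \<le> L * r powr p * r" using L_nonneg r by simp
  have "continuous_on {0..} (\<lambda>t. f (G (exp (- (lam * t)) *\<^sub>R Y t)))"
    by (rule continuous_f_G[OF _ scaled_norm_le(3)[OF Y(2) _ r(1)] r(2)])
      (intro continuous_intros Y, simp_all)
  then show "continuous_on {0..} (rhs Y)" unfolding rhs_def by (intro continuous_intros)
  fix t :: real assume t: "0 \<le> t"
  let ?e = "exp (- (lam * t))"
  have "norm (f (G (?e *\<^sub>R Y t))) \<le> L * (?e * r) powr p * (?e * r)"
    using scaled_norm_le[of Y t r] Y(2)[OF t] t r by (intro f_G_norm) auto
  then have "exp (lam * t) * norm (f (G (?e *\<^sub>R Y t))) \<le> exp (lam * t) * (L * (?e * r) powr p * (?e * r))"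
    by (rule mult_left_mono) simp
  also have "\<dots> = L * r powr p * r * exp (- (p * lam * t))"
    unfolding powr_scaled[OF r(1)] by (simp add: exp_minus mult_ac)
  finally show "norm (rhs Y t) \<le> L * r powr p * r * exp (- (p * lam * t))" by (simp add: rhs_def)
qed

text \<open>The factor r^p in front of the distance \<open>d\<close> is what becomes small with
  \<open>r\<close> and turns the linear bound into a contraction.\<close>

lemma rhs_diff_decaying:
  assumes Y: "continuous_on {0..} Y" "\<And>t. t \<ge> 0 \<Longrightarrow> norm (Y t) \<le> r"
    and Z: "continuous_on {0..} Z" "\<And>t. t \<ge> 0 \<Longrightarrow> norm (Z t) \<le> r" and r: "0 \<le> r" "r < R"
    and d: "\<And>t. t \<ge> 0 \<Longrightarrow> norm (Y t - Z t) \<le> d" "0 \<le> d"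
  shows "decaying (2 * L * r powr p * d) (\<lambda>t. rhs Y t - rhs Z t)"
  unfolding decaying_def
proof (intro conjI allI impI)
  show "0 \<le> 2 * L * r powr p * d" using L_nonneg d by simp
  show "continuous_on {0..} (\<lambda>t. rhs Y t - rhs Z t)"
    using rhs_decaying[OF Y r] rhs_decaying[OF Z r] by (intro continuous_intros) (auto simp: decaying_def)
  fix t :: real assume t: "0 \<le> t"
  let ?e = "exp (- (lam * t))"
  have "norm (f (G (?e *\<^sub>R Y t)) - f (G (?e *\<^sub>R Z t))) \<le> 2 * L * (?e * r) powr p * norm (?e *\<^sub>R Y t - ?e *\<^sub>R Z t)"
    using scaled_norm_le[of Y t r] scaled_norm_le[of Z t r] Y(2)[OF t] Z(2)[OF t] t r by (intro f_G_diff) auto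
  also have "norm (?e *\<^sub>R Y t - ?e *\<^sub>R Z t) = ?e * norm (Y t - Z t)" by (simp flip: scaleR_diff_right)
  also have "2 * L * (?e * r) powr p * (?e * norm (Y t - Z t)) \<le> 2 * L * (?e * r) powr p * (?e * d)"
    using L_nonneg d(1)[OF t] by (intro mult_left_mono) auto
  finally have "exp (lam * t) * norm (f (G (?e *\<^sub>R Y t)) - f (G (?e *\<^sub>R Z t)))
      \<le> exp (lam * t) * (2 * L * (?e * r) powr p * (?e * d))" by (intro mult_left_mono) auto
  also have "\<dots> = 2 * L * r powr p * d * exp (- (p * lam * t))"
    unfolding powr_scaled[OF r(1)] by (simp add: exp_minus mult_ac)
  finally show "norm (rhs Y t - rhs Z t) \<le> 2 * L * r powr p * d * exp (- (p * lam * t))"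
    by (simp add: rhs_def flip: scaleR_diff_right)
qed

text \<open>In the ball of radius \<open>r\<close> the data use up r/2 and the nonlinear term at
  most r/4, so the ball is mapped into itself. Differences of images have zero data, both at time 0
  and at infinity, and \<open>modes_bound\<close> gives the factor 1/2.\<close>

lemma fixed_point:
  assumes v: "v \<in> eigenspace lam" and r: "0 < r" "r < R" and small: "K * (2 * L * r powr p) \<le> 1 / 2"
    and vw: "norm v + norm w \<le> r / 2"
  obtains Y where "continuous_on {0..} Y" "\<And>t. t \<ge> 0 \<Longrightarrow> norm (Y t) \<le> r" "modes lam (rhs Y) Y"
    "\<And>z. lam < z \<Longrightarrow> P z (Y 0) = P z w"
    "\<And>t. t \<ge> 0 \<Longrightarrow> norm (Y t - v) \<le> exp (- (\<delta> / 2 * t)) * r"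
proof -
  let ?C = "L * r powr p * r"
  \<comment> \<open>Bounded continuous functions on the whole line provide the complete space.
    Images are extended constantly to negative times by \<open>max t 0\<close>, so that their
    distance is controlled by times t \<ge> 0.\<close>
  define S where "S = (cball 0 r :: (real \<Rightarrow>\<^sub>C 'a) set)"
  have S_iff: "Y \<in> S \<longleftrightarrow> (\<forall>t. norm (apply_bcontfun Y t) \<le> r)" for Y
  proof
    assume "Y \<in> S"
    then show "\<forall>t. norm (apply_bcontfun Y t) \<le> r"
      using norm_bounded[of Y] by (auto simp: S_def intro: order_trans)
  next
    assume "\<forall>t. norm (apply_bcontfun Y t) \<le> r"
    then show "Y \<in> S" by (auto simp: S_def intro: norm_bound)
  qed
  have cont: "continuous_on {0..} (apply_bcontfun Y)" for Y :: "real \<Rightarrow>\<^sub>C 'a"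
    using apply_bcontfun[of Y] by (auto simp: bcontfun_def intro: continuous_on_subset)
  \<comment> \<open>The solution of the linear problem is described by a relation; the map \<Phi> is
    chosen from it afterwards, and the contraction estimate works with the relation alone.\<close>
  define image where "image Y Z \<longleftrightarrow> modes lam (rhs (apply_bcontfun Y)) (apply_bcontfun Z) \<and>
    (\<forall>z>lam. P z (Z 0) = P z w) \<and> (\<forall>z\<le>lam. ((\<lambda>t. P z (Z t)) \<longlongrightarrow> P z v) at_top) \<and>
    (\<forall>t. apply_bcontfun Z t = apply_bcontfun Z (max t 0)) \<and>
    (\<forall>t\<ge>0. norm (Z t - v) \<le> exp (- (\<delta> / 2 * t)) * (norm w + K * ?C))" for Y Z :: "real \<Rightarrow>\<^sub>C 'a"
  have KC: "K * ?C \<le> r / 4"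
  proof -
    have "K * (2 * L * r powr p) * (r / 2) \<le> 1 / 2 * (r / 2)"
      using small r by (intro mult_right_mono) auto
    then show ?thesis by (simp add: mult_ac)
  qed
  have KC0: "0 \<le> K * ?C" using K_nonneg L_nonneg r by simp
  have image_exists: "\<exists>Z. Z \<in> S \<and> image Y Z" if Y: "Y \<in> S" for Y
  proof -
    have dec: "decaying ?C (rhs (apply_bcontfun Y))"
      by (rule rhs_decaying[OF cont]) (use Y r S_iff in auto)
    obtain Z where Z: "continuous_on {0..} Z" "modes lam (rhs (apply_bcontfun Y)) Z"
      "\<And>z. lam < z \<Longrightarrow> P z (Z 0) = P z w" "\<And>z. z \<le> lam \<Longrightarrow> ((\<lambda>t. P z (Z t)) \<longlongrightarrow> P z v) at_top"
      using modes_exist[OF dec v] by blast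
    have W: "(\<Sum>z\<in>Lam n - Low. (norm (P z (Z 0)))\<^sup>2) \<le> (norm w)\<^sup>2" for n
    proof -
      have "(\<Sum>z\<in>Lam n - Low. (norm (P z (Z 0)))\<^sup>2) = (\<Sum>z\<in>Lam n - Low. (norm (P z w))\<^sup>2)"
        by (rule sum.cong) (use high Z(3) in auto)
      also have "\<dots> \<le> (norm w)\<^sup>2" by (rule bessel) (use finite_Lam in simp)
      finally show ?thesis .
    qed
    have bnd: "norm (Z t - v) \<le> exp (- (\<delta> / 2 * t)) * (norm w + K * ?C)" if "t \<ge> 0" for t
      by (rule modes_bound[OF Z(2) dec v Z(4) norm_ge_zero W that])
    have Z_le: "norm (Z t) \<le> r" if t: "t \<ge> 0" for t
    proof -
      have "exp (- (\<delta> / 2 * t)) * (norm w + K * ?C) \<le> 1 * (norm w + K * ?C)"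
        using KC0 \<delta>_pos t by (intro mult_right_mono) (auto simp: add_nonneg_nonneg)
      with bnd[OF t] have "norm (Z t - v) \<le> 1 * (norm w + K * ?C)" by (rule order_trans)
      also have "\<dots> \<le> norm w + r / 4" using KC by simp
      finally have "norm (Z t - v) \<le> norm w + r / 4" .
      moreover have "norm (Z t) \<le> norm (Z t - v) + norm v" by (metis diff_add_cancel norm_triangle_ineq)
      ultimately show ?thesis using vw r by linarith
    qed
    have bc: "(\<lambda>t. Z (max t 0)) \<in> bcontfun"
    proof (rule bcontfun_normI)
      show "continuous_on UNIV (\<lambda>t. Z (max t 0))"
        by (rule continuous_on_compose2[OF Z(1)]) (auto intro!: continuous_intros)
      show "norm (Z (max t 0)) \<le> r" for t by (rule Z_le) simp
    qed
    define B where "B = Bcontfun (\<lambda>t. Z (max t 0))"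
    have B: "apply_bcontfun B t = Z (max t 0)" for t
      unfolding B_def by (simp add: Bcontfun_inverse[OF bc])
    have "B \<in> S" unfolding S_iff B using Z_le by simp
    moreover have "modes lam (rhs (apply_bcontfun Y)) (apply_bcontfun B)"
      unfolding modes_def
    proof (intro allI impI)
      fix z t :: real assume t: "0 \<le> t"
      have "((\<lambda>t. P z (Z t)) has_vector_derivative
          - (z - lam) *\<^sub>R P z (Z t) + sqrt (1 + z) *\<^sub>R P z (rhs (apply_bcontfun Y) t)) (at t within {0..})"
        using Z(2) t by (simp add: modes_def)
      then have "((\<lambda>t. P z (apply_bcontfun B t)) has_vector_derivative
          - (z - lam) *\<^sub>R P z (Z t) + sqrt (1 + z) *\<^sub>R P z (rhs (apply_bcontfun Y) t)) (at t within {0..})"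
        by (rule has_vector_derivative_transform[rotated 2]) (use t in \<open>auto simp: B max_def\<close>)
      then show "((\<lambda>t. P z (apply_bcontfun B t)) has_vector_derivative
          - (z - lam) *\<^sub>R P z (apply_bcontfun B t) + sqrt (1 + z) *\<^sub>R P z (rhs (apply_bcontfun Y) t)) (at t within {0..})"
        using t by (simp add: B max_def)
    qed
    moreover have "((\<lambda>t. P z (apply_bcontfun B t)) \<longlongrightarrow> P z v) at_top" if "z \<le> lam" for z
      by (rule Lim_transform_eventually[OF Z(4)[OF that]], rule eventually_mono[OF eventually_ge_at_top[of 0]])
        (simp add: B max_def)
    ultimately have "B \<in> S \<and> image Y B"
      unfolding image_def using Z(3) bnd by (auto simp: B max_def)
    then show ?thesis by blast
  qed
  then obtain \<Phi> where \<Phi>: "\<And>Y. Y \<in> S \<Longrightarrow> \<Phi> Y \<in> S" "\<And>Y. Y \<in> S \<Longrightarrow> image Y (\<Phi> Y)" by metis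
  have contraction: "dist (\<Phi> Y1) (\<Phi> Y2) \<le> 1 / 2 * dist Y1 Y2" if Y: "Y1 \<in> S" "Y2 \<in> S" for Y1 Y2
  proof (rule dist_bound)
    fix t :: real
    let ?d = "dist Y1 Y2" and ?s = "max t 0"
    have im: "image Y1 (\<Phi> Y1)" "image Y2 (\<Phi> Y2)" using \<Phi>(2) Y by auto
    have dec: "decaying (2 * L * r powr p * ?d) (\<lambda>t. rhs (apply_bcontfun Y1) t - rhs (apply_bcontfun Y2) t)"
      by (rule rhs_diff_decaying[OF cont _ cont])
        (use Y r S_iff in \<open>auto simp: dist_norm[symmetric] dist_bounded\<close>)
    have m: "modes lam (\<lambda>t. rhs (apply_bcontfun Y1) t - rhs (apply_bcontfun Y2) t)
        (\<lambda>t. apply_bcontfun (\<Phi> Y1) t - apply_bcontfun (\<Phi> Y2) t)"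
      by (rule modes_diff) (use im in \<open>auto simp: image_def\<close>)
    have "norm ((\<Phi> Y1 ?s - \<Phi> Y2 ?s) - 0) \<le> exp (- (\<delta> / 2 * ?s)) * (0 + K * (2 * L * r powr p * ?d))"
    proof (rule modes_bound[OF m dec])
      show "0 \<in> eigenspace lam" using subspace_eigenspace by (rule subspace_0)
      fix z assume z: "z \<le> lam"
      have "((\<lambda>t. P z (\<Phi> Y1 t) - P z (\<Phi> Y2 t)) \<longlongrightarrow> P z v - P z v) at_top"
        using im z by (intro tendsto_diff) (auto simp: image_def)
      then show "((\<lambda>t. P z (\<Phi> Y1 t - \<Phi> Y2 t)) \<longlongrightarrow> P z 0) at_top" by (simp add: P_diff P_0)
    next
      fix n
      have "P z (\<Phi> Y1 0 - \<Phi> Y2 0) = 0" if "z \<in> Lam n - Low" for z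
        using im high[OF that] by (simp add: image_def P_diff)
      then show "(\<Sum>z\<in>Lam n - Low. (norm (P z (\<Phi> Y1 0 - \<Phi> Y2 0)))\<^sup>2) \<le> 0\<^sup>2" by simp
    qed simp_all
    also have "\<dots> \<le> 1 * (0 + K * (2 * L * r powr p * ?d))"
      using \<delta>_pos K_nonneg L_nonneg by (intro mult_right_mono) auto
    also have "\<dots> = K * (2 * L * r powr p) * ?d" by (simp add: mult_ac)
    also have "\<dots> \<le> 1 / 2 * ?d" using small by (intro mult_right_mono) auto
    finally have "dist (\<Phi> Y1 ?s) (\<Phi> Y2 ?s) \<le> 1 / 2 * ?d" by (simp add: dist_norm)
    moreover have "apply_bcontfun (\<Phi> Y1) t = \<Phi> Y1 ?s" "apply_bcontfun (\<Phi> Y2) t = \<Phi> Y2 ?s"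
      using im by (auto simp: image_def)
    ultimately show "dist (\<Phi> Y1 t) (\<Phi> Y2 t) \<le> 1 / 2 * ?d" by simp
  qed
  have "\<exists>!Y. Y \<in> S \<and> \<Phi> Y = Y"
  proof (rule Banach_fix[where c="1 / 2"])
    show "complete S" unfolding S_def by (simp add: complete_eq_closed)
    show "S \<noteq> {}" using r by (auto simp: S_def)
    show "\<Phi> ` S \<subseteq> S" using \<Phi>(1) by blast
  qed (use contraction in auto)
  then obtain Y where Y: "Y \<in> S" "\<Phi> Y = Y" by blast
  then have im: "image Y Y" using \<Phi>(2)[of Y] by simp
  have "norm (Y t - v) \<le> exp (- (\<delta> / 2 * t)) * r" if "t \<ge> 0" for t
  proof -
    have "norm w + K * ?C \<le> r" using KC vw r norm_ge_zero[of v] by linarith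
    then have "exp (- (\<delta> / 2 * t)) * (norm w + K * ?C) \<le> exp (- (\<delta> / 2 * t)) * r" by (rule mult_left_mono) simp
    then show ?thesis using im that unfolding image_def by (meson order_trans)
  qed
  then show ?thesis using that[OF cont, of Y] Y(1) im by (auto simp: S_iff image_def)
qed

text \<open>The smallness condition reads 2 K L r^p \<le> 1/2, so r^p \<le> 1/c with c = 4 K L + 1
  is enough. The summand 1 keeps \<open>c\<close> positive when K L = 0.\<close>

lemma small_radius_exists:
  obtains r where "0 < r" "r < R" "K * (2 * L * r powr p) \<le> 1 / 2"
proof -
  define c where "c = 4 * K * L + 1"
  have c: "c > 0" using K_nonneg L_nonneg by (simp add: c_def add_nonneg_pos)
  define r where "r = min (R / 2) ((1 / c) powr (1 / p))"
  have r: "0 < r" "r < R" using R_pos c by (auto simp: r_def)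
  have "r powr p \<le> ((1 / c) powr (1 / p)) powr p" using r p_pos by (intro powr_mono2) (auto simp: r_def)
  also have "\<dots> = 1 / c" using c p_pos by (simp add: powr_powr)
  finally have "2 * K * L * r powr p \<le> 2 * K * L * (1 / c)"
    using K_nonneg L_nonneg by (intro mult_left_mono) auto
  also have "\<dots> \<le> 1 / 2" using c by (simp add: c_def field_simps)
  finally show ?thesis using that[OF r] by (simp add: mult_ac)
qed

section \<open>From the fixed point to the solution and its asymptotics\<close>

lemma H_plus_P_eq_0:
  assumes "w \<in> H_plus D A lam" "z \<le> lam" shows "P z w = 0"
proof -
  have "P z w \<bullet> w = 0"
  proof (rule inner_closure_span_eq_0[OF assms(1)[unfolded H_plus_def]])
    fix s assume "s \<in> {v. \<exists>z>lam. eigenvector D A z v}"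
    then obtain z' where "z' > lam" "s \<in> eigenspace z'" by (auto simp: eigenvector_iff)
    then show "P z w \<bullet> s = 0" using assms(2) by (intro eigenspace_orthogonal[OF P_in]) auto
  qed
  then show ?thesis by (simp add: P_inner_self)
qed

lemma H_minusI:
  assumes "\<And>z. lam < z \<Longrightarrow> P z u = 0" shows "u \<in> H_minus D A lam"
proof -
  have "Q n u \<in> span {v. \<exists>z\<le>lam. eigenvector D A z v}" for n
    unfolding Q_def
  proof (rule span_sum)
    fix z
    show "P z u \<in> span {v. \<exists>z\<le>lam. eigenvector D A z v}"
    proof (cases "P z u = 0")
      case False
      then have "z \<le> lam" using assms[of z] by force
      then show ?thesis using False P_in by (intro span_base) (auto simp: eigenvector_iff)
    qed (simp add: span_0)
  qed
  then show ?thesis unfolding H_minus_def closure_sequential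
    using Q_tendsto by (intro exI[of _ "\<lambda>n. Q n u"] conjI allI)
qed

text \<open>By the product rule the factor exp(-lam t) removes the shift by \<open>lam\<close> and
  the scaling in \<open>rhs\<close>, so \<open>x\<close> has the modes of the original equation.
  Uniqueness holds against all competitors because \<open>f\<close> is Lipschitz on the whole
  ball.\<close>

lemma solution_from_fixed_point:
  assumes Y: "continuous_on {0..} Y" "\<And>t. t \<ge> 0 \<Longrightarrow> norm (Y t) \<le> r" "modes lam (rhs Y) Y" and r: "0 \<le> r" "r < R"
  shows "is_unique_global_solution D A R f (G (Y 0)) (\<lambda>t. G (exp (- (lam * t)) *\<^sub>R Y t))"
proof -
  define x where "x t = exp (- (lam * t)) *\<^sub>R Y t" for t
  define g where "g t = f (G (x t))" for t
  have cx: "continuous_on {0..} x" unfolding x_def by (intro continuous_intros Y)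
  have x_le: "norm (x t) \<le> r" if "t \<ge> 0" for t
    unfolding x_def by (rule scaled_norm_le(3)[of Y t r, OF Y(2)[OF that] that r(1)])
  have cg: "continuous_on {0..} g" unfolding g_def by (rule continuous_f_G[OF cx _ r(2)]) (use x_le in simp)
  have m: "modes 0 g x"
    unfolding modes_def
  proof (intro allI impI)
    fix z t :: real assume t: "0 \<le> t"
    have "((\<lambda>t. P z (Y t)) has_vector_derivative - (z - lam) *\<^sub>R P z (Y t) + sqrt (1 + z) *\<^sub>R P z (rhs Y t)) (at t within {0..})"
      using Y(3) t by (simp add: modes_def)
    moreover have "((\<lambda>t. exp (- (lam * t))) has_real_derivative - lam * exp (- (lam * t))) (at t within {0..})"
      by (auto intro!: derivative_eq_intros)
    ultimately have "((\<lambda>t. exp (- (lam * t)) *\<^sub>R P z (Y t)) has_vector_derivative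
        exp (- (lam * t)) *\<^sub>R (- (z - lam) *\<^sub>R P z (Y t) + sqrt (1 + z) *\<^sub>R P z (rhs Y t)) +
        (- lam * exp (- (lam * t))) *\<^sub>R P z (Y t)) (at t within {0..})"
      by (intro has_vector_derivative_scaleR)
    moreover have "rhs Y t = exp (lam * t) *\<^sub>R g t" by (simp add: rhs_def g_def x_def)
    ultimately show "((\<lambda>t. P z (x t)) has_vector_derivative - (z - 0) *\<^sub>R P z (x t) + sqrt (1 + z) *\<^sub>R P z (g t)) (at t within {0..})"
      by (simp add: x_def P_scale exp_minus algebra_simps)
  qed
  have sol: "is_solution D A R f (G (x 0)) \<infinity> (\<lambda>t. G (x t))"
    by (rule is_solution_if_modes[OF cx cg m]) (use x_le r in \<open>auto simp: g_def intro: order_le_less_trans\<close>)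
  have x0: "x 0 = Y 0" by (simp add: x_def)
  have "v t = G (x t)" if v: "is_solution D A R f (G (x 0)) Tmax v" and t: "t \<ge> 0" "ereal t < Tmax" for Tmax v t
    by (rule solution_unique[OF sol v t(1) _ t(2) _ f_lipschitz]) (use L_nonneg in auto)
  then show ?thesis using sol unfolding is_unique_global_solution_def x0 by (simp add: x_def)
qed

lemma prescribed_asymptotics:
  "\<exists>r0>0. \<forall>v0 w0.
    eigenvector D A lam v0 \<longrightarrow> w0 \<in> H_plus D A lam \<inter> half_domain D A \<longrightarrow>
    half_norm D A v0 + half_norm D A w0 \<le> r0 \<longrightarrow>
    (\<exists>w1\<in>H_minus D A lam. w0 + w1 \<in> half_ball D A R \<and>
      (\<exists>u. is_unique_global_solution D A R f (w0 + w1) u \<and>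
         ((\<lambda>t. half_norm D A (exp (lam * t) *\<^sub>R u t - v0)) \<longlongrightarrow> 0) at_top))"
proof -
  obtain r where r: "0 < r" "r < R" and small: "K * (2 * L * r powr p) \<le> 1 / 2"
    using small_radius_exists by blast
  show ?thesis
  \<comment> \<open>\<open>G\<close> is an isometry, so the hypothesis on \<open>v0\<close> and
    \<open>w0\<close> becomes the bound r/2 on the data in \<open>fixed_point\<close>.\<close>
  proof (intro exI[of _ "r / 2"] conjI allI impI)
    show "0 < r / 2" using r by simp
    fix v0 w0
    assume v0: "eigenvector D A lam v0" and w0: "w0 \<in> H_plus D A lam \<inter> half_domain D A"
      and vw: "half_norm D A v0 + half_norm D A w0 \<le> r / 2"
    \<comment> \<open>On this eigenspace \<open>G\<close> divides by sqrt(1 + lam), so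
      \<open>v\<close> is the preimage of \<open>v0\<close>.\<close>
    define v where "v = sqrt (1 + lam) *\<^sub>R v0"
    have v0E: "v0 \<in> eigenspace lam" using v0 by (simp add: eigenvector_iff)
    have v: "v \<in> eigenspace lam" unfolding v_def by (rule subspace_scale[OF subspace_eigenspace v0E])
    have Gv: "G v = v0" using mult_eigen(2)[OF v, of "\<lambda>z. 1 / sqrt (1 + z)"] lam_pos by (simp add: G_def v_def)
    obtain w where Gw: "w0 = G w" using half_domain_G w0 by blast
    have Pw: "P z w = 0" if "z \<le> lam" "eigenvalue D A z" for z
      using H_plus_P_eq_0[of w0 z] w0 that eigenvalue_nonneg[of z] unfolding Gw by (auto simp: P_G)
    obtain Y where Y: "continuous_on {0..} Y" "\<And>t. t \<ge> 0 \<Longrightarrow> norm (Y t) \<le> r" "modes lam (rhs Y) Y"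
      "\<And>z. lam < z \<Longrightarrow> P z (Y 0) = P z w"
      "\<And>t. t \<ge> 0 \<Longrightarrow> norm (Y t - v) \<le> exp (- (\<delta> / 2 * t)) * r"
      using fixed_point[OF v r small, of w] vw half_norm_G[of v] half_norm_G[of w] by (auto simp: Gv Gw)
    define u where "u t = G (exp (- (lam * t)) *\<^sub>R Y t)" for t
    \<comment> \<open>Above \<open>lam\<close> the projections of \<open>Y 0\<close> and
      \<open>w\<close> agree, so this correction has only modes up to \<open>lam\<close>.\<close>
    define w1 where "w1 = G (Y 0 - w)"
    have sum: "w0 + w1 = G (Y 0)" by (simp add: w1_def Gw G_diff)
    have "w1 \<in> H_minus D A lam"
      by (rule H_minusI) (simp add: w1_def P_G P_diff Y(4))
    moreover have "w0 + w1 \<in> half_ball D A R"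
      unfolding sum half_ball_G using Y(2)[of 0] r by simp
    moreover have "is_unique_global_solution D A R f (w0 + w1) u"
      unfolding sum u_def using solution_from_fixed_point[OF Y(1-3)] r by simp
    moreover have "((\<lambda>t. half_norm D A (exp (lam * t) *\<^sub>R u t - v0)) \<longlongrightarrow> 0) at_top"
    proof -
      have eq: "half_norm D A (exp (lam * t) *\<^sub>R u t - v0) = norm (Y t - v)" for t
      proof -
        have "exp (lam * t) *\<^sub>R u t - v0 = G (Y t - v)"
          by (simp add: u_def G_scale G_diff Gv exp_minus)
        then show ?thesis by (simp add: half_norm_G)
      qed
      have "((\<lambda>t. norm (Y t - v)) \<longlongrightarrow> 0) at_top"
      proof (rule Lim_null_comparison)
        show "\<forall>\<^sub>F t in at_top. norm (norm (Y t - v)) \<le> exp (- (\<delta> / 2 * t)) * r"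
          by (rule eventually_mono[OF eventually_ge_at_top[of 0]]) (simp only: real_norm_def abs_norm_cancel Y(5))
        have "((\<lambda>t. exp (- (\<delta> / 2 * t)) * r) \<longlongrightarrow> 0 * r) at_top"
        proof (intro tendsto_mult_right filterlim_compose[OF exp_at_bot])
          show "LIM t at_top. - (\<delta> / 2 * t) :> at_bot"
            unfolding filterlim_uminus_at_bot
            using filterlim_tendsto_pos_mult_at_top[OF tendsto_const _ filterlim_ident, of "\<delta> / 2"] \<delta>_pos by simp
        qed
        then show "((\<lambda>t. exp (- (\<delta> / 2 * t)) * r) \<longlongrightarrow> 0) at_top" by simp
      qed
      then show ?thesis by (simp add: eq)
    qed
    ultimately show "\<exists>w1\<in>H_minus D A lam. w0 + w1 \<in> half_ball D A R \<and>
      (\<exists>u. is_unique_global_solution D A R f (w0 + w1) u \<and>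
         ((\<lambda>t. half_norm D A (exp (lam * t) *\<^sub>R u t - v0)) \<longlongrightarrow> 0) at_top)" by blast
  qed
qed

end

theorem theorem2p9:
  fixes D :: "'a::{real_inner, complete_space} set"
    and A f :: "'a \<Rightarrow> 'a"
    and R lam :: real
  assumes selfadjoint: "selfadjoint_operator D A"
    and nonneg: "nonnegative_operator D A"
    and R_pos: "R > 0"
    and spectrum: "finite (operator_spectrum D A) \<or>
      (\<exists>z :: nat \<Rightarrow> real. strict_mono z \<and> range z = operator_spectrum D A \<and>
         (\<forall>n. eigenvalue D A (z n)))"
    and f_bound: "\<exists>p>0. \<exists>L\<ge>0. \<forall>u\<in>half_ball D A R. \<forall>v\<in>half_ball D A R.
      norm (f u - f v) \<le>
        L * (half_norm D A u powr p + half_norm D A v powr p) * half_norm D A (u - v)"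
    and f_zero: "f 0 = 0"
    and lambda_pos: "lam > 0"
    and lambda_eigenvalue: "eigenvalue D A lam"
  shows "\<exists>r0>0. \<forall>v0 w0.
    eigenvector D A lam v0 \<longrightarrow> w0 \<in> H_plus D A lam \<inter> half_domain D A \<longrightarrow>
    half_norm D A v0 + half_norm D A w0 \<le> r0 \<longrightarrow>
    (\<exists>w1\<in>H_minus D A lam. w0 + w1 \<in> half_ball D A R \<and>
      (\<exists>u. is_unique_global_solution D A R f (w0 + w1) u \<and>
         ((\<lambda>t. half_norm D A (exp (lam * t) *\<^sub>R u t - v0)) \<longlongrightarrow> 0) at_top))"
proof -
  obtain p L where p: "p > 0" and L: "L \<ge> 0"
    and bound: "\<And>u v. u \<in> half_ball D A R \<Longrightarrow> v \<in> half_ball D A R \<Longrightarrow> norm (f u - f v) \<le>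
        L * (half_norm D A u powr p + half_norm D A v powr p) * half_norm D A (u - v)"
    using f_bound by blast
  interpret discrete_selfadjoint D A
    by (rule discrete_selfadjointI[OF selfadjoint nonneg spectrum])
  obtain \<delta> \<kappa> where gap: "spectral_gap D A lam \<delta> \<kappa> (p * lam)"
    using spectral_gap_exists[of lam "p * lam"] lambda_pos p by (auto intro: mult_pos_pos)
  interpret spectral_gap D A lam \<delta> \<kappa> "p * lam" by (rule gap)
  interpret nonlinear_problem D A lam \<delta> \<kappa> p f R L
    using lambda_pos lambda_eigenvalue p L R_pos f_zero bound by unfold_locales auto
  show ?thesis by (rule prescribed_asymptotics)
qed


end
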